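(* Let $\mu$ be a finitely supported, non-degenerate, symmetric probability measure on $\mathrm{DA}(\mathbb{T})$. Then the $L_1$-isoperimetric profile satisfies $$\Lambda_{1,\mathrm{DA}(\mathbb{T}),\mu}(v)\simeq\frac{1}{\log\log v},$$ and the return probability satisfies $$\mu^{(2n)}(e)\simeq e^{-n/(\log n)^2}.$$
   Context: Tree and groups. Fix an integer $q\ge 2$, let $\mathcal{A}_q=\{0,\dots,q-1\}$, and let the symmetric group $\mathfrak{S}_q$ act on $\mathcal{A}_q$ on the right, $t\mapsto t.\sigma$. For $m\in\mathbb{Z}$ let $H_m$ be the set of sequences $(u_k)_{k\le m}$ indexed by integers $k\le m$, with values in $\mathcal{A}_q$, and equal to $0$ for all sufficiently negative $k$. The $(q+1)$-regular tree $\mathbb{T}$ has vertex set $\bigsqcup_{m\in\mathbb{Z}}H_m$, each vertex of $H_m$ being joined by an edge to its ancestor in $H_{m-1}$ obtained by deleting the last entry; for a vertex $v$ and $t\in\mathcal{A}_q$, $vt$ is the child of $v$ obtained by appending $t$. Let $\omega(n)\in H_{-n}$ be the zero sequence, $o=\omega(0)$, and $\omega$ the end of $\mathbb{T}$ represented by the ray $(\omega(n))_{n\ge0}$. $\mathrm{Aff}(\mathbb{T})$ is the group of graph automorphisms of $\mathbb{T}$ fixing $\omega$; it acts on the right ($v\mapsto v.g$; in $gh$, $g$ is applied first). Put $\beta(v)=m$ for $v\in H_m$ and let $\Phi:\mathrm{Aff}(\mathbb{T})\to\mathbb{Z}$ be the homomorphism $\Phi(g)=\beta(v.g)-\beta(v)$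 (independent of $v$), with kernel $\mathrm{Hor}(\mathbb{T})$. Let $\alpha\in\mathrm{Aff}(\mathbb{T})$ be the shift $(u_k)_{k\le m}\mapsto(u_{k-1})_{k\le m+1}$, so $\Phi(\alpha)=1$. For $\gamma\in\mathrm{Hor}(\mathbb{T})$ the portrait of $\gamma$ is the function $v\mapsto\gamma[v]\in\mathfrak{S}_q$ determined by $(vt).\gamma=(v.\gamma)(t.\gamma[v])$ for all vertices $v$ and $t\in\mathcal{A}_q$. Every $g\in\mathrm{Aff}(\mathbb{T})$ is uniquely $g=\gamma\alpha^m$ with $\gamma\in\mathrm{Hor}(\mathbb{T})$, $m\in\mathbb{Z}$, and one sets $g[v]:=\gamma[v]$. The discrete affine group is $\mathrm{DA}(\mathbb{T})=\{g\in\mathrm{Aff}(\mathbb{T}): g[v]=e \text{ for all but finitely many } v\}$. $\mu$ is non-degenerate if its support generates $\mathrm{DA}(\mathbb{T})$ as a semigroup; symmetric means $\mu(g)=\mu(g^{-1})$; $\mu^{(2n)}$ is the $2n$-fold convolution power and $e$ the identity. Isoperimetric profile. For a finitely generated group $\Gamma$ and a symmetric probability measure $\mu$ on $\Gamma$, $\Lambda_{1,\Gamma,\mu}:[1,\infty)\to\mathbb{R}$ is $$\Lambda_{1,\Gamma,\mu}(v)=\inf\Big\{\tfrac12\sum_{x,y\in\Gamma}|f(x)-f(xy)|\,\mu(y)\ :\ f:\Gamma\to\mathbb{R},\ |\mathrm{supp} f|\le v,\ \|f\|_1=1\Big\}.$$ Equivalence. For positive functions $f,g$ (defined for all large reals or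 all large integers; arguments are rounded to integers when a function is only defined on integers), $f\lesssim g$ means there are constants $C_1,C_2>0$ with $f(t)\le C_1g(C_2t)$ for all large enough $t$; $f\simeq g$ means $f\lesssim g$ and $g\lesssim f$. *)

theory Defs
  imports
    "HOL-Probability.Probability"
    "HOL-Algebra.Group"
    "HOL-Combinatorics.Permutations"
    "HOL-Library.FuncSet"
begin

text \<open>
  A vertex is a pair \<open>(m, u)\<close> with \<open>u\<close> in \<open>H q m\<close>; the first component makes the
  union of the \<open>H q m\<close> disjoint. Sequences are extensional functions, i.e. they take the value
  \<open>undefined\<close> at the indices \<open>k > m\<close>. The alphabet is the set of naturals below \<open>q\<close>.
\<close>

type_synonym vertex = "int \<times> (int \<Rightarrow> nat)"

definition H :: "nat \<Rightarrow> int \<Rightarrow> (int \<Rightarrow> nat) set" where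
  "H q m = {u \<in> {..m} \<rightarrow>\<^sub>E {..<q}. \<exists>N\<le>m. \<forall>k\<le>N. u k = 0}"

definition verts :: "nat \<Rightarrow> vertex set" where
  "verts q = Sigma UNIV (H q)"

definition ancestor :: "vertex \<Rightarrow> vertex" where
  "ancestor v = (fst v - 1, restrict (snd v) {..fst v - 1})"

definition child :: "vertex \<Rightarrow> nat \<Rightarrow> vertex" where
  "child v t = (fst v + 1, (snd v)(fst v + 1 := t))"

definition adj :: "nat \<Rightarrow> vertex \<Rightarrow> vertex \<Rightarrow> bool" where
  "adj q v w \<longleftrightarrow> v \<in> verts q \<and> w \<in> verts q \<and> (w = ancestor v \<or> v = ancestor w)"

definition \<beta> :: "vertex \<Rightarrow> int" where
  "\<beta> v = fst v"

definition omega_ray :: "nat \<Rightarrow> vertex" where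
  "omega_ray n = (- int n, \<lambda>k\<in>{..- int n}. 0)"

definition ray :: "nat \<Rightarrow> (nat \<Rightarrow> vertex) \<Rightarrow> bool" where
  "ray q r \<longleftrightarrow> inj r \<and> (\<forall>n. adj q (r n) (r (Suc n)))"

text \<open>In a tree, injective paths are geodesics, and two rays are equivalent iff they share a tail.\<close>

definition end_of :: "nat \<Rightarrow> (nat \<Rightarrow> vertex) \<Rightarrow> (nat \<Rightarrow> vertex) set" where
  "end_of q r = {s. ray q s \<and> (\<exists>a b. \<forall>n. s (n + a) = r (n + b))}"

text \<open>
  Tree automorphisms are functions that are extensional on the vertex set, so that equality of
  functions is equality of automorphisms. The action \<open>v.g\<close> is written \<open>g v\<close>; in the
  product \<open>g \<otimes> h\<close> the factor \<open>g\<close> is applied first.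
\<close>

definition tree_auts :: "nat \<Rightarrow> (vertex \<Rightarrow> vertex) set" where
  "tree_auts q = {g \<in> extensional (verts q). bij_betw g (verts q) (verts q) \<and>
     (\<forall>v\<in>verts q. \<forall>w\<in>verts q. adj q (g v) (g w) \<longleftrightarrow> adj q v w)}"

definition Aff :: "nat \<Rightarrow> (vertex \<Rightarrow> vertex) monoid" where
  "Aff q = \<lparr>carrier = {g \<in> tree_auts q. (\<lambda>s. g \<circ> s) ` end_of q omega_ray = end_of q omega_ray},
            mult = (\<lambda>g h. compose (verts q) h g),
            one = (\<lambda>v\<in>verts q. v)\<rparr>"

text \<open>\<open>\<beta> (g v) - \<beta> v\<close> does not depend on \<open>v\<close>; it is evaluated at the root \<open>omega_ray 0\<close>.\<close>

definition \<Phi> :: "(vertex \<Rightarrow> vertex) \<Rightarrow> int" where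
  "\<Phi> g = \<beta> (g (omega_ray 0)) - \<beta> (omega_ray 0)"

definition Hor :: "nat \<Rightarrow> (vertex \<Rightarrow> vertex) set" where
  "Hor q = {g \<in> carrier (Aff q). \<Phi> g = 0}"

definition \<alpha> :: "nat \<Rightarrow> vertex \<Rightarrow> vertex" where
  "\<alpha> q = (\<lambda>v\<in>verts q. (fst v + 1, \<lambda>k\<in>{..fst v + 1}. snd v (k - 1)))"

definition hor_portrait :: "nat \<Rightarrow> (vertex \<Rightarrow> vertex) \<Rightarrow> vertex \<Rightarrow> nat \<Rightarrow> nat" where
  "hor_portrait q \<gamma> v =
     (THE \<sigma>. \<sigma> permutes {..<q} \<and> (\<forall>t<q. \<gamma> (child v t) = child (\<gamma> v) (\<sigma> t)))"

definition hor_part :: "nat \<Rightarrow> (vertex \<Rightarrow> vertex) \<Rightarrow> vertex \<Rightarrow> vertex" where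
  "hor_part q g =
     (THE \<gamma>. \<gamma> \<in> Hor q \<and> (\<exists>m::int. g = \<gamma> \<otimes>\<^bsub>Aff q\<^esub> (\<alpha> q [^]\<^bsub>Aff q\<^esub> m)))"

definition portrait :: "nat \<Rightarrow> (vertex \<Rightarrow> vertex) \<Rightarrow> vertex \<Rightarrow> nat \<Rightarrow> nat" where
  "portrait q g = hor_portrait q (hor_part q g)"

definition DA :: "nat \<Rightarrow> (vertex \<Rightarrow> vertex) monoid" where
  "DA q = (Aff q)\<lparr>carrier :=
     {g \<in> carrier (Aff q). finite {v \<in> verts q. portrait q g v \<noteq> id}}\<rparr>"

inductive_set semigroup_generated :: "('a, 'b) monoid_scheme \<Rightarrow> 'a set \<Rightarrow> 'a set"
  for G (structure) and S where
  incl: "x \<in> S \<Longrightarrow> x \<in> semigroup_generated G S"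
| mult: "x \<in> semigroup_generated G S \<Longrightarrow> y \<in> semigroup_generated G S \<Longrightarrow>
    x \<otimes> y \<in> semigroup_generated G S"

definition nondegenerate :: "('a, 'b) monoid_scheme \<Rightarrow> 'a pmf \<Rightarrow> bool" where
  "nondegenerate G \<mu> \<longleftrightarrow> semigroup_generated G (set_pmf \<mu>) = carrier G"

definition symmetric_measure :: "('a, 'b) monoid_scheme \<Rightarrow> 'a pmf \<Rightarrow> bool" where
  "symmetric_measure G \<mu> \<longleftrightarrow> (\<forall>g\<in>carrier G. pmf \<mu> g = pmf \<mu> (inv\<^bsub>G\<^esub> g))"

definition convolution :: "('a, 'b) monoid_scheme \<Rightarrow> 'a pmf \<Rightarrow> 'a pmf \<Rightarrow> 'a pmf" where
  "convolution G \<mu> \<nu> = map_pmf (\<lambda>(x, y). x \<otimes>\<^bsub>G\<^esub> y) (pair_pmf \<mu> \<nu>)"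

primrec conv_power :: "('a, 'b) monoid_scheme \<Rightarrow> 'a pmf \<Rightarrow> nat \<Rightarrow> 'a pmf" where
  "conv_power G \<mu> 0 = return_pmf \<one>\<^bsub>G\<^esub>"
| "conv_power G \<mu> (Suc n) = convolution G (conv_power G \<mu> n) \<mu>"

text \<open>
  Functions on the group are functions on the whole type of which only the values on the carrier
  are used. Meaningful for \<open>v \<ge> 1\<close> only: otherwise the infimum is over the empty set.
\<close>

definition isoperimetric_profile :: "('a, 'b) monoid_scheme \<Rightarrow> 'a pmf \<Rightarrow> real \<Rightarrow> real" where
  "isoperimetric_profile G \<mu> v =
     (INF f \<in> {f :: 'a \<Rightarrow> real. finite {x \<in> carrier G. f x \<noteq> 0} \<and>
                  real (card {x \<in> carrier G. f x \<noteq> 0}) \<le> v \<and>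
                  (\<Sum>\<^sub>\<infinity>x\<in>carrier G. \<bar>f x\<bar>) = 1}.
        1 / 2 * (\<Sum>\<^sub>\<infinity>(x, y)\<in>carrier G \<times> carrier G. \<bar>f x - f (x \<otimes>\<^bsub>G\<^esub> y)\<bar> * pmf \<mu> y))"

definition asymp_le :: "(real \<Rightarrow> real) \<Rightarrow> (real \<Rightarrow> real) \<Rightarrow> bool" (infix \<open>\<lesssim>\<close> 50) where
  "f \<lesssim> g \<longleftrightarrow> (\<exists>C1>0. \<exists>C2>0. \<forall>\<^sub>F t in at_top. f t \<le> C1 * g (C2 * t))"

definition asymp_equiv_scaled :: "(real \<Rightarrow> real) \<Rightarrow> (real \<Rightarrow> real) \<Rightarrow> bool" (infix \<open>\<simeq>\<close> 50) where
  "f \<simeq> g \<longleftrightarrow> f \<lesssim> g \<and> g \<lesssim> f"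

definition rounded :: "(nat \<Rightarrow> real) \<Rightarrow> real \<Rightarrow> real" where
  "rounded f t = f (nat (round t))"

end

theory Submission
  imports Defs "HOL-Real_Asymp.Real_Asymp"
begin

text \<open>
  Lower bound on the profile: for a word \<open>ts\<close> in \<open>0, 1\<close> of length \<open>r\<close>, an automorphism \<open>embed ts\<close> of word
  length \<open>O(r)\<close> maps the subtree below \<open>o\<close> onto the one below the vertex \<open>ts\<close>; conjugating a fixed element
  by it gives \<open>2^r\<close> elements of word length \<open>O(r)\<close> that act like the coordinate flips of a cube of
  dimension \<open>2^r\<close>. Edge isoperimetry in the cube then bounds the profile below by \<open>c / r\<close> for sets of size
  up to \<open>2^(2^r/4)\<close>. Upper bound: the function \<open>max 0 (2r - \<bar>\<Phi> g\<bar>)\<close> on the elements whose portrait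
  is supported in a window of height \<open>O(r)\<close> has support of size \<open>exp (exp (O(r)))\<close> and energy \<open>O(1/r)\<close>.
  For the return probability, the profile yields a Nash inequality through Cheeger's inequality, applied to
  the two-step walk (whence the care to use words of even length), and the same test function bounds
  the return probability below by log-convexity of \<open>n \<mapsto> \<parallel>P^n f\<parallel>\<^sup>2\<close>.
\<close>

subsection \<open>Dirichlet forms on a group\<close>

text \<open>The flips of the cube need not commute or be involutions: the isoperimetric argument
  only sees that each of them toggles its own Boolean coordinate of the group and leaves the
  coordinates of the others alone. In dimension d = 2^r, a function with support of size at most
  2^(d/4) varies along the d flips by at least half of its norm on average; one flip costs O(r)
  generators, and r is about log log of the size. The obstacle is parity: \<mu> need not charge the
  identity, so \<open>P\<close> may have spectrum near -1. The drop of the squared norm under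
  \<open>P\<close> is exactly the Dirichlet form of the two-step walk, which removes the problem but
  leaves only words of even length under control. Hence the element that is conjugated is a square:
  its length is even whatever the generators are. At time 2n the relevant sets have size up to 4
  e^n, so r is of order log n and each step loses a fraction of order 1 / (log n)^2. In the lower
  bound the support size exp(exp(C r)) may be as large as e^(sqrt n), which allows r of the same
  order.\<close>

locale symmetric_walk = group G for G (structure) +
  fixes \<mu> :: "'a pmf"
  assumes support_subset: "set_pmf \<mu> \<subseteq> carrier G"
    and finite_support: "finite (set_pmf \<mu>)"
    and symmetric: "symmetric_measure G \<mu>"
begin

text \<open>Values off the carrier are arbitrary, as in the definition of the profile, so sums and
  supports look at the carrier only. For functions of finite support \<open>tot_eq_sum\<close> turns
  the infinite sum into a finite one.\<close>

definition tot :: "('a \<Rightarrow> real) \<Rightarrow> real" where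
  "tot f = infsum f (carrier G)"

definition supp :: "('a \<Rightarrow> real) \<Rightarrow> 'a set" where
  "supp f = {x \<in> carrier G. f x \<noteq> 0}"

abbreviation fin_supp :: "('a \<Rightarrow> real) \<Rightarrow> bool" where
  "fin_supp f \<equiv> finite (supp f)"

lemma tot_eq_sum:
  assumes "finite F" "F \<subseteq> carrier G" "supp f \<subseteq> F"
  shows "tot f = sum f F"
proof -
  have "tot f = infsum f F"
    unfolding tot_def by (rule infsum_cong_neutral) (use assms in \<open>auto simp: supp_def\<close>)
  then show ?thesis using assms by simp
qed

lemma tot_cong: "(\<And>x. x \<in> carrier G \<Longrightarrow> f x = g x) \<Longrightarrow> tot f = tot g"
  unfolding tot_def by (rule infsum_cong) auto

lemma fin_supp_le:
  assumes "fin_supp f" "\<And>x. x \<in> carrier G \<Longrightarrow> f x = 0 \<Longrightarrow> g x = 0"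
  shows "fin_supp g"
  by (rule finite_subset[OF _ assms(1)]) (use assms(2) in \<open>auto simp: supp_def\<close>)

lemma fin_supp_le2:
  assumes "fin_supp f" "fin_supp g"
    "\<And>x. x \<in> carrier G \<Longrightarrow> f x = 0 \<Longrightarrow> g x = 0 \<Longrightarrow> h x = 0"
  shows "fin_supp h"
  by (rule finite_subset[OF _ finite_UnI[OF assms(1,2)]]) (use assms(3) in \<open>auto simp: supp_def\<close>)

lemma fin_supp_add: "fin_supp f \<Longrightarrow> fin_supp g \<Longrightarrow> fin_supp (\<lambda>x. f x + g x)"
  by (erule fin_supp_le2) auto

lemma fin_supp_diff: "fin_supp f \<Longrightarrow> fin_supp g \<Longrightarrow> fin_supp (\<lambda>x. f x - g x)"
  by (erule fin_supp_le2) auto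

lemma fin_supp_cmult: "fin_supp f \<Longrightarrow> fin_supp (\<lambda>x. c * f x)"
  by (erule fin_supp_le) auto

lemma fin_supp_mult: "fin_supp f \<Longrightarrow> fin_supp (\<lambda>x. f x * g x)"
  by (erule fin_supp_le) auto

lemma fin_supp_mult2: "fin_supp g \<Longrightarrow> fin_supp (\<lambda>x. f x * g x)"
  by (erule fin_supp_le) auto

lemma fin_supp_power2: "fin_supp f \<Longrightarrow> fin_supp (\<lambda>x. (f x)\<^sup>2)"
  by (erule fin_supp_le) auto

lemma fin_supp_abs: "fin_supp f \<Longrightarrow> fin_supp (\<lambda>x. \<bar>f x\<bar>)"
  by (erule fin_supp_le) auto

lemma bij_betw_mult_right: "y \<in> carrier G \<Longrightarrow> bij_betw (\<lambda>x. x \<otimes> y) (carrier G) (carrier G)"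
  by (rule bij_betw_byWitness[where f' = "\<lambda>x. x \<otimes> inv y"]) (auto simp: m_assoc)

lemma bij_betw_mult_left: "y \<in> carrier G \<Longrightarrow> bij_betw (\<lambda>x. y \<otimes> x) (carrier G) (carrier G)"
  by (rule bij_betw_byWitness[where f' = "\<lambda>x. inv y \<otimes> x"]) (auto simp: m_assoc[symmetric])

lemma fin_supp_shift:
  assumes "fin_supp f" "y \<in> carrier G"
  shows "fin_supp (\<lambda>x. f (x \<otimes> y))"
proof (rule finite_imageD)
  show "finite ((\<lambda>x. x \<otimes> y) ` supp (\<lambda>x. f (x \<otimes> y)))"
    by (rule finite_subset[OF _ assms(1)]) (use assms(2) in \<open>auto simp: supp_def\<close>)
  show "inj_on (\<lambda>x. x \<otimes> y) (supp (\<lambda>x. f (x \<otimes> y)))"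
    using bij_betw_mult_right[OF assms(2)] unfolding bij_betw_def
    by (auto intro: inj_on_subset simp: supp_def)
qed

lemma fin_supp_sum:
  assumes "finite I" "\<And>i. i \<in> I \<Longrightarrow> fin_supp (f i)"
  shows "fin_supp (\<lambda>x. \<Sum>i\<in>I. f i x)"
  using assms by (induction I rule: finite_induct) (auto simp: supp_def intro: fin_supp_add[unfolded supp_def])

lemma tot_shift: "y \<in> carrier G \<Longrightarrow> tot (\<lambda>x. f (x \<otimes> y)) = tot f"
  unfolding tot_def by (rule infsum_reindex_bij_betw[OF bij_betw_mult_right])

lemma tot_shift_left: "y \<in> carrier G \<Longrightarrow> tot (\<lambda>x. f (y \<otimes> x)) = tot f"
  unfolding tot_def by (rule infsum_reindex_bij_betw[OF bij_betw_mult_left])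

lemma fin_supp_summable:
  assumes "fin_supp f"
  shows "f summable_on carrier G"
proof -
  have "f summable_on supp f \<longleftrightarrow> f summable_on carrier G"
    by (rule summable_on_cong_neutral) (auto simp: supp_def)
  then show ?thesis using assms summable_on_finite by blast
qed

lemma tot_add: "fin_supp f \<Longrightarrow> fin_supp g \<Longrightarrow> tot (\<lambda>x. f x + g x) = tot f + tot g"
  unfolding tot_def by (intro infsum_add fin_supp_summable)

lemma tot_cmult: "tot (\<lambda>x. c * f x) = c * tot f"
  unfolding tot_def by (rule infsum_cmult_right')

lemma tot_diff:
  assumes "fin_supp f" "fin_supp g"
  shows "tot (\<lambda>x. f x - g x) = tot f - tot g"
  using tot_add[OF assms(1) fin_supp_cmult[OF assms(2), of "-1"]] tot_cmult[of "-1" g] by simp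

lemma tot_sum:
  assumes "finite I" "\<And>i. i \<in> I \<Longrightarrow> fin_supp (f i)"
  shows "tot (\<lambda>x. \<Sum>i\<in>I. f i x) = (\<Sum>i\<in>I. tot (f i))"
  using assms
proof (induction I rule: finite_induct)
  case empty show ?case by (simp add: tot_def)
next
  case (insert i I) then show ?case by (simp add: tot_add fin_supp_sum)
qed

lemma tot_mono:
  assumes "fin_supp f" "fin_supp g" "\<And>x. x \<in> carrier G \<Longrightarrow> f x \<le> g x"
  shows "tot f \<le> tot g"
  unfolding tot_def by (intro infsum_mono fin_supp_summable assms)

lemma tot_nonneg: "(\<And>x. x \<in> carrier G \<Longrightarrow> f x \<ge> 0) \<Longrightarrow> tot f \<ge> 0"
  unfolding tot_def by (rule infsum_nonneg)

lemma tot_ge_card: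
  assumes "fin_supp f" "\<And>x. x \<in> carrier G \<Longrightarrow> f x \<ge> 0" "A \<subseteq> carrier G" "finite A"
    "\<And>x. x \<in> A \<Longrightarrow> f x \<ge> c"
  shows "c * card A \<le> tot f"
proof -
  have "c * card A = (\<Sum>x\<in>A. c)" by simp
  also have "\<dots> \<le> sum f A" using assms by (intro sum_mono) auto
  also have "\<dots> \<le> sum f (A \<union> supp f)" using assms by (intro sum_mono2) (auto simp: supp_def)
  also have "\<dots> = tot f" using assms by (intro tot_eq_sum[symmetric]) (auto simp: supp_def)
  finally show ?thesis .
qed

lemma tot_le_card:
  assumes "A \<subseteq> carrier G" "finite A" "supp f \<subseteq> A" "\<And>x. x \<in> A \<Longrightarrow> f x \<le> c"
  shows "tot f \<le> c * card A"
proof -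
  have "tot f = sum f A" using assms by (intro tot_eq_sum) auto
  also have "\<dots> \<le> (\<Sum>x\<in>A. c)" using assms by (intro sum_mono) auto
  finally show ?thesis by (simp add: mult.commute)
qed

lemma tot_Cauchy_Schwarz:
  assumes "fin_supp f" "fin_supp g"
  shows "(tot (\<lambda>x. f x * g x))\<^sup>2 \<le> tot (\<lambda>x. (f x)\<^sup>2) * tot (\<lambda>x. (g x)\<^sup>2)"
proof -
  let ?F = "supp f \<union> supp g"
  have "tot (\<lambda>x. f x * g x) = (\<Sum>x\<in>?F. f x * g x)" "tot (\<lambda>x. (f x)\<^sup>2) = (\<Sum>x\<in>?F. (f x)\<^sup>2)"
    "tot (\<lambda>x. (g x)\<^sup>2) = (\<Sum>x\<in>?F. (g x)\<^sup>2)"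
    using assms by (auto intro!: tot_eq_sum simp: supp_def)
  then show ?thesis using Cauchy_Schwarz_ineq_sum[of f g ?F] by simp
qed

section \<open>The Markov operator of the walk\<close>

definition P :: "('a \<Rightarrow> real) \<Rightarrow> 'a \<Rightarrow> real" where
  "P f x = (\<Sum>a\<in>set_pmf \<mu>. pmf \<mu> a * f (x \<otimes> a))"

lemma support_carrier: "a \<in> set_pmf \<mu> \<Longrightarrow> a \<in> carrier G"
  using support_subset by auto

lemma pmf_inv: "a \<in> carrier G \<Longrightarrow> pmf \<mu> (inv a) = pmf \<mu> a"
  using symmetric unfolding symmetric_measure_def by (metis)

lemma inv_support: "a \<in> set_pmf \<mu> \<Longrightarrow> inv a \<in> set_pmf \<mu>"
  using pmf_inv[of a] support_carrier[of a] by (metis set_pmf_iff)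

lemma sum_support_inv:
  "(\<Sum>a\<in>set_pmf \<mu>. pmf \<mu> a * F (inv a)) = (\<Sum>a\<in>set_pmf \<mu>. pmf \<mu> a * F a)"
  by (rule sum.reindex_bij_witness[where i = "\<lambda>a. inv a" and j = "\<lambda>a. inv a"])
     (auto simp: pmf_inv inv_support support_carrier)

lemma sum_support: "(\<Sum>a\<in>set_pmf \<mu>. pmf \<mu> a) = 1"
  by (rule sum_pmf_eq_1) (auto simp: finite_support)

lemma fin_supp_P: "fin_supp f \<Longrightarrow> fin_supp (P f)"
  unfolding P_def[abs_def]
  by (intro fin_supp_sum finite_support fin_supp_cmult fin_supp_shift support_carrier)

text \<open>Translating by \<open>inv a\<close> moves the shift from \<open>f\<close> to
  \<open>g\<close>, and the symmetry of \<mu> replaces \<open>inv a\<close> by \<open>a\<close>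
  again.\<close>

lemma P_selfadjoint:
  assumes "fin_supp f" "fin_supp g"
  shows "tot (\<lambda>x. P f x * g x) = tot (\<lambda>x. f x * P g x)"
proof -
  have "tot (\<lambda>x. P f x * g x) = tot (\<lambda>x. \<Sum>a\<in>set_pmf \<mu>. pmf \<mu> a * (f (x \<otimes> a) * g x))"
    by (simp add: P_def sum_distrib_right mult.assoc)
  also have "\<dots> = (\<Sum>a\<in>set_pmf \<mu>. pmf \<mu> a * tot (\<lambda>x. f (x \<otimes> a) * g x))"
    using assms by (subst tot_sum)
      (auto simp: tot_cmult finite_support intro!: fin_supp_cmult fin_supp_mult2)
  also have "\<dots> = (\<Sum>a\<in>set_pmf \<mu>. pmf \<mu> a * tot (\<lambda>x. f x * g (x \<otimes> inv a)))"
  proof (intro sum.cong refl arg_cong2[of _ _ _ _ "(*)"])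
    fix a assume "a \<in> set_pmf \<mu>"
    then have a: "a \<in> carrier G" by (rule support_carrier)
    have "tot (\<lambda>x. f (x \<otimes> a) * g x) = tot (\<lambda>x. f (x \<otimes> a) * g (x \<otimes> a \<otimes> inv a))"
      using a by (intro tot_cong) (simp add: m_assoc)
    also have "\<dots> = tot (\<lambda>x. f x * g (x \<otimes> inv a))"
      using a by (intro tot_shift[of a "\<lambda>x. f x * g (x \<otimes> inv a)"]) auto
    finally show "tot (\<lambda>x. f (x \<otimes> a) * g x) = tot (\<lambda>x. f x * g (x \<otimes> inv a))" .
  qed
  also have "\<dots> = (\<Sum>a\<in>set_pmf \<mu>. pmf \<mu> a * tot (\<lambda>x. f x * g (x \<otimes> a)))"
    by (rule sum_support_inv)
  also have "\<dots> = tot (\<lambda>x. \<Sum>a\<in>set_pmf \<mu>. pmf \<mu> a * (f x * g (x \<otimes> a)))"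
    by (simp only: tot_sum[OF finite_support fin_supp_cmult[OF fin_supp_mult[OF assms(1)]]] tot_cmult)
  also have "\<dots> = tot (\<lambda>x. f x * P g x)"
    by (simp add: P_def sum_distrib_left mult_ac)
  finally show ?thesis .
qed

text \<open>The expectation of \<open>F\<close> after two independent steps, that is, for the
  convolution square of \<mu>.\<close>

definition avg :: "('a \<Rightarrow> real) \<Rightarrow> real" where
  "avg F = (\<Sum>a\<in>set_pmf \<mu>. \<Sum>b\<in>set_pmf \<mu>. pmf \<mu> a * pmf \<mu> b * F (a \<otimes> b))"

lemma avg_const: "avg (\<lambda>_. c) = c"
proof -
  have "avg (\<lambda>_. c) = (\<Sum>a\<in>set_pmf \<mu>. pmf \<mu> a) * (\<Sum>a\<in>set_pmf \<mu>. pmf \<mu> a) * c"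
    unfolding sum_product by (simp only: avg_def sum_distrib_right)
  then show ?thesis by (simp add: sum_support)
qed

lemma avg_add: "avg (\<lambda>y. F y + F' y) = avg F + avg F'"
  by (simp add: avg_def sum.distrib distrib_left)

lemma avg_diff: "avg (\<lambda>y. F y - F' y) = avg F - avg F'"
  by (simp add: avg_def sum_subtractf right_diff_distrib)

lemma avg_cmult: "avg (\<lambda>y. c * F y) = c * avg F"
  by (simp add: avg_def sum_distrib_left mult_ac)

lemma avg_mono:
  "(\<And>a b. a \<in> set_pmf \<mu> \<Longrightarrow> b \<in> set_pmf \<mu> \<Longrightarrow> F (a \<otimes> b) \<le> F' (a \<otimes> b)) \<Longrightarrow> avg F \<le> avg F'"
  unfolding avg_def by (intro sum_mono mult_left_mono) auto

lemma avg_cong: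
  "(\<And>a b. a \<in> set_pmf \<mu> \<Longrightarrow> b \<in> set_pmf \<mu> \<Longrightarrow> F (a \<otimes> b) = F' (a \<otimes> b)) \<Longrightarrow> avg F = avg F'"
  unfolding avg_def by (intro sum.cong refl) auto

lemma avg_ge_term:
  assumes "\<And>y. y \<in> carrier G \<Longrightarrow> F y \<ge> 0" "a \<in> set_pmf \<mu>" "b \<in> set_pmf \<mu>"
  shows "pmf \<mu> a * pmf \<mu> b * F (a \<otimes> b) \<le> avg F"
proof -
  have "pmf \<mu> a * pmf \<mu> b * F (a \<otimes> b) \<le> (\<Sum>b\<in>set_pmf \<mu>. pmf \<mu> a * pmf \<mu> b * F (a \<otimes> b))"
    using assms finite_support support_carrier
    by (intro member_le_sum[of b "set_pmf \<mu>" "\<lambda>b. pmf \<mu> a * pmf \<mu> b * F (a \<otimes> b)"]) auto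
  also have "\<dots> \<le> avg F"
    unfolding avg_def using assms finite_support
    by (intro member_le_sum[of a "set_pmf \<mu>" "\<lambda>a. \<Sum>b\<in>set_pmf \<mu>. pmf \<mu> a * pmf \<mu> b * F (a \<otimes> b)"])
       (auto intro!: sum_nonneg simp: support_carrier)
  finally show ?thesis .
qed

section \<open>Variations, the Dirichlet form, Cheeger and Nash inequalities\<close>

definition var1 :: "('a \<Rightarrow> real) \<Rightarrow> 'a \<Rightarrow> real" where
  "var1 f y = tot (\<lambda>x. \<bar>f x - f (x \<otimes> y)\<bar>)"

definition var2 :: "('a \<Rightarrow> real) \<Rightarrow> 'a \<Rightarrow> real" where
  "var2 f y = tot (\<lambda>x. (f x - f (x \<otimes> y))\<^sup>2)"

lemma var1_nonneg: "var1 f y \<ge> 0" and var2_nonneg: "var2 f y \<ge> 0"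
  by (auto simp: var1_def var2_def intro: tot_nonneg)

lemma fin_supp_sq_diff: "fin_supp f \<Longrightarrow> y \<in> carrier G \<Longrightarrow> fin_supp (\<lambda>x. (f x - f (x \<otimes> y))\<^sup>2)"
  by (intro fin_supp_power2 fin_supp_diff fin_supp_shift)

lemma fin_supp_abs_diff: "fin_supp f \<Longrightarrow> y \<in> carrier G \<Longrightarrow> fin_supp (\<lambda>x. \<bar>f x - f (x \<otimes> y)\<bar>)"
  by (intro fin_supp_abs fin_supp_diff fin_supp_shift)

lemma var2_eq:
  assumes "fin_supp f" "y \<in> carrier G"
  shows "var2 f y = 2 * tot (\<lambda>x. (f x)\<^sup>2) - 2 * tot (\<lambda>x. f x * f (x \<otimes> y))"
proof -
  note fs = fin_supp_power2[OF assms(1)] fin_supp_power2[OF fin_supp_shift[OF assms]]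
    fin_supp_mult[OF assms(1), of "\<lambda>x. f (x \<otimes> y)"]
  have "var2 f y = tot (\<lambda>x. ((f x)\<^sup>2 + (f (x \<otimes> y))\<^sup>2) - 2 * (f x * f (x \<otimes> y)))"
    unfolding var2_def by (intro tot_cong) (simp add: power2_eq_square algebra_simps)
  also have "\<dots> = tot (\<lambda>x. (f x)\<^sup>2) + tot (\<lambda>x. (f (x \<otimes> y))\<^sup>2) - tot (\<lambda>x. 2 * (f x * f (x \<otimes> y)))"
    by (simp only: tot_diff[OF fin_supp_add[OF fs(1,2)] fin_supp_cmult[OF fs(3)]] tot_add[OF fs(1,2)])
  finally show ?thesis using assms by (simp add: tot_cmult tot_shift[of y "\<lambda>x. (f x)\<^sup>2"])
qed

text \<open>Self-adjointness turns the squared norm of \<open>P f\<close> into the pairing of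
  \<open>f\<close> with \<open>P (P f)\<close>; expanding both steps gives the averaged
  autocorrelation of \<open>f\<close>, which \<open>var2_eq\<close> expresses through
  \<open>var2\<close>.\<close>

lemma dirichlet_form_eq:
  assumes "fin_supp f"
  shows "tot (\<lambda>x. (P f x)\<^sup>2) = tot (\<lambda>x. (f x)\<^sup>2) - avg (var2 f) / 2"
proof -
  have "avg (var2 f) = avg (\<lambda>y. 2 * tot (\<lambda>x. (f x)\<^sup>2) - 2 * tot (\<lambda>x. f x * f (x \<otimes> y)))"
    using assms by (intro avg_cong var2_eq) (auto simp: support_carrier)
  also have "\<dots> = 2 * tot (\<lambda>x. (f x)\<^sup>2) - 2 * avg (\<lambda>y. tot (\<lambda>x. f x * f (x \<otimes> y)))"
    by (simp add: avg_diff avg_cmult avg_const)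
  also have "avg (\<lambda>y. tot (\<lambda>x. f x * f (x \<otimes> y))) = tot (\<lambda>x. f x * P (P f) x)"
  proof -
    have "tot (\<lambda>x. f x * P (P f) x) = tot (\<lambda>x. \<Sum>a\<in>set_pmf \<mu>. \<Sum>b\<in>set_pmf \<mu>.
        pmf \<mu> a * pmf \<mu> b * (f x * f (x \<otimes> (a \<otimes> b))))"
      unfolding P_def by (intro tot_cong) (simp add: sum_distrib_left sum_distrib_right mult_ac m_assoc support_carrier)
    also have "\<dots> = avg (\<lambda>y. tot (\<lambda>x. f x * f (x \<otimes> y)))"
      unfolding avg_def
      by (simp only: tot_cmult tot_sum[OF finite_support fin_supp_cmult[OF fin_supp_mult[OF assms]]]
          tot_sum[OF finite_support fin_supp_sum[OF finite_support
              fin_supp_cmult[OF fin_supp_mult[OF assms]]]])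
    finally show ?thesis by simp
  qed
  also have "tot (\<lambda>x. f x * P (P f) x) = tot (\<lambda>x. (P f x)\<^sup>2)"
    using P_selfadjoint[OF assms fin_supp_P[OF assms]] by (simp add: power2_eq_square)
  finally show ?thesis by linarith
qed

text \<open>The product |u^2 - v^2| = |u - v| |u + v| is split by a weighted arithmetic-geometric
  mean inequality instead of Cauchy-Schwarz; the weight \<open>t\<close> stays free so that
  \<open>cheeger\<close> can absorb the second term.\<close>

lemma cheeger_term:
  assumes "fin_supp f" "y \<in> carrier G" "t > 0"
  shows "var1 (\<lambda>x. (f x)\<^sup>2) y \<le> var2 f y / (2 * t) + 2 * t * tot (\<lambda>x. (f x)\<^sup>2)"
proof -
  have pt: "\<bar>u\<^sup>2 - v\<^sup>2\<bar> \<le> 1 / (2 * t) * (u - v)\<^sup>2 + t * (u\<^sup>2 + v\<^sup>2)" for u v :: real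
  proof -
    have "\<bar>u\<^sup>2 - v\<^sup>2\<bar> = \<bar>u - v\<bar> * \<bar>u + v\<bar>"
      by (simp add: power2_eq_square square_diff_square_factored abs_mult mult.commute)
    moreover have "0 \<le> (\<bar>u - v\<bar> - t * \<bar>u + v\<bar>)\<^sup>2" by simp
    hence "2 * t * (\<bar>u - v\<bar> * \<bar>u + v\<bar>) \<le> (u - v)\<^sup>2 + t\<^sup>2 * (u + v)\<^sup>2"
      by (simp add: power2_diff power_mult_distrib algebra_simps)
    moreover have "t\<^sup>2 * (u + v)\<^sup>2 \<le> t\<^sup>2 * (2 * (u\<^sup>2 + v\<^sup>2))"
      using sum_squares_bound[of u v] by (intro mult_left_mono) (auto simp: power2_sum)
    ultimately have "2 * t * \<bar>u\<^sup>2 - v\<^sup>2\<bar> \<le> (u - v)\<^sup>2 + 2 * t\<^sup>2 * (u\<^sup>2 + v\<^sup>2)"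
      by (simp add: algebra_simps)
    then have "\<bar>u\<^sup>2 - v\<^sup>2\<bar> \<le> ((u - v)\<^sup>2 + 2 * t\<^sup>2 * (u\<^sup>2 + v\<^sup>2)) / (2 * t)"
      using \<open>t > 0\<close> by (simp add: field_simps)
    also have "\<dots> = 1 / (2 * t) * (u - v)\<^sup>2 + t * (u\<^sup>2 + v\<^sup>2)"
      using \<open>t > 0\<close> by (simp add: field_simps power2_eq_square)
    finally show ?thesis .
  qed
  note fs = fin_supp_power2[OF assms(1)] fin_supp_power2[OF fin_supp_shift[OF assms(1,2)]]
    fin_supp_sq_diff[OF assms(1,2)]
  have "var1 (\<lambda>x. (f x)\<^sup>2) y \<le>
      tot (\<lambda>x. 1 / (2 * t) * (f x - f (x \<otimes> y))\<^sup>2 + t * ((f x)\<^sup>2 + (f (x \<otimes> y))\<^sup>2))"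
    unfolding var1_def 
    by (rule tot_mono[OF fin_supp_abs_diff[OF fs(1) assms(2)]
          fin_supp_add[OF fin_supp_cmult[OF fs(3)] fin_supp_cmult[OF fin_supp_add[OF fs(1,2)]]] pt])
  also have "\<dots> = 1 / (2 * t) * var2 f y + t * (tot (\<lambda>x. (f x)\<^sup>2) + tot (\<lambda>x. (f (x \<otimes> y))\<^sup>2))"
    unfolding var2_def
    by (simp only: tot_add[OF fin_supp_cmult[OF fs(3)] fin_supp_cmult[OF fin_supp_add[OF fs(1,2)]]]
        tot_cmult tot_add[OF fs(1,2)])
  finally show ?thesis using assms by (simp add: tot_shift[of y "\<lambda>x. (f x)\<^sup>2"])
qed

lemma cheeger:
  assumes "fin_supp f" "k > 0" and k: "k * tot (\<lambda>x. (f x)\<^sup>2) \<le> avg (var1 (\<lambda>x. (f x)\<^sup>2))"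
  shows "k\<^sup>2 / 4 * tot (\<lambda>x. (f x)\<^sup>2) \<le> avg (var2 f)"
proof -
  have "avg (var1 (\<lambda>x. (f x)\<^sup>2)) \<le> avg (\<lambda>y. 2 / k * var2 f y + k / 2 * tot (\<lambda>x. (f x)\<^sup>2))"
    \<comment> \<open>With \<open>t = k / 4\<close> the second term is half of the lower bound in
      \<open>k\<close>, hence can be absorbed.\<close>
    using cheeger_term[OF assms(1), of _ "k / 4"] assms(2) by (intro avg_mono) (auto simp: field_simps support_carrier)
  also have "\<dots> = 2 / k * avg (var2 f) + k / 2 * tot (\<lambda>x. (f x)\<^sup>2)"
    by (simp only: avg_add avg_cmult avg_const)
  finally have "k / 2 * tot (\<lambda>x. (f x)\<^sup>2) \<le> 2 / k * avg (var2 f)" using k by (simp add: field_simps)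
  then show ?thesis using assms(2) by (simp add: field_simps power2_eq_square)
qed

text \<open>Let u be the squared norm of \<open>f\<close> and truncate at height u / 4. As
  \<open>tot f = 1\<close>, the remainder \<open>h\<close> lives on at most 4 / u points;
  differences only shrink; and h^2 \<ge> f^2 - (u / 2) f shows that at least half of u survives.
  Cheeger for \<open>h\<close> gives (\<kappa>^2 / 4) (u / 2) as a lower bound for
  \<open>avg (var2 f)\<close>, which is twice the drop of the squared norm; this is the constant 1 /
  16.\<close>

lemma nash_step:
  assumes f: "fin_supp f" "\<And>x. f x \<ge> 0" "tot f = 1" and u: "tot (\<lambda>x. (f x)\<^sup>2) > 0"
    and "\<kappa> > 0" "4 / tot (\<lambda>x. (f x)\<^sup>2) \<le> N"
    and iso: "\<And>g. fin_supp g \<Longrightarrow> real (card (supp g)) \<le> N \<Longrightarrow> \<kappa> * tot (\<lambda>x. \<bar>g x\<bar>) \<le> avg (var1 g)"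
  shows "tot (\<lambda>x. (P f x)\<^sup>2) \<le> (1 - \<kappa>\<^sup>2 / 16) * tot (\<lambda>x. (f x)\<^sup>2)"
proof -
  define u where "u = tot (\<lambda>x. (f x)\<^sup>2)"
  define h where "h = (\<lambda>x. max 0 (f x - u / 4))"
  have u0: "u > 0" using u by (simp add: u_def)
  have h: "fin_supp h" using f u0 by (intro fin_supp_le[OF f(1)]) (auto simp: h_def)
  have "u / 4 * card (supp h) \<le> tot f"
    using f h u0 by (intro tot_ge_card) (auto simp: supp_def h_def max_def split: if_splits)
  then have "card (supp h) \<le> 4 / u" using f u0 by (simp add: field_simps)
  then have "real (card (supp (\<lambda>x. (h x)\<^sup>2))) \<le> N"
    using assms(6) by (simp add: supp_def u_def)
  then have "\<kappa> * tot (\<lambda>x. (h x)\<^sup>2) \<le> avg (var1 (\<lambda>x. (h x)\<^sup>2))"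
    using iso[of "\<lambda>x. (h x)\<^sup>2"] h by (simp add: fin_supp_power2)
  then have ch: "\<kappa>\<^sup>2 / 4 * tot (\<lambda>x. (h x)\<^sup>2) \<le> avg (var2 h)"
    using h \<open>\<kappa> > 0\<close> by (intro cheeger)
  have "avg (var2 h) \<le> avg (var2 f)"
  proof (intro avg_mono)
    fix a b assume "a \<in> set_pmf \<mu>" "b \<in> set_pmf \<mu>"
    then have ab: "a \<in> carrier G" "b \<in> carrier G" by (auto intro: support_carrier)
    have "\<bar>h x - h y\<bar> \<le> \<bar>f x - f y\<bar>" for x y by (auto simp: h_def max_def)
    then show "var2 h (a \<otimes> b) \<le> var2 f (a \<otimes> b)"
      unfolding var2_def using h f ab
      by (intro tot_mono fin_supp_sq_diff m_closed) (auto simp: abs_le_square_iff[symmetric])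
  qed
  moreover have "u / 2 \<le> tot (\<lambda>x. (h x)\<^sup>2)"
  proof -
    have "(f x)\<^sup>2 - u / 2 * f x \<le> (h x)\<^sup>2" for x
    proof (cases "f x \<le> u / 4")
      case True
      then have "f x * f x \<le> u / 4 * f x" using f(2)[of x] by (intro mult_right_mono)
      moreover have "u * f x \<ge> 0" using u0 f(2)[of x] by simp
      ultimately show ?thesis using True by (simp add: h_def power2_eq_square max_def)
    next
      case False
      then show ?thesis by (simp add: h_def power2_eq_square max_def algebra_simps)
    qed
    then have "tot (\<lambda>x. (f x)\<^sup>2 - u / 2 * f x) \<le> tot (\<lambda>x. (h x)\<^sup>2)"
      using f h by (intro tot_mono fin_supp_diff fin_supp_cmult fin_supp_power2)
    moreover have "tot (\<lambda>x. (f x)\<^sup>2 - u / 2 * f x) = u - u / 2 * 1"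
      unfolding u_def tot_diff[OF fin_supp_power2[OF f(1)] fin_supp_cmult[OF f(1)]] tot_cmult f(3) ..
    ultimately show ?thesis by simp
  qed
  then have "\<kappa>\<^sup>2 / 4 * (u / 2) \<le> \<kappa>\<^sup>2 / 4 * tot (\<lambda>x. (h x)\<^sup>2)" by (intro mult_left_mono) auto
  ultimately show ?thesis
    using ch dirichlet_form_eq[OF f(1)] by (simp add: u_def[symmetric] algebra_simps)
qed

end

subsection \<open>Return probabilities\<close>

context symmetric_walk
begin

definition heat :: "nat \<Rightarrow> 'a \<Rightarrow> real" where
  "heat n = pmf (conv_power G \<mu> n)"

lemma set_conv_power: "set_pmf (conv_power G \<mu> n) \<subseteq> carrier G"
  by (induction n) (use support_subset in \<open>auto simp: convolution_def\<close>)

lemma finite_conv_power: "finite (set_pmf (conv_power G \<mu> n))"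
  by (induction n) (use finite_support in \<open>auto simp: convolution_def\<close>)

lemma heat_nonneg: "heat n x \<ge> 0"
  by (simp add: heat_def)

lemma fin_supp_heat: "fin_supp (heat n)"
  by (rule finite_subset[OF _ finite_conv_power[of n]]) (auto simp: supp_def heat_def set_pmf_iff)

lemma tot_heat: "tot (heat n) = 1"
proof -
  have "tot (heat n) = sum (heat n) (set_pmf (conv_power G \<mu> n))"
    using finite_conv_power set_conv_power
    by (intro tot_eq_sum) (auto simp: supp_def heat_def set_pmf_iff)
  then show ?thesis unfolding heat_def
    by (subst (asm) sum_pmf_eq_1) (use finite_conv_power in auto)
qed

text \<open>Right multiplication need not be injective outside the carrier, so the preimage of
  \<open>x\<close> is compared with a singleton only inside the support of \<open>A\<close>.\<close>

lemma pmf_map_mult_right: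
  assumes "set_pmf A \<subseteq> carrier G" "x \<in> carrier G" "y \<in> carrier G"
  shows "pmf (map_pmf (\<lambda>z. z \<otimes> y) A) x = pmf A (x \<otimes> inv y)"
proof -
  have "pmf (map_pmf (\<lambda>z. z \<otimes> y) A) x = measure A ({z. z \<otimes> y = x} \<inter> set_pmf A)"
    by (simp add: pmf_map vimage_def measure_Int_set_pmf)
  also have "{z. z \<otimes> y = x} \<inter> set_pmf A = {x \<otimes> inv y} \<inter> set_pmf A"
    using assms by (auto simp: m_assoc)
  also have "measure A \<dots> = pmf A (x \<otimes> inv y)"
    by (simp only: measure_Int_set_pmf measure_pmf_single)
  finally show ?thesis .
qed

text \<open>Conditioning on the last factor \<open>y\<close> gives the value at
  \<open>x \<otimes> inv y\<close>; the symmetry of \<mu> turns this into the average over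
  \<open>x \<otimes> y\<close>.\<close>

lemma heat_Suc:
  assumes "x \<in> carrier G"
  shows "heat (Suc n) x = P (heat n) x"
proof -
  have "convolution G (conv_power G \<mu> n) \<mu> =
      bind_pmf \<mu> (\<lambda>y. map_pmf (\<lambda>z. z \<otimes> y) (conv_power G \<mu> n))"
    unfolding convolution_def pair_pmf_def map_bind_pmf
    by (subst bind_commute_pmf) (simp add: map_pmf_def bind_assoc_pmf bind_return_pmf)
  then have "heat (Suc n) x =
      (\<integral>y. pmf (map_pmf (\<lambda>z. z \<otimes> y) (conv_power G \<mu> n)) x \<partial>measure_pmf \<mu>)"
    by (simp add: heat_def pmf_bind)
  also have "\<dots> = (\<Sum>y\<in>set_pmf \<mu>. pmf (map_pmf (\<lambda>z. z \<otimes> y) (conv_power G \<mu> n)) x * pmf \<mu> y)"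
    by (rule integral_measure_pmf_real) (auto simp: finite_support)
  also have "\<dots> = (\<Sum>y\<in>set_pmf \<mu>. pmf \<mu> y * heat n (x \<otimes> inv y))"
    unfolding heat_def using assms
    by (intro sum.cong refl)
       (simp add: pmf_map_mult_right set_conv_power support_carrier mult.commute)
  also have "\<dots> = P (heat n) x"
    unfolding P_def using sum_support_inv[of "\<lambda>a. heat n (x \<otimes> a)"] by simp
  finally show ?thesis .
qed

lemma heat_0: "heat 0 x = (if x = \<one> then 1 else 0)"
  by (simp add: heat_def indicator_def)

lemma tot_delta: "tot (\<lambda>x. heat 0 x * f x) = f \<one>"
proof -
  have "tot (\<lambda>x. heat 0 x * f x) = sum (\<lambda>x. heat 0 x * f x) {\<one>}"
    by (intro tot_eq_sum) (auto simp: heat_0 supp_def split: if_splits)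
  then show ?thesis by (simp add: heat_0)
qed

text \<open>One \<open>P\<close> at a time moves from the first factor to the second, until the
  first is the point mass at the identity.\<close>

lemma tot_heat_mult: "tot (\<lambda>x. heat m x * heat n x) = heat (m + n) \<one>"
proof (induction m arbitrary: n)
  case 0 show ?case by (simp add: tot_delta)
next
  case (Suc m)
  have "tot (\<lambda>x. heat (Suc m) x * heat n x) = tot (\<lambda>x. P (heat m) x * heat n x)"
    by (intro tot_cong) (simp add: heat_Suc)
  also have "\<dots> = tot (\<lambda>x. heat m x * P (heat n) x)"
    by (intro P_selfadjoint fin_supp_heat)
  also have "\<dots> = tot (\<lambda>x. heat m x * heat (Suc n) x)"
    by (intro tot_cong) (simp add: heat_Suc)
  finally show ?case using Suc by simp
qed

lemma return_eq: "heat (2 * n) \<one> = tot (\<lambda>x. (heat n x)\<^sup>2)"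
  using tot_heat_mult[of n n] by (simp add: power2_eq_square mult_2)

lemma tot_P_heat: "tot (\<lambda>x. (P (heat n) x)\<^sup>2) = heat (2 * Suc n) \<one>"
  unfolding return_eq by (intro tot_cong) (simp add: heat_Suc)

lemma return_mono: "heat (2 * Suc n) \<one> \<le> heat (2 * n) \<one>"
proof -
  have "avg (var2 (heat n)) \<ge> 0" using avg_mono[of "\<lambda>_. 0"] by (simp add: avg_const var2_nonneg)
  then show ?thesis
    using dirichlet_form_eq[OF fin_supp_heat, of n] by (simp only: tot_P_heat return_eq[symmetric])
qed

text \<open>A dichotomy. If the value at \<open>n\<close> is at most e^(-n), then \<kappa> \<le> 1
  gives the claim. Otherwise monotonicity keeps all earlier values above e^(-n), so the truncated
  functions in \<open>nash_step\<close> have support at most 4 e^n and the same \<kappa> can be used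
  in each of the \<open>n\<close> steps.\<close>

lemma return_upper:
  assumes "\<kappa> > 0" "\<kappa> \<le> 1"
    and iso: "\<And>g. fin_supp g \<Longrightarrow> real (card (supp g)) \<le> 4 * exp (real n) \<Longrightarrow>
      \<kappa> * tot (\<lambda>x. \<bar>g x\<bar>) \<le> avg (var1 g)"
  shows "heat (2 * n) \<one> \<le> exp (- (\<kappa>\<^sup>2 / 16 * n))"
proof (cases "heat (2 * n) \<one> \<le> exp (- real n)")
  case True
  have "\<kappa>\<^sup>2 \<le> 1" using assms by (simp add: power_le_one)
  then have "\<kappa>\<^sup>2 / 16 * n \<le> 1 * real n" by (intro mult_right_mono) auto
  then have "exp (- real n) \<le> exp (- (\<kappa>\<^sup>2 / 16 * n))" by simp
  with True show ?thesis by linarith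
next
  case False
  have ge: "heat (2 * k) \<one> \<ge> exp (- real n)" if "k \<le> n" for k
    using lift_Suc_antimono_le[of "\<lambda>k. heat (2 * k) \<one>" k n, OF return_mono that] False by simp
  have pos: "1 - \<kappa>\<^sup>2 / 16 \<ge> 0" using assms power_le_one[of \<kappa> 2] by simp
  have "heat (2 * k) \<one> \<le> (1 - \<kappa>\<^sup>2 / 16) ^ k" if "k \<le> n" for k
    using that
  proof (induction k)
    case 0 show ?case by (simp add: heat_0)
  next
    case (Suc k)
    have g: "exp (- real n) \<le> tot (\<lambda>x. (heat k x)\<^sup>2)" using ge[of k] Suc.prems by (simp add: return_eq)
    have p: "0 < tot (\<lambda>x. (heat k x)\<^sup>2)" by (rule less_le_trans[OF _ g]) simp
    have "1 / tot (\<lambda>x. (heat k x)\<^sup>2) \<le> 1 / exp (- real n)"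
      using g p by (intro divide_left_mono) auto
    then have "4 / tot (\<lambda>x. (heat k x)\<^sup>2) \<le> 4 * exp (real n)"
      by (simp add: exp_minus field_simps)
    from nash_step[OF fin_supp_heat heat_nonneg tot_heat p \<open>\<kappa> > 0\<close> this iso]
    have "heat (2 * Suc k) \<one> \<le> (1 - \<kappa>\<^sup>2 / 16) * heat (2 * k) \<one>"
      by (simp only: tot_P_heat return_eq[symmetric])
    also have "\<dots> \<le> (1 - \<kappa>\<^sup>2 / 16) * (1 - \<kappa>\<^sup>2 / 16) ^ k"
      using Suc pos by (intro mult_left_mono) auto
    finally show ?case by simp
  qed
  then have "heat (2 * n) \<one> \<le> (1 - \<kappa>\<^sup>2 / 16) ^ n" by simp
  also have "\<dots> \<le> exp (- (\<kappa>\<^sup>2 / 16)) ^ n"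
    using pos exp_ge_add_one_self[of "- (\<kappa>\<^sup>2 / 16)"] by (intro power_mono) auto
  also have "\<dots> = exp (- (\<kappa>\<^sup>2 / 16 * n))"
    by (simp add: exp_of_nat_mult[symmetric] mult.commute)
  finally show ?thesis .
qed

section \<open>Lower bounds for the return probability\<close>

lemma fin_supp_shift_left:
  assumes "fin_supp f" "y \<in> carrier G"
  shows "fin_supp (\<lambda>x. f (y \<otimes> x))"
proof (rule finite_imageD)
  show "finite ((\<lambda>x. y \<otimes> x) ` supp (\<lambda>x. f (y \<otimes> x)))"
    by (rule finite_subset[OF _ assms(1)]) (use assms(2) in \<open>auto simp: supp_def\<close>)
  show "inj_on (\<lambda>x. y \<otimes> x) (supp (\<lambda>x. f (y \<otimes> x)))"
    using bij_betw_mult_left[OF assms(2)] unfolding bij_betw_def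
    by (auto intro: inj_on_subset simp: supp_def)
qed

lemma fin_supp_P_iter: "fin_supp f \<Longrightarrow> fin_supp ((P ^^ n) f)"
  by (induction n) (auto intro: fin_supp_P)

text \<open>\<open>P\<close> multiplies on the right and so commutes with left translation by
  \<open>x\<close>; each \<open>P\<close> can thus be moved from the translated function to the heat
  kernel.\<close>

lemma P_iter_eq:
  assumes "fin_supp f" "x \<in> carrier G"
  shows "(P ^^ n) f x = tot (\<lambda>y. f (x \<otimes> y) * heat n y)"
  using assms(1)
proof (induction n arbitrary: f)
  case 0
  then show ?case using tot_delta[of "\<lambda>y. f (x \<otimes> y)"] assms(2) by (simp add: mult.commute)
next
  case (Suc n)
  have "(P ^^ Suc n) f x = tot (\<lambda>y. P f (x \<otimes> y) * heat n y)"
    using Suc.IH[OF fin_supp_P[OF Suc.prems]] by (simp add: funpow_swap1)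
  also have "\<dots> = tot (\<lambda>y. P (\<lambda>z. f (x \<otimes> z)) y * heat n y)"
    by (intro tot_cong) (use assms(2) in \<open>simp add: P_def m_assoc support_carrier\<close>)
  also have "\<dots> = tot (\<lambda>y. f (x \<otimes> y) * P (heat n) y)"
    by (intro P_selfadjoint fin_supp_heat fin_supp_shift_left Suc.prems assms)
  also have "\<dots> = tot (\<lambda>y. f (x \<otimes> y) * heat (Suc n) y)"
    by (intro tot_cong) (simp add: heat_Suc)
  finally show ?case .
qed

lemma heat_add:
  assumes "x \<in> carrier G"
  shows "heat (m + n) x = (P ^^ m) (heat n) x"
  using assms
proof (induction m arbitrary: x)
  case (Suc m)
  have "heat (Suc m + n) x = P (heat (m + n)) x" using Suc.prems by (simp add: heat_Suc)
  also have "\<dots> = P ((P ^^ m) (heat n)) x"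
    unfolding P_def[of _ x] by (intro sum.cong refl) (use Suc in \<open>simp add: support_carrier\<close>)
  finally show ?case by simp
qed simp

text \<open>At even times the heat kernel is the autocorrelation of \<open>heat n\<close>, and an
  autocorrelation is largest at the identity.\<close>

lemma heat_le_return:
  assumes "y \<in> carrier G"
  shows "heat (2 * n) y \<le> heat (2 * n) \<one>"
proof -
  note fs = fin_supp_heat[of n] fin_supp_shift_left[OF fin_supp_heat[of n] assms]
  have "heat (2 * n) y = tot (\<lambda>z. heat n (y \<otimes> z) * heat n z)"
    using heat_add[OF assms, of n n] P_iter_eq[OF fin_supp_heat assms, of n n] by (simp add: mult_2)
  also have "\<dots> \<le> tot (\<lambda>z. 1 / 2 * ((heat n z)\<^sup>2 + (heat n (y \<otimes> z))\<^sup>2))"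
    by (rule tot_mono[OF fin_supp_mult[OF fs(2)]
          fin_supp_cmult[OF fin_supp_add[OF fs[THEN fin_supp_power2]]]])
       (metis (no_types, lifting) divide_inverse inverse_eq_divide mult.commute
         mult.left_commute sum_squares_bound pos_le_divide_eq zero_less_numeral)
  also have "\<dots> = tot (\<lambda>z. (heat n z)\<^sup>2)"
    using tot_shift_left[OF assms, of "\<lambda>z. (heat n z)\<^sup>2"]
    by (simp only: tot_cmult tot_add[OF fs[THEN fin_supp_power2]]) simp
  finally show ?thesis by (simp add: return_eq)
qed

text \<open>By self-adjointness and Cauchy-Schwarz the sequence \<open>a\<close> is log-convex, so
  its successive quotients are nondecreasing and all at least the first one.\<close>

lemma moment_bound:
  assumes f: "fin_supp f"
    and a: "a = (\<lambda>n. tot (\<lambda>x. ((P ^^ n) f x)\<^sup>2))" and "a 0 > 0"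
  shows "a n \<ge> a 0 * (a 1 / a 0) ^ n"
proof -
  have nn: "a k \<ge> 0" for k by (simp add: a tot_nonneg)
  have conv: "(a (Suc k))\<^sup>2 \<le> a k * a (Suc (Suc k))" for k
  proof -
    have "a (Suc k) = tot (\<lambda>x. P ((P ^^ k) f) x * (P ^^ Suc k) f x)"
      by (simp add: a power2_eq_square)
    also have "\<dots> = tot (\<lambda>x. (P ^^ k) f x * (P ^^ Suc (Suc k)) f x)"
      using P_selfadjoint[OF fin_supp_P_iter[OF f] fin_supp_P_iter[OF f], of k "Suc k"] by simp
    finally show ?thesis
      using tot_Cauchy_Schwarz[OF fin_supp_P_iter[OF f] fin_supp_P_iter[OF f], of k "Suc (Suc k)"]
      by (simp only: a)
  qed
  \<comment> \<open>Written without division, because \<open>a k\<close> might vanish.\<close>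
  have ratio: "a k * a 1 \<le> a (Suc k) * a 0" for k
  proof (induction k)
    case (Suc k)
    show ?case
    proof (cases "a (Suc k) = 0")
      case False
      then have p: "a (Suc k) > 0" using nn[of "Suc k"] by simp
      then have k: "a k > 0" using conv[of k] nn[of k] by (cases "a k = 0") auto
      have "a k * (a (Suc k) * a 1) = a (Suc k) * (a k * a 1)" by simp
      also have "\<dots> \<le> a (Suc k) * (a (Suc k) * a 0)" using Suc p by (intro mult_left_mono) auto
      also have "\<dots> = (a (Suc k))\<^sup>2 * a 0" by (simp add: power2_eq_square)
      also have "\<dots> \<le> a k * a (Suc (Suc k)) * a 0" using conv nn by (intro mult_right_mono) auto
      finally show ?thesis using k by (simp add: mult.assoc)
    qed (use nn in auto)
  qed simp
  show ?thesis
  proof (induction n)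
    case (Suc n)
    have "a 0 * (a 1 / a 0) ^ Suc n = a 0 * (a 1 / a 0) ^ n * (a 1 / a 0)" by simp
    also have "\<dots> \<le> a n * (a 1 / a 0)" using Suc nn by (intro mult_right_mono) auto
    also have "\<dots> \<le> a (Suc n)" using ratio[of n] \<open>a 0 > 0\<close> by (simp add: field_simps)
    finally show ?case .
  qed simp
qed

text \<open>The pairing of \<open>f\<close> with \<open>P ^^ (2 * n)\<close> applied to
  \<open>f\<close> is estimated twice. From above, the heat kernel is at most its value at the
  identity, which leaves the square of \<open>tot f\<close>, and Cauchy-Schwarz on the support
  bounds that. From below, log-convexity propagates the loss \<delta> of a single step.\<close>

lemma return_lower:
  assumes f: "fin_supp f" "\<And>x. f x \<ge> 0" "tot (\<lambda>x. (f x)\<^sup>2) > 0"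
    and \<delta>: "\<delta> \<le> 1" "avg (var2 f) \<le> 2 * \<delta> * tot (\<lambda>x. (f x)\<^sup>2)"
  shows "(1 - \<delta>) ^ n \<le> card (supp f) * heat (2 * n) \<one>"
proof -
  define a where "a = (\<lambda>n. tot (\<lambda>x. ((P ^^ n) f x)\<^sup>2))"
  have a0: "a 0 = tot (\<lambda>x. (f x)\<^sup>2)" by (simp add: a_def)
  have shift: "tot (\<lambda>x. (P ^^ m) f x * (P ^^ k) f x) = tot (\<lambda>x. (P ^^ (m + k)) f x * f x)" for m k
  proof (induction k arbitrary: m)
    case (Suc k)
    have "tot (\<lambda>x. (P ^^ m) f x * (P ^^ Suc k) f x) = tot (\<lambda>x. (P ^^ Suc m) f x * (P ^^ k) f x)"
      using P_selfadjoint[OF fin_supp_P_iter[OF f(1)] fin_supp_P_iter[OF f(1)], of m k] by simp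
    then show ?case using Suc[of "Suc m"] by simp
  qed simp
  have "a n = tot (\<lambda>x. (P ^^ (2 * n)) f x * f x)"
    using shift[of n n] by (simp add: a_def power2_eq_square mult_2)
  also have "\<dots> \<le> tot (\<lambda>x. heat (2 * n) \<one> * tot f * f x)"
  proof (intro tot_mono fin_supp_mult2[OF f(1)] mult_right_mono f(2))
    fix x assume x: "x \<in> carrier G"
    note fx = fin_supp_shift_left[OF f(1) x]
    have "(P ^^ (2 * n)) f x = tot (\<lambda>y. f (x \<otimes> y) * heat (2 * n) y)" by (rule P_iter_eq[OF f(1) x])
    also have "\<dots> \<le> tot (\<lambda>y. heat (2 * n) \<one> * f (x \<otimes> y))"
      by (rule tot_mono[OF fin_supp_mult[OF fx] fin_supp_cmult[OF fx]])
         (simp add: mult.commute[of _ "f _"] mult_left_mono f heat_le_return)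
    also have "\<dots> = heat (2 * n) \<one> * tot f" by (simp only: tot_cmult tot_shift_left[OF x])
    finally show "(P ^^ (2 * n)) f x \<le> heat (2 * n) \<one> * tot f" .
  qed
  also have "\<dots> = heat (2 * n) \<one> * (tot f)\<^sup>2" by (simp add: tot_cmult power2_eq_square)
  also have "\<dots> \<le> heat (2 * n) \<one> * (card (supp f) * a 0)"
  proof (intro mult_left_mono heat_nonneg)
    have "tot f = sum f (supp f)" "a 0 = sum (\<lambda>x. (f x)\<^sup>2) (supp f)"
      unfolding a0 by (rule tot_eq_sum; use f in \<open>auto simp: supp_def\<close>)+
    then show "(tot f)\<^sup>2 \<le> card (supp f) * a 0"
      using Cauchy_Schwarz_ineq_sum[of "\<lambda>_. 1" f "supp f"] by simp
  qed
  finally have up: "a n \<le> a 0 * (card (supp f) * heat (2 * n) \<one>)" by (simp add: mult_ac)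
  have "a 1 = a 0 - avg (var2 f) / 2" using dirichlet_form_eq[OF f(1)] by (simp add: a_def)
  then have "a 1 \<ge> (1 - \<delta>) * a 0" using \<delta>(2) by (simp add: a0 algebra_simps)
  then have "1 - \<delta> \<le> a 1 / a 0" using f(3) a0 by (simp add: field_simps)
  then have "a 0 * (1 - \<delta>) ^ n \<le> a 0 * (a 1 / a 0) ^ n"
    using \<delta> f(3) a0 by (intro mult_left_mono power_mono) auto
  also have "\<dots> \<le> a n" using f a0 by (intro moment_bound[OF f(1) a_def]) auto
  finally have "a 0 * (1 - \<delta>) ^ n \<le> a 0 * (card (supp f) * heat (2 * n) \<one>)" using up by linarith
  then show ?thesis using f(3) a0 by (simp only: mult_le_cancel_left_pos)
qed

text \<open>Products of exactly \<open>n\<close> elements of the support, not of at most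
  \<open>n\<close>: the identity need not be in the support, and the parity of the length
  matters.\<close>

primrec words :: "nat \<Rightarrow> 'a set" where
  "words 0 = {\<one>}"
| "words (Suc n) = (\<lambda>(x, a). x \<otimes> a) ` (words n \<times> set_pmf \<mu>)"

lemma words_carrier: "w \<in> words n \<Longrightarrow> w \<in> carrier G"
  by (induction n arbitrary: w) (auto simp: support_carrier)

lemma words_mult: "v \<in> words m \<Longrightarrow> w \<in> words n \<Longrightarrow> v \<otimes> w \<in> words (m + n)"
proof (induction n arbitrary: w)
  case 0 then show ?case using words_carrier by auto
next
  case (Suc n)
  then obtain x a where xa: "w = x \<otimes> a" "x \<in> words n" "a \<in> set_pmf \<mu>" by auto
  then have "v \<otimes> w = (v \<otimes> x) \<otimes> a"
    using Suc.prems words_carrier support_carrier by (simp add: m_assoc)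
  then show ?case using Suc.IH[OF Suc.prems(1) xa(2)] xa(3) by auto
qed

lemma words_1: "a \<in> set_pmf \<mu> \<Longrightarrow> a \<in> words 1"
  by (force simp: support_carrier)

lemma words_inv: "w \<in> words n \<Longrightarrow> inv w \<in> words n"
proof (induction n arbitrary: w)
  case (Suc n)
  then obtain x a where xa: "w = x \<otimes> a" "x \<in> words n" "a \<in> set_pmf \<mu>" by auto
  then have "inv w = inv a \<otimes> inv x"
    using words_carrier support_carrier by (simp add: inv_mult_group)
  then show ?case using words_mult[OF words_1[OF inv_support[OF xa(3)]] Suc.IH[OF xa(2)]] by simp
qed simp

lemma semigroup_generated_words:
  "x \<in> semigroup_generated G (set_pmf \<mu>) \<Longrightarrow> \<exists>n. x \<in> words n"
  by (induction rule: semigroup_generated.induct) (blast intro: words_1 words_mult)+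

lemma var1_mult:
  assumes "fin_supp f" "y \<in> carrier G" "z \<in> carrier G"
  shows "var1 f (y \<otimes> z) \<le> var1 f y + var1 f z"
proof -
  note fs = fin_supp_abs_diff[OF assms(1,2)]
    fin_supp_shift[OF fin_supp_abs_diff[OF assms(1,3)] assms(2)]
  have "var1 f (y \<otimes> z) \<le> tot (\<lambda>x. \<bar>f x - f (x \<otimes> y)\<bar> + \<bar>f (x \<otimes> y) - f (x \<otimes> y \<otimes> z)\<bar>)"
    unfolding var1_def
    by (rule tot_mono[OF fin_supp_abs_diff[OF assms(1)] fin_supp_add[OF fs]])
       (use assms in \<open>auto simp: m_assoc\<close>)
  also have "\<dots> = var1 f y + var1 f z"
    unfolding var1_def
    by (simp only: tot_add[OF fs] tot_shift[OF assms(2), of "\<lambda>x. \<bar>f x - f (x \<otimes> z)\<bar>"])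
  finally show ?thesis .
qed

lemma var1_even_word:
  assumes "fin_supp f" "\<And>a b. a \<in> set_pmf \<mu> \<Longrightarrow> b \<in> set_pmf \<mu> \<Longrightarrow> var1 f (a \<otimes> b) \<le> M"
    "w \<in> words (2 * n)"
  shows "var1 f w \<le> n * M"
  using assms(3)
proof (induction n arbitrary: w)
  case 0
  have "var1 f \<one> = tot (\<lambda>x. 0 * f x)" unfolding var1_def by (intro tot_cong) auto
  then show ?case using 0 by (simp only: tot_cmult) simp
next
  case (Suc n)
  then obtain x a b where xa: "w = (x \<otimes> a) \<otimes> b" "x \<in> words (2 * n)" "a \<in> set_pmf \<mu>" "b \<in> set_pmf \<mu>"
    by auto
  then have "w = x \<otimes> (a \<otimes> b)" using words_carrier support_carrier by (simp add: m_assoc)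
  then have "var1 f w \<le> var1 f x + var1 f (a \<otimes> b)"
    using xa assms(1) words_carrier support_carrier by (auto intro!: var1_mult)
  also have "\<dots> \<le> n * M + M" using Suc.IH xa assms(2) by (intro add_mono) auto
  finally show ?case by (simp add: algebra_simps)
qed

lemma pmin: "\<exists>p>0. \<forall>a\<in>set_pmf \<mu>. \<forall>b\<in>set_pmf \<mu>. p \<le> pmf \<mu> a * pmf \<mu> b"
proof -
  let ?M = "Min (pmf \<mu> ` set_pmf \<mu>)"
  have fin: "finite (pmf \<mu> ` set_pmf \<mu>)" using finite_support by simp
  have pos: "?M > 0" using finite_support set_pmf_not_empty[of \<mu>]
    by (subst Min_gr_iff) (auto simp: pmf_positive)
  have "?M * ?M \<le> pmf \<mu> a * pmf \<mu> b" if "a \<in> set_pmf \<mu>" "b \<in> set_pmf \<mu>" for a b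
    using that fin pos by (intro mult_mono Min_le) auto
  then show ?thesis using pos by (intro exI[of _ "?M * ?M"]) auto
qed

text \<open>Every product of two support elements has weight at least p > 0 in \<open>avg\<close>,
  hence variation at most \<open>avg (var1 f) / p\<close>; a word of length \<open>2 * n\<close>
  consists of \<open>n\<close> such products.\<close>

lemma var1_even_word_avg:
  "\<exists>C>0. \<forall>f n. \<forall>w\<in>words (2 * n). fin_supp f \<longrightarrow> var1 f w \<le> C * n * avg (var1 f)"
proof -
  obtain p where p: "p > 0" "\<And>a b. a \<in> set_pmf \<mu> \<Longrightarrow> b \<in> set_pmf \<mu> \<Longrightarrow> p \<le> pmf \<mu> a * pmf \<mu> b"
    using pmin by blast
  have "var1 f w \<le> 1 / p * n * avg (var1 f)" if "w \<in> words (2 * n)" "fin_supp f" for f n w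
  proof -
    have "var1 f (a \<otimes> b) \<le> avg (var1 f) / p" if ab: "a \<in> set_pmf \<mu>" "b \<in> set_pmf \<mu>" for a b
    proof -
      have "p * var1 f (a \<otimes> b) \<le> pmf \<mu> a * pmf \<mu> b * var1 f (a \<otimes> b)"
        using p(2)[OF ab] by (intro mult_right_mono var1_nonneg)
      also have "\<dots> \<le> avg (var1 f)" using ab by (intro avg_ge_term var1_nonneg)
      finally show ?thesis using p(1) by (simp add: field_simps)
    qed
    then show ?thesis using var1_even_word[OF \<open>fin_supp f\<close> _ \<open>w \<in> words (2 * n)\<close>, of "avg (var1 f) / p"]
      by simp
  qed
  then show ?thesis using p(1) by (intro exI[of _ "1 / p"]) auto
qed

section \<open>The one-step energy of the profile\<close>

definition energy1 :: "('a \<Rightarrow> real) \<Rightarrow> real" where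
  "energy1 f = (\<Sum>a\<in>set_pmf \<mu>. pmf \<mu> a * var1 f a)"

text \<open>Transfers an isoperimetric inequality for two steps to the one-step energy that occurs
  in the profile.\<close>

lemma avg_var1_le:
  assumes "fin_supp f"
  shows "avg (var1 f) \<le> 2 * energy1 f"
proof -
  have "avg (var1 f) \<le> (\<Sum>a\<in>set_pmf \<mu>. \<Sum>b\<in>set_pmf \<mu>. pmf \<mu> a * pmf \<mu> b * (var1 f a + var1 f b))"
    unfolding avg_def using assms by (intro sum_mono mult_left_mono var1_mult support_carrier) auto
  also have "\<dots> = (\<Sum>b\<in>set_pmf \<mu>. pmf \<mu> b) * energy1 f + (\<Sum>a\<in>set_pmf \<mu>. pmf \<mu> a) * energy1 f"
    unfolding energy1_def sum_product distrib_left sum.distrib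
    by (subst sum.swap) (simp add: mult_ac)
  finally show ?thesis by (simp add: sum_support)
qed

lemma infsum_energy1:
  assumes f: "fin_supp f"
  shows "(\<Sum>\<^sub>\<infinity>(x, y)\<in>carrier G \<times> carrier G. \<bar>f x - f (x \<otimes> y)\<bar> * pmf \<mu> y) = energy1 f"
proof -
  let ?S = "set_pmf \<mu>"
  define F where "F = (\<Union>a\<in>?S. supp (\<lambda>x. \<bar>f x - f (x \<otimes> a)\<bar>))"
  have F: "finite F" "F \<subseteq> carrier G"
    using f fin_supp_abs_diff support_carrier finite_support by (auto simp: F_def supp_def)
  have "(\<Sum>\<^sub>\<infinity>(x, y)\<in>carrier G \<times> carrier G. \<bar>f x - f (x \<otimes> y)\<bar> * pmf \<mu> y) =
      (\<Sum>\<^sub>\<infinity>(x, y)\<in>F \<times> ?S. \<bar>f x - f (x \<otimes> y)\<bar> * pmf \<mu> y)"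
    by (rule infsum_cong_neutral)
       (use F(2) support_carrier in \<open>auto simp: F_def supp_def set_pmf_iff\<close>)
  also have "\<dots> = (\<Sum>(x, y)\<in>F \<times> ?S. \<bar>f x - f (x \<otimes> y)\<bar> * pmf \<mu> y)"
    using F finite_support by simp
  also have "\<dots> = (\<Sum>a\<in>?S. \<Sum>x\<in>F. \<bar>f x - f (x \<otimes> a)\<bar> * pmf \<mu> a)"
    by (subst sum.cartesian_product[symmetric], subst sum.swap) simp
  also have "\<dots> = energy1 f"
    unfolding energy1_def var1_def
  proof (intro sum.cong refl)
    fix a assume a: "a \<in> ?S"
    then have "tot (\<lambda>x. \<bar>f x - f (x \<otimes> a)\<bar>) = (\<Sum>x\<in>F. \<bar>f x - f (x \<otimes> a)\<bar>)"
      using F by (intro tot_eq_sum) (auto simp: F_def)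
    then show "(\<Sum>x\<in>F. \<bar>f x - f (x \<otimes> a)\<bar> * pmf \<mu> a) = pmf \<mu> a * tot (\<lambda>x. \<bar>f x - f (x \<otimes> a)\<bar>)"
      by (simp add: sum_distrib_left mult.commute)
  qed
  finally show ?thesis .
qed

end

subsection \<open>Isoperimetry in the cube\<close>

text \<open>If a is the smaller part, 2a \<le> a + b gives 1 + log a \<le> log (a + b). The gain
  pays for the pairs in the direction along which \<open>cube_edge_count\<close> splits the
  set.\<close>

lemma xlog_add:
  fixes a b :: nat
  shows "2 * real (min a b) + (2 * a * log 2 a + 2 * b * log 2 b) \<le> 2 * real (a + b) * log 2 (real (a + b))"
proof (induction a b rule: linorder_wlog)
  case (le a b)
  show ?case
  proof (cases "a = 0")
    case False
    have "log 2 (2 * a) \<le> log 2 (a + b)" using le False by (subst log_le_cancel_iff) auto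
    then have "1 + log 2 a \<le> log 2 (a + b)" using False by (simp add: log_mult)
    then have "a * (1 + log 2 a) \<le> a * log 2 (a + b)" by (intro mult_left_mono) auto
    moreover have "log 2 b \<le> log 2 (a + b)" using le False by (subst log_le_cancel_iff) auto
    then have "b * log 2 b \<le> b * log 2 (a + b)" by (intro mult_left_mono) auto
    ultimately show ?thesis using le by (simp add: algebra_simps)
  qed simp
qed (simp add: add_ac min.commute)

text \<open>Edge isoperimetry by induction on the directions. Split \<open>A\<close> by the
  coordinate \<open>\<xi> i\<close>: the other directions stay inside the two halves, and direction
  \<open>i\<close> injects each half into the other, so it contributes at most twice the smaller
  half. The bound is twice the sharp one for the cube, which keeps \<open>xlog_add\<close>
  elementary.\<close>

lemma cube_edge_count:
  fixes s :: "'i \<Rightarrow> 'a \<Rightarrow> 'a" and \<xi> :: "'i \<Rightarrow> 'a \<Rightarrow> bool"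
  assumes "finite I" "\<And>i. i \<in> I \<Longrightarrow> inj_on (s i) X"
    and flip: "\<And>i x. i \<in> I \<Longrightarrow> x \<in> X \<Longrightarrow> \<xi> i (s i x) = (\<not> \<xi> i x)"
    and keep: "\<And>i j x. i \<in> I \<Longrightarrow> j \<in> I \<Longrightarrow> i \<noteq> j \<Longrightarrow> x \<in> X \<Longrightarrow> \<xi> j (s i x) = \<xi> j x"
    and "finite A" "A \<subseteq> X"
  shows "real (\<Sum>i\<in>I. card {x \<in> A. s i x \<in> A}) \<le> 2 * card A * log 2 (card A)"
  using assms
proof (induction I arbitrary: A rule: finite_induct)
  case empty
  show ?case by (cases "card A = 0") auto
next
  case (insert i I)
  let ?A1 = "{x \<in> A. \<xi> i x}" and ?A0 = "{x \<in> A. \<not> \<xi> i x}"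
  have IH: "real (\<Sum>j\<in>I. card {x \<in> B. s j x \<in> B}) \<le> 2 * card B * log 2 (card B)" if "B \<subseteq> A" for B
    by (rule insert.IH) (use insert.prems that in \<open>auto intro: finite_subset\<close>)
  have A: "card A = card ?A1 + card ?A0"
    using insert.prems(4) by (subst card_Un_disjoint[symmetric]) (auto intro: arg_cong[of _ _ card])
  have split: "card {x \<in> A. s j x \<in> A} =
      card {x \<in> ?A1. s j x \<in> ?A1} + card {x \<in> ?A0. s j x \<in> ?A0}" if "j \<in> I" for j
  proof -
    have "{x \<in> A. s j x \<in> A} = {x \<in> ?A1. s j x \<in> ?A1} \<union> {x \<in> ?A0. s j x \<in> ?A0}"
      using insert.prems(3)[of j i] insert.prems(5) insert.hyps that by blast
    then show ?thesis
      using insert.prems(4) by (simp only:) (subst card_Un_disjoint, auto)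
  qed
  have "card {x \<in> A. s i x \<in> A} \<le> 2 * min (card ?A1) (card ?A0)"
  proof -
    have inj: "inj_on (s i) X" using insert.prems(1) by auto
    have fl: "\<xi> i (s i x) = (\<not> \<xi> i x)" if "x \<in> A" for x
      using insert.prems(2)[of i x] insert.prems(5) that by auto
    have 1: "card {x \<in> ?A1. s i x \<in> ?A0} \<le> card ?A0"
      using insert.prems(4,5) by (intro card_inj_on_le[of "s i"] inj_on_subset[OF inj]) auto
    have 2: "card {x \<in> ?A0. s i x \<in> ?A1} \<le> card ?A1"
      using insert.prems(4,5) by (intro card_inj_on_le[of "s i"] inj_on_subset[OF inj]) auto
    have 3: "card {x \<in> ?A1. s i x \<in> ?A0} \<le> card ?A1" "card {x \<in> ?A0. s i x \<in> ?A1} \<le> card ?A0"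
      using insert.prems(4) by (auto intro!: card_mono)
    have "{x \<in> A. s i x \<in> A} = {x \<in> ?A1. s i x \<in> ?A0} \<union> {x \<in> ?A0. s i x \<in> ?A1}"
      using fl by auto
    then have "card {x \<in> A. s i x \<in> A} \<le> card {x \<in> ?A1. s i x \<in> ?A0} + card {x \<in> ?A0. s i x \<in> ?A1}"
      by (simp only: card_Un_le)
    then show ?thesis using 1 2 3 by linarith
  qed
  then have "real (\<Sum>j\<in>insert i I. card {x \<in> A. s j x \<in> A}) \<le>
      2 * min (card ?A1) (card ?A0) + real (\<Sum>j\<in>I. card {x \<in> A. s j x \<in> A})"
    using insert.hyps by simp
  also have "\<dots> = 2 * min (card ?A1) (card ?A0) + (real (\<Sum>j\<in>I. card {x \<in> ?A1. s j x \<in> ?A1})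
      + real (\<Sum>j\<in>I. card {x \<in> ?A0. s j x \<in> ?A0}))"
    using split by (simp add: sum.distrib)
  also have "\<dots> \<le> 2 * min (card ?A1) (card ?A0) +
      (2 * card ?A1 * log 2 (card ?A1) + 2 * card ?A0 * log 2 (card ?A0))"
    by (intro add_mono IH order.refl) auto
  also have "\<dots> \<le> 2 * card A * log 2 (card A)"
    unfolding A using xlog_add[of "card ?A1" "card ?A0"] by simp
  finally show ?case .
qed

text \<open>The smallness hypothesis makes the internal pairs at most half of all
  \<open>card I * card A\<close> pairs.\<close>

lemma cube_boundary_count:
  fixes s :: "'i \<Rightarrow> 'a \<Rightarrow> 'a" and \<xi> :: "'i \<Rightarrow> 'a \<Rightarrow> bool"
  assumes "finite I" "\<And>i. i \<in> I \<Longrightarrow> inj_on (s i) X"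
    and "\<And>i x. i \<in> I \<Longrightarrow> x \<in> X \<Longrightarrow> \<xi> i (s i x) = (\<not> \<xi> i x)"
    and "\<And>i j x. i \<in> I \<Longrightarrow> j \<in> I \<Longrightarrow> i \<noteq> j \<Longrightarrow> x \<in> X \<Longrightarrow> \<xi> j (s i x) = \<xi> j x"
    and A: "finite A" "A \<subseteq> X" and small: "4 * log 2 (card A) \<le> card I"
  shows "card I * card A / 2 \<le> real (\<Sum>i\<in>I. card {x \<in> A. s i x \<notin> A})"
proof -
  have "card A = card {x \<in> A. s i x \<in> A} + card {x \<in> A. s i x \<notin> A}" for i
    using A by (subst card_Un_disjoint[symmetric]) (auto intro: arg_cong[of _ _ card])
  then have "real (\<Sum>i\<in>I. card A) = real (\<Sum>i\<in>I. card {x \<in> A. s i x \<in> A} + card {x \<in> A. s i x \<notin> A})"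
    by simp
  then have "card I * card A = real (\<Sum>i\<in>I. card {x \<in> A. s i x \<in> A}) + real (\<Sum>i\<in>I. card {x \<in> A. s i x \<notin> A})"
    by (simp add: sum.distrib)
  moreover have "real (\<Sum>i\<in>I. card {x \<in> A. s i x \<in> A}) \<le> 2 * card A * log 2 (card A)"
    using cube_edge_count[of I s X \<xi> A] assms by simp
  moreover have "card A * (4 * log 2 (card A)) \<le> card A * real (card I)" using small by (intro mult_left_mono) auto
  ultimately show ?thesis by (simp add: algebra_simps)
qed

context symmetric_walk
begin

text \<open>From sets to functions by peeling layers: with \<open>m\<close> the least value of
  \<open>f\<close> on its support, f is \<open>m\<close> times the indicator of the support plus a
  nonnegative \<open>h\<close> of strictly smaller support. The sets that occur are all within the
  size bound.\<close>

lemma cube_isoperimetry: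
  fixes s :: "'i \<Rightarrow> 'a" and \<xi> :: "'i \<Rightarrow> 'a \<Rightarrow> bool"
  assumes I: "finite I" and s: "\<And>i. i \<in> I \<Longrightarrow> s i \<in> carrier G"
    and flip: "\<And>i x. i \<in> I \<Longrightarrow> x \<in> carrier G \<Longrightarrow> \<xi> i (x \<otimes> s i) = (\<not> \<xi> i x)"
    and keep: "\<And>i j x. i \<in> I \<Longrightarrow> j \<in> I \<Longrightarrow> i \<noteq> j \<Longrightarrow> x \<in> carrier G \<Longrightarrow> \<xi> j (x \<otimes> s i) = \<xi> j x"
    and f: "fin_supp f" "\<And>x. f x \<ge> 0" and small: "4 * log 2 (card (supp f)) \<le> card I"
  shows "card I * tot f / 2 \<le> (\<Sum>i\<in>I. var1 f (s i))"
  using f small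
proof (induction "card (supp f)" arbitrary: f rule: less_induct)
  case less
  let ?A = "supp f"
  have A: "finite ?A" "?A \<subseteq> carrier G" using less.prems by (auto simp: supp_def)
  show ?case
  proof (cases "?A = {}")
    case True
    then have "tot f = 0" using tot_eq_sum[of "{}" f] by simp
    then show ?thesis by (simp add: sum_nonneg var1_nonneg)
  next
    case False
    define m where "m = Min (f ` ?A)"
    have m_le: "m \<le> f x" if "x \<in> ?A" for x using that A by (simp add: m_def)
    have "m \<in> f ` ?A" unfolding m_def using A False by (intro Min_in) auto
    then obtain x0 where x0: "x0 \<in> ?A" "f x0 = m" by auto
    have m: "m > 0" using x0 less.prems(2)[of x0] by (auto simp: supp_def)
    define h where "h = (\<lambda>x. if x \<in> ?A then f x - m else 0)"
    define k where "k = (\<lambda>x. if x \<in> ?A then 1 else 0 :: real)"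
    have supps: "supp h \<subseteq> ?A - {x0}" "supp k = ?A" using x0 by (auto simp: h_def k_def supp_def)
    have fs: "fin_supp h" "fin_supp k" using supps A by (auto intro: finite_subset)
    have less_card: "card (supp h) < card ?A" using supps(1) A x0 by (intro psubset_card_mono) auto
    have f_eq: "f x = m * k x + h x" if "x \<in> carrier G" for x
      using that by (auto simp: h_def k_def supp_def)
    have tot_k: "tot k = card ?A"
      using tot_eq_sum[of ?A k] A supps by (simp add: k_def)
    have tot_f: "tot f = m * card ?A + tot h"
      using tot_cong[of f "\<lambda>x. m * k x + h x", OF f_eq] fs
      by (simp add: tot_add[OF fin_supp_cmult] tot_cmult tot_k)
    have var: "var1 f (s i) = m * var1 k (s i) + var1 h (s i)" if i: "i \<in> I" for i
    proof -
      note fd = fin_supp_abs_diff[OF fs(2) s[OF i]] fin_supp_abs_diff[OF fs(1) s[OF i]]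
      have "var1 f (s i) = tot (\<lambda>x. m * \<bar>k x - k (x \<otimes> s i)\<bar> + \<bar>h x - h (x \<otimes> s i)\<bar>)"
        unfolding var1_def
      proof (intro tot_cong)
        fix x assume "x \<in> carrier G"
        then have xs: "x \<in> carrier G" "x \<otimes> s i \<in> carrier G" using s[OF i] by auto
        \<comment> \<open>There is no cancellation: \<open>k\<close> and \<open>h\<close> both
          vanish off the support and \<open>h\<close> is nonnegative on it, so their differences
          never have opposite signs.\<close>
        show "\<bar>f x - f (x \<otimes> s i)\<bar> = m * \<bar>k x - k (x \<otimes> s i)\<bar> + \<bar>h x - h (x \<otimes> s i)\<bar>"
          unfolding f_eq[OF xs(1)] f_eq[OF xs(2)] using m m_le[of x] m_le[of "x \<otimes> s i"]
          by (cases "x \<in> ?A"; cases "x \<otimes> s i \<in> ?A") (simp_all add: h_def k_def)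
      qed
      then show ?thesis unfolding var1_def by (simp only: tot_add[OF fin_supp_cmult[OF fd(1)] fd(2)] tot_cmult)
    qed
    have var_k: "card {x \<in> ?A. x \<otimes> s i \<notin> ?A} \<le> var1 k (s i)" if i: "i \<in> I" for i
    proof -
      have "1 * real (card {x \<in> ?A. x \<otimes> s i \<notin> ?A}) \<le> tot (\<lambda>x. \<bar>k x - k (x \<otimes> s i)\<bar>)"
        by (rule tot_ge_card[OF fin_supp_abs_diff[OF fs(2) s[OF i]]]) (use A in \<open>auto simp: k_def\<close>)
      then show ?thesis by (simp add: var1_def)
    qed
    have "card I * card ?A / 2 \<le> real (\<Sum>i\<in>I. card {x \<in> ?A. x \<otimes> s i \<notin> ?A})"
    proof (rule cube_boundary_count[where X = "carrier G" and \<xi> = \<xi>])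
      show "inj_on (\<lambda>x. x \<otimes> s i) (carrier G)" if "i \<in> I" for i
        using bij_betw_mult_right[OF s[OF that]] by (simp add: bij_betw_def)
    qed (use assms A less.prems(3) in auto)
    also have "\<dots> \<le> (\<Sum>i\<in>I. var1 k (s i))" using var_k by (simp add: sum_mono)
    finally have "m * (card I * card ?A / 2) \<le> m * (\<Sum>i\<in>I. var1 k (s i))"
      using m by (intro mult_left_mono) auto
    moreover have "card I * tot h / 2 \<le> (\<Sum>i\<in>I. var1 h (s i))"
    proof (rule less.hyps[OF less_card fs(1)])
      show "h x \<ge> 0" for x using m_le by (simp add: h_def)
      show "4 * log 2 (card (supp h)) \<le> card I"
      \<comment> \<open>For empty support the logarithm is 0 by the convention
        \<open>ln 0 = 0\<close>.\<close>
      proof (cases "card (supp h) = 0")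
        case False
        then have "log 2 (card (supp h)) \<le> log 2 (card ?A)" using less_card by (subst log_le_cancel_iff) auto
        then show ?thesis using less.prems(3) by linarith
      qed (simp add: log_def)
    qed
    moreover have "(\<Sum>i\<in>I. var1 f (s i)) = m * (\<Sum>i\<in>I. var1 k (s i)) + (\<Sum>i\<in>I. var1 h (s i))"
      using var by (simp add: sum.distrib sum_distrib_left)
    ultimately show ?thesis by (simp add: tot_f algebra_simps)
  qed
qed

end

subsection \<open>Automorphisms of the tree fixing the end\<close>

lemma verts_iff: "v \<in> verts q \<longleftrightarrow> snd v \<in> H q (fst v)"
  by (cases v) (auto simp: verts_def)

lemma vert_letter: "v \<in> verts q \<Longrightarrow> k \<le> fst v \<Longrightarrow> snd v k < q"
  by (auto simp: verts_iff H_def PiE_iff)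

lemma vert_undefined: "v \<in> verts q \<Longrightarrow> k > fst v \<Longrightarrow> snd v k = undefined"
  by (auto simp: verts_iff H_def PiE_iff extensional_def)

lemma fst_ancestor [simp]: "fst (ancestor v) = fst v - 1"
  by (simp add: ancestor_def)

lemma fst_child [simp]: "fst (child v t) = fst v + 1"
  by (simp add: child_def)

lemma snd_child_last [simp]: "snd (child v t) (fst v + 1) = t"
  by (simp add: child_def)

lemma ancestor_verts [simp]:
  assumes "v \<in> verts q" shows "ancestor v \<in> verts q"
proof -
  obtain N where N: "N \<le> fst v" "\<forall>k\<le>N. snd v k = 0" and v: "snd v \<in> {..fst v} \<rightarrow>\<^sub>E {..<q}"
    using assms by (auto simp: verts_iff H_def)
  have "\<exists>N\<le>fst v - 1. \<forall>k\<le>N. snd (ancestor v) k = 0"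
    using N by (intro exI[of _ "N - 1"]) (auto simp: ancestor_def)
  moreover have "snd (ancestor v) \<in> {..fst v - 1} \<rightarrow>\<^sub>E {..<q}"
    using v by (auto simp: ancestor_def PiE_iff)
  ultimately show ?thesis by (simp add: verts_iff H_def)
qed

lemma child_verts [simp]:
  assumes "v \<in> verts q" "t < q" shows "child v t \<in> verts q"
proof -
  obtain N where N: "N \<le> fst v" "\<forall>k\<le>N. snd v k = 0" and v: "snd v \<in> {..fst v} \<rightarrow>\<^sub>E {..<q}"
    using assms by (auto simp: verts_iff H_def)
  have "\<exists>N\<le>fst v + 1. \<forall>k\<le>N. snd (child v t) k = 0"
    using N by (intro exI[of _ N]) (auto simp: child_def)
  moreover have "snd (child v t) \<in> {..fst v + 1} \<rightarrow>\<^sub>E {..<q}"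
    using v assms(2) by (auto simp: child_def PiE_iff extensional_def)
  ultimately show ?thesis by (simp add: verts_iff H_def)
qed

lemma ancestor_child [simp]: "v \<in> verts q \<Longrightarrow> ancestor (child v t) = v"
  by (rule prod_eqI) (auto simp: ancestor_def child_def restrict_def vert_undefined fun_eq_iff)

lemma child_eq_iff:
  "v \<in> verts q \<Longrightarrow> w \<in> verts q \<Longrightarrow> child v t = child w s \<longleftrightarrow> v = w \<and> t = s"
  by (metis ancestor_child snd_child_last)

lemma child_ancestor: "v \<in> verts q \<Longrightarrow> child (ancestor v) (snd v (fst v)) = v"
  by (rule prod_eqI) (auto simp: ancestor_def child_def restrict_def vert_undefined fun_eq_iff)

lemma fst_ancestor_iter [simp]: "fst ((ancestor ^^ n) v) = fst v - int n"
  by (induction n) auto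

lemma ancestor_iter_verts [simp]: "v \<in> verts q \<Longrightarrow> (ancestor ^^ n) v \<in> verts q"
  by (induction n) auto

lemma snd_ancestor_iter: "k \<le> fst v - int n \<Longrightarrow> snd ((ancestor ^^ n) v) k = snd v k"
  by (induction n) (auto simp: ancestor_def)

lemma vert_eqI:
  assumes "v \<in> verts q" "w \<in> verts q" "fst v = fst w" "\<And>k. k \<le> fst v \<Longrightarrow> snd v k = snd w k"
  shows "v = w"
proof (rule prod_eqI)
  show "snd v = snd w"
  proof
    fix k show "snd v k = snd w k"
      using assms vert_undefined[of v q k] vert_undefined[of w q k] by (cases "k \<le> fst v") auto
  qed
qed fact

lemma fst_omega_ray [simp]: "fst (omega_ray n) = - int n"
  by (simp add: omega_ray_def)

lemma omega_ray_verts [simp]: "(q::nat) > 0 \<Longrightarrow> omega_ray n \<in> verts q"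
  by (auto simp: omega_ray_def verts_iff H_def)

lemma ancestor_omega_ray [simp]: "ancestor (omega_ray n) = omega_ray (Suc n)"
  by (auto simp: ancestor_def omega_ray_def restrict_def fun_eq_iff)

lemma ancestor_iter_omega_ray [simp]: "(ancestor ^^ n) (omega_ray k) = omega_ray (n + k)"
  by (induction n) auto

lemma ancestor_iter_eventually_omega:
  assumes "v \<in> verts q" "q > 0"
  obtains n k where "(ancestor ^^ n) v = omega_ray k"
proof -
  obtain N where N: "N \<le> fst v" "\<forall>k\<le>N. snd v k = 0"
    using assms by (auto simp: verts_iff H_def)
  \<comment> \<open>Capped at 0 since the vertices of \<open>omega_ray\<close> have levels at most
    0.\<close>
  define M where "M = min N 0"
  have M: "M \<le> fst v" "M \<le> 0" "\<forall>k\<le>M. snd v k = 0" using N by (auto simp: M_def)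
  have "(ancestor ^^ nat (fst v - M)) v = omega_ray (nat (- M))"
    using M assms by (intro vert_eqI[of _ q]) (simp_all add: snd_ancestor_iter, simp add: omega_ray_def)
  then show thesis by (rule that)
qed

text \<open>Commuting with \<open>ancestor\<close> is the form in which fixing the end is used;
  \<open>carrier_Aff\<close> shows that it describes the same group.\<close>

definition tree_maps :: "nat \<Rightarrow> (vertex \<Rightarrow> vertex) set" where
  "tree_maps q = {g \<in> extensional (verts q). bij_betw g (verts q) (verts q) \<and>
     (\<forall>v\<in>verts q. g (ancestor v) = ancestor (g v))}"

lemma tree_mapsD:
  assumes "g \<in> tree_maps q"
  shows "g \<in> extensional (verts q)" "bij_betw g (verts q) (verts q)"
    "inj_on g (verts q)" "v \<in> verts q \<Longrightarrow> g v \<in> verts q"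
    "v \<in> verts q \<Longrightarrow> g (ancestor v) = ancestor (g v)"
  using assms by (auto simp: tree_maps_def bij_betw_def)

lemma tree_maps_ancestor_iter:
  assumes "g \<in> tree_maps q" "v \<in> verts q"
  shows "g ((ancestor ^^ n) v) = (ancestor ^^ n) (g v)"
proof (induction n)
  case (Suc n)
  then show ?case using tree_mapsD(5)[OF assms(1) ancestor_iter_verts[OF assms(2), of n]] by simp
qed simp

lemma tree_maps_compose:
  assumes "g \<in> tree_maps q" "h \<in> tree_maps q"
  shows "compose (verts q) h g \<in> tree_maps q"
  unfolding tree_maps_def
  using bij_betw_compose[OF tree_mapsD(2)[OF assms(1)] tree_mapsD(2)[OF assms(2)]]
    tree_mapsD[OF assms(1)] tree_mapsD[OF assms(2)] by (auto simp: compose_def)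

lemma tree_maps_one: "(\<lambda>v\<in>verts q. v) \<in> tree_maps q"
  by (auto simp: tree_maps_def bij_betw_def inj_on_def)

lemma tree_maps_inverse:
  assumes "g \<in> tree_maps q"
  shows "restrict (inv_into (verts q) g) (verts q) \<in> tree_maps q"
proof -
  let ?h = "inv_into (verts q) g"
  note g = tree_mapsD[OF assms]
  have bij: "bij_betw ?h (verts q) (verts q)" using g(2) by (rule bij_betw_inv_into)
  have hv: "?h v \<in> verts q" "g (?h v) = v" if "v \<in> verts q" for v
    using that bij_betwE[OF bij] bij_betw_inv_into_right[OF g(2)] by blast+
  have "?h (ancestor v) = ancestor (?h v)" if "v \<in> verts q" for v
    using inv_into_f_f[OF g(3), of "ancestor (?h v)"] g(5)[of "?h v"] hv[OF that] by simp
  moreover have "bij_betw (restrict ?h (verts q)) (verts q) (verts q)"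
    using bij by (simp cong: bij_betw_cong)
  ultimately show ?thesis by (simp add: tree_maps_def)
qed

lemma ancestor_ray:
  assumes "v \<in> verts q" "q > 0"
  shows "(\<lambda>n. (ancestor ^^ n) v) \<in> end_of q omega_ray"
proof -
  obtain a b where ab: "(ancestor ^^ a) v = omega_ray b"
    using ancestor_iter_eventually_omega[OF assms] .
  have "inj (\<lambda>n. (ancestor ^^ n) v)"
  proof (rule injI)
    fix m n assume "(ancestor ^^ m) v = (ancestor ^^ n) v"
    then have "fst ((ancestor ^^ m) v) = fst ((ancestor ^^ n) v)" by (rule arg_cong)
    then show "m = n" by simp
  qed
  moreover have "\<exists>a b. \<forall>n. (ancestor ^^ (n + a)) v = omega_ray (n + b)"
    using ab by (intro exI[of _ a] exI[of _ b]) (simp add: funpow_add)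
  ultimately show ?thesis using assms by (auto simp: end_of_def ray_def adj_def)
qed

text \<open>Once a ray steps to a child, injectivity forbids the way back to the unique ancestor, so
  it would descend forever; but its tail is the ascending ray \<open>omega_ray\<close>.\<close>

lemma end_ray_goes_up:
  assumes "s \<in> end_of q omega_ray"
  shows "s (Suc n) = ancestor (s n)"
proof (rule ccontr)
  assume neg: "s (Suc n) \<noteq> ancestor (s n)"
  have inj: "inj s" and adj: "\<And>n. adj q (s n) (s (Suc n))"
    using assms by (auto simp: end_of_def ray_def)
  obtain a b where ab: "\<And>n. s (n + a) = omega_ray (n + b)" using assms by (auto simp: end_of_def)
  have down: "s (n + k) = ancestor (s (Suc (n + k)))" for k
  proof (induction k)
    case 0 show ?case using adj[of n] neg by (auto simp: adj_def)
  next
    case (Suc k)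
    then have "s (Suc (Suc (n + k))) \<noteq> ancestor (s (Suc (n + k)))"
      using inj_eq[OF inj, of "Suc (Suc (n + k))" "n + k"] by auto
    then show ?case using adj[of "Suc (n + k)"] by (auto simp: adj_def)
  qed
  have "omega_ray (n + b) = omega_ray (Suc (Suc (n + b)))"
    using down[of a] ab[of n] ab[of "Suc n"] by simp
  then have "fst (omega_ray (n + b)) = fst (omega_ray (Suc (Suc (n + b))))" by (rule arg_cong)
  then show False by simp
qed

lemma tree_maps_end:
  assumes g: "g \<in> tree_maps q" and s: "s \<in> end_of q omega_ray" and "q > 0"
  shows "g \<circ> s \<in> end_of q omega_ray"
proof -
  have inj: "inj s" and adj: "\<And>n. adj q (s n) (s (Suc n))"
    using s by (auto simp: end_of_def ray_def)
  obtain a b where ab: "\<And>n. s (n + a) = omega_ray (n + b)" using s by (auto simp: end_of_def)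
  have sv: "s n \<in> verts q" for n using adj by (auto simp: adj_def)
  obtain m k where mk: "(ancestor ^^ m) (g (omega_ray b)) = omega_ray k"
    using ancestor_iter_eventually_omega tree_mapsD(4)[OF g] omega_ray_verts assms(3) by metis
  have "(g \<circ> s) (n + (m + a)) = omega_ray (n + k)" for n
  proof -
    have "(g \<circ> s) (n + (m + a)) = g ((ancestor ^^ (n + m)) (omega_ray b))"
      using ab[of "n + m"] by (simp add: add.assoc)
    also have "\<dots> = (ancestor ^^ n) ((ancestor ^^ m) (g (omega_ray b)))"
      using tree_maps_ancestor_iter[OF g omega_ray_verts[OF assms(3)]] by (simp add: funpow_add)
    finally show ?thesis by (simp add: mk)
  qed
  moreover have "inj (g \<circ> s)"
    using inj tree_mapsD(3)[OF g] sv by (auto simp: inj_on_def)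
  moreover have "adj q ((g \<circ> s) n) ((g \<circ> s) (Suc n))" for n
    using adj[of n] tree_mapsD(4,5)[OF g] unfolding adj_def comp_def by metis
  ultimately show ?thesis unfolding end_of_def ray_def by blast
qed

text \<open>An element of \<open>Aff\<close> maps the ascending ray of \<open>v\<close> to a ray of
  the same end, whose first step must ascend; this is commutation with \<open>ancestor\<close> at
  \<open>v\<close>. Conversely, \<open>tree_maps_end\<close> for \<open>g\<close> and for its
  inverse gives the two inclusions between the end and its image.\<close>

lemma carrier_Aff:
  assumes "q > 0"
  shows "carrier (Aff q) = tree_maps q"
proof (intro equalityI subsetI)
  fix g assume "g \<in> carrier (Aff q)"
  then have g: "g \<in> extensional (verts q)" "bij_betw g (verts q) (verts q)"
    and e: "(\<lambda>s. g \<circ> s) ` end_of q omega_ray = end_of q omega_ray"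
    by (auto simp: Aff_def tree_auts_def)
  have "g (ancestor v) = ancestor (g v)" if "v \<in> verts q" for v
  proof -
    have "g \<circ> (\<lambda>n. (ancestor ^^ n) v) \<in> end_of q omega_ray"
      using ancestor_ray[OF that assms] e by blast
    from end_ray_goes_up[OF this, of 0] show ?thesis by simp
  qed
  then show "g \<in> tree_maps q" using g by (simp add: tree_maps_def)
next
  fix g assume g: "g \<in> tree_maps q"
  let ?h = "restrict (inv_into (verts q) g) (verts q)"
  have adj: "adj q (g v) (g w) \<longleftrightarrow> adj q v w" if "v \<in> verts q" "w \<in> verts q" for v w
    using that tree_mapsD[OF g] inj_onD[OF tree_mapsD(3)[OF g]] ancestor_verts unfolding adj_def by metis
  have "(\<lambda>s. g \<circ> s) ` end_of q omega_ray = end_of q omega_ray"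
  proof (intro equalityI subsetI)
    fix s assume s: "s \<in> end_of q omega_ray"
    then have sv: "s n \<in> verts q" for n by (auto simp: end_of_def ray_def adj_def)
    then have "g \<circ> (?h \<circ> s) = s"
      using bij_betw_inv_into_right[OF tree_mapsD(2)[OF g]] by (simp add: fun_eq_iff)
    then show "s \<in> (\<lambda>s. g \<circ> s) ` end_of q omega_ray"
      using tree_maps_end[OF tree_maps_inverse[OF g] s assms] by (metis image_eqI)
  qed (use tree_maps_end[OF g _ assms] in auto)
  then show "g \<in> carrier (Aff q)"
    using tree_mapsD[OF g] adj by (simp add: Aff_def tree_auts_def)
qed

lemma mult_Aff [simp]: "g \<otimes>\<^bsub>Aff q\<^esub> h = compose (verts q) h g"
  by (simp add: Aff_def)

lemma one_Aff [simp]: "\<one>\<^bsub>Aff q\<^esub> = (\<lambda>v\<in>verts q. v)"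
  by (simp add: Aff_def)

lemma group_Aff:
  assumes "q > 0" shows "group (Aff q)"
proof (rule groupI)
  show "\<exists>h\<in>carrier (Aff q). h \<otimes>\<^bsub>Aff q\<^esub> g = \<one>\<^bsub>Aff q\<^esub>" if g: "g \<in> carrier (Aff q)" for g
  proof
    show "restrict (inv_into (verts q) g) (verts q) \<otimes>\<^bsub>Aff q\<^esub> g = \<one>\<^bsub>Aff q\<^esub>"
      using bij_betw_inv_into_right[OF tree_mapsD(2)] g unfolding carrier_Aff[OF assms]
      by (simp add: compose_def restrict_def fun_eq_iff split_paired_All[symmetric] del: split_paired_All)
  qed (use g tree_maps_inverse carrier_Aff[OF assms] in auto)
  fix f g h assume "f \<in> carrier (Aff q)" "g \<in> carrier (Aff q)" "h \<in> carrier (Aff q)"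
  then have *: "f \<in> tree_maps q" "g \<in> tree_maps q" "h \<in> tree_maps q" by (auto simp: carrier_Aff[OF assms])
  show "f \<otimes>\<^bsub>Aff q\<^esub> g \<in> carrier (Aff q)"
    using tree_maps_compose[OF *(1,2)] carrier_Aff[OF assms] by simp
  show "f \<otimes>\<^bsub>Aff q\<^esub> g \<otimes>\<^bsub>Aff q\<^esub> h = f \<otimes>\<^bsub>Aff q\<^esub> (g \<otimes>\<^bsub>Aff q\<^esub> h)"
    using tree_mapsD(4)[OF *(1)] by (auto simp: compose_def fun_eq_iff)
  show "\<one>\<^bsub>Aff q\<^esub> \<otimes>\<^bsub>Aff q\<^esub> f = f"
    using tree_mapsD(1)[OF *(1)] by (auto simp: compose_def fun_eq_iff extensional_def)
qed (auto simp: carrier_Aff[OF assms] tree_maps_one)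

text \<open>Some ancestor of \<open>v\<close> lies on the ray of the root, and along ancestors the
  shift of the level does not change.\<close>

lemma level_shift:
  assumes g: "g \<in> tree_maps q" and v: "v \<in> verts q" and "q > 0"
  shows "fst (g v) = fst v + \<Phi> g"
proof -
  obtain n k where nk: "(ancestor ^^ n) v = omega_ray k"
    using ancestor_iter_eventually_omega[OF v assms(3)] .
  have "fst (g v) - int n = fst (g ((ancestor ^^ n) v))"
    using tree_maps_ancestor_iter[OF g v, of n] by simp
  also have "\<dots> = fst (g ((ancestor ^^ k) (omega_ray 0)))" by (simp add: nk)
  also have "\<dots> = fst (g (omega_ray 0)) - int k"
    using tree_maps_ancestor_iter[OF g omega_ray_verts[OF assms(3)], of k 0] by simp
  finally show ?thesis using arg_cong[OF nk, of fst] by (simp add: \<Phi>_def \<beta>_def)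
qed

lemma \<Phi>_mult:
  assumes "g \<in> tree_maps q" "h \<in> tree_maps q" "q > 0"
  shows "\<Phi> (compose (verts q) h g) = \<Phi> g + \<Phi> h"
  using level_shift[OF assms(1) omega_ray_verts[OF assms(3)], of 0]
    level_shift[OF assms(2) tree_mapsD(4)[OF assms(1) omega_ray_verts[OF assms(3)]], of 0] assms(3)
  by (simp add: \<Phi>_def \<beta>_def compose_def)

text \<open>The support of the portrait, expressed without definite descriptions and directly for
  maps with any value of \<Phi>; the link is \<open>portrait_id_iff\<close>.\<close>

definition bad :: "nat \<Rightarrow> (vertex \<Rightarrow> vertex) \<Rightarrow> vertex set" where
  "bad q g = {v \<in> verts q. \<exists>t<q. g (child v t) \<noteq> child (g v) t}"

lemma bad_compose_subset:
  assumes "g \<in> tree_maps q"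
  shows "bad q (compose (verts q) h g) \<subseteq> bad q g \<union> {v \<in> verts q. g v \<in> bad q h}"
  using tree_mapsD(4)[OF assms] by (auto simp: bad_def compose_def)

text \<open>For \<open>h\<close> a power of \<alpha>, this says that passing to the horocyclic part
  does not change where the portrait is nontrivial.\<close>

lemma bad_compose_right:
  assumes "g \<in> tree_maps q" "h \<in> tree_maps q" "bad q h = {}"
  shows "bad q (compose (verts q) h g) = bad q g"
proof -
  have "h (g (child v t)) = child (h (g v)) t \<longleftrightarrow> g (child v t) = child (g v) t"
    if "v \<in> verts q" "t < q" for v t
  proof -
    have gv: "g v \<in> verts q" "g (child v t) \<in> verts q" "child (g v) t \<in> verts q"
      using tree_mapsD(4)[OF assms(1)] that by auto
    then have "child (h (g v)) t = h (child (g v) t)" using assms(3) that unfolding bad_def by fastforce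
    then show ?thesis using inj_on_eq_iff[OF tree_mapsD(3)[OF assms(2)] gv(2,3)] by simp
  qed
  then show ?thesis by (auto simp: bad_def compose_def)
qed

lemma bad_inverse:
  assumes "g \<in> tree_maps q" "h \<in> tree_maps q" "\<And>v. v \<in> verts q \<Longrightarrow> h (g v) = v"
    "\<And>v. v \<in> verts q \<Longrightarrow> g (h v) = v"
  shows "bad q h \<subseteq> g ` bad q g"
proof
  fix v assume "v \<in> bad q h"
  then obtain t where t: "v \<in> verts q" "t < q" "h (child v t) \<noteq> child (h v) t" by (auto simp: bad_def)
  have hv: "h v \<in> verts q" using tree_mapsD(4)[OF assms(2) t(1)] .
  have "g (child (h v) t) \<noteq> child (g (h v)) t"
    using t assms(3)[of "child (h v) t"] assms(4)[of v] hv by auto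
  then have "h v \<in> bad q g" using hv t(2) by (auto simp: bad_def)
  then show "v \<in> g ` bad q g" using assms(4)[OF t(1)] by force
qed

section \<open>The shift, the horocyclic part and portraits\<close>

lemma \<alpha>_tree_maps:
  assumes "q > 0" shows "\<alpha> q \<in> tree_maps q"
proof -
  \<comment> \<open>Stated for an arbitrary shift \<open>j\<close>: 1 gives \<alpha> and -1 its
    inverse.\<close>
  have shift: "(fst v + j, \<lambda>k\<in>{..fst v + j}. snd v (k - j)) \<in> verts q" if v: "v \<in> verts q" for v and j :: int
  proof -
    obtain N where N: "N \<le> fst v" "\<forall>k\<le>N. snd v k = 0" and sv: "snd v \<in> {..fst v} \<rightarrow>\<^sub>E {..<q}"
      using v by (auto simp: verts_iff H_def)
    have "\<exists>N\<le>fst v + j. \<forall>k\<le>N. (\<lambda>k\<in>{..fst v + j}. snd v (k - j)) k = 0"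
      using N by (intro exI[of _ "N + j"]) auto
    moreover have "(\<lambda>k\<in>{..fst v + j}. snd v (k - j)) \<in> {..fst v + j} \<rightarrow>\<^sub>E {..<q}"
      using sv by (auto simp: PiE_iff)
    ultimately show ?thesis by (simp add: verts_iff H_def)
  qed
  define h where "h = (\<lambda>v::vertex. (fst v + (-1), \<lambda>k\<in>{..fst v + (-1)}. snd v (k - (-1))))"
  have aV: "\<alpha> q v \<in> verts q" and hV: "h v \<in> verts q" if "v \<in> verts q" for v
    using shift[OF that, of 1] shift[OF that, of "-1"] that by (simp_all add: \<alpha>_def h_def)
  have "bij_betw (\<alpha> q) (verts q) (verts q)"
  proof (rule bij_betw_byWitness[where f' = h])
    show "\<forall>v\<in>verts q. h (\<alpha> q v) = v"
    proof
      fix v assume v: "v \<in> verts q"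
      show "h (\<alpha> q v) = v" by (rule vert_eqI[OF hV[OF aV[OF v]] v]) (simp_all add: \<alpha>_def h_def v)
    qed
    show "\<forall>v\<in>verts q. \<alpha> q (h v) = v"
    proof
      fix v assume v: "v \<in> verts q"
      show "\<alpha> q (h v) = v" using hV[OF v]
        by (intro vert_eqI[OF aV[OF hV[OF v]] v]) (simp_all add: \<alpha>_def h_def)
    qed
    show "\<alpha> q ` verts q \<subseteq> verts q" "h ` verts q \<subseteq> verts q" using aV hV by auto
  qed
  moreover have "\<alpha> q (ancestor v) = ancestor (\<alpha> q v)" if v: "v \<in> verts q" for v
    by (rule vert_eqI[OF aV[OF ancestor_verts[OF v]] ancestor_verts[OF aV[OF v]]])
       (simp_all add: \<alpha>_def ancestor_verts[OF v] v, simp_all add: ancestor_def v)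
  ultimately show ?thesis by (simp add: tree_maps_def \<alpha>_def)
qed

lemma bad_\<alpha>: "bad q (\<alpha> q) = {}"
proof -
  have "\<alpha> q (child v t) = child (\<alpha> q v) t" if v: "v \<in> verts q" and t: "t < q" for v t
  proof -
    have "q > 0" using t by simp
    note aV = tree_mapsD(4)[OF \<alpha>_tree_maps[OF this]]
    show ?thesis
      by (rule vert_eqI[OF aV[OF child_verts[OF v t]] child_verts[OF aV[OF v] t]])
         (simp_all add: \<alpha>_def child_verts[OF v t] v, simp_all add: child_def v)
  qed
  then show ?thesis by (simp add: bad_def)
qed

lemma \<Phi>_\<alpha>: "q > 0 \<Longrightarrow> \<Phi> (\<alpha> q) = 1"
  by (simp add: \<Phi>_def \<beta>_def \<alpha>_def)

lemma inv_Aff: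
  assumes "q > 0" "g \<in> tree_maps q"
  shows "inv\<^bsub>Aff q\<^esub> g \<in> tree_maps q" "v \<in> verts q \<Longrightarrow> (inv\<^bsub>Aff q\<^esub> g) (g v) = v"
    "v \<in> verts q \<Longrightarrow> g ((inv\<^bsub>Aff q\<^esub> g) v) = v"
proof -
  interpret group "Aff q" using assms(1) by (rule group_Aff)
  have g: "g \<in> carrier (Aff q)" using assms carrier_Aff by simp
  then show "inv\<^bsub>Aff q\<^esub> g \<in> tree_maps q" using inv_closed carrier_Aff[OF assms(1)] by simp
  show "(inv\<^bsub>Aff q\<^esub> g) (g v) = v" if "v \<in> verts q"
    using fun_cong[OF r_inv[OF g], of v] that by (simp add: compose_def)
  show "g ((inv\<^bsub>Aff q\<^esub> g) v) = v" if "v \<in> verts q"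
    using fun_cong[OF l_inv[OF g], of v] that by (simp add: compose_def)
qed

lemma \<Phi>_inv:
  assumes "q > 0" "g \<in> tree_maps q"
  shows "\<Phi> (inv\<^bsub>Aff q\<^esub> g) = - \<Phi> g"
  using level_shift[OF assms(2) tree_mapsD(4)[OF inv_Aff(1)[OF assms] omega_ray_verts[OF assms(1)]] assms(1)]
    level_shift[OF inv_Aff(1)[OF assms] omega_ray_verts[OF assms(1)] assms(1)]
    inv_Aff(3)[OF assms omega_ray_verts[OF assms(1)]] by (metis add.assoc add_cancel_left_right eq_neg_iff_add_eq_0)

lemma \<alpha>_power:
  assumes "q > 0"
  shows "\<alpha> q [^]\<^bsub>Aff q\<^esub> (m::int) \<in> tree_maps q \<and> bad q (\<alpha> q [^]\<^bsub>Aff q\<^esub> m) = {} \<and>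
    \<Phi> (\<alpha> q [^]\<^bsub>Aff q\<^esub> m) = m"
proof -
  interpret group "Aff q" using assms by (rule group_Aff)
  have nat: "\<alpha> q [^]\<^bsub>Aff q\<^esub> n \<in> tree_maps q \<and> bad q (\<alpha> q [^]\<^bsub>Aff q\<^esub> n) = {} \<and>
    \<Phi> (\<alpha> q [^]\<^bsub>Aff q\<^esub> n) = int n" for n :: nat
  proof (induction n)
    case 0
    have "bad q (\<lambda>v\<in>verts q. v) = {}" by (auto simp: bad_def)
    moreover have "\<Phi> (\<lambda>v\<in>verts q. v) = 0" using assms by (simp add: \<Phi>_def)
    ultimately show ?case using tree_maps_one by (simp only: nat_pow_0 one_Aff) simp
  next
    case (Suc n)
    then show ?case
      using bad_compose_right[OF _ \<alpha>_tree_maps[OF assms] bad_\<alpha>]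
      by (simp add: tree_maps_compose \<alpha>_tree_maps assms \<Phi>_mult \<Phi>_\<alpha>)
  qed
  show ?thesis
  proof (cases m rule: int_cases2)
    case (nonneg n) then show ?thesis using nat by (simp add: int_pow_int)
  next
    case (nonpos n)
    have *: "\<alpha> q [^]\<^bsub>Aff q\<^esub> m = inv\<^bsub>Aff q\<^esub> (\<alpha> q [^]\<^bsub>Aff q\<^esub> n)"
      using nonpos \<alpha>_tree_maps[OF assms] carrier_Aff[OF assms] by (simp add: int_pow_neg_int)
    note n = conjunct1[OF nat[of n]]
    show ?thesis unfolding *
      using nat[of n] inv_Aff[OF assms n] bad_inverse[OF n inv_Aff[OF assms n]] \<Phi>_inv[OF assms n] nonpos
      by auto
  qed
qed

text \<open>As powers of \<alpha> have \<Phi> equal to their exponent and \<Phi> vanishes on the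
  horocyclic part, the exponent in the decomposition has to be \<open>\<Phi> g\<close>, which
  settles uniqueness.\<close>

lemma hor_part_eq:
  assumes "q > 0" "g \<in> tree_maps q"
  shows "hor_part q g = compose (verts q) (\<alpha> q [^]\<^bsub>Aff q\<^esub> (- \<Phi> g)) g"
  unfolding hor_part_def
proof (rule the_equality)
  interpret group "Aff q" using assms(1) by (rule group_Aff)
  note pow = \<alpha>_power[OF assms(1)]
  have a: "\<alpha> q \<in> carrier (Aff q)" "g \<in> carrier (Aff q)"
    using \<alpha>_tree_maps assms carrier_Aff by auto
  let ?\<gamma> = "compose (verts q) (\<alpha> q [^]\<^bsub>Aff q\<^esub> (- \<Phi> g)) g"
  have "?\<gamma> \<in> tree_maps q" using assms pow by (intro tree_maps_compose) auto
  moreover have "\<Phi> ?\<gamma> = 0" using \<Phi>_mult[OF assms(2) _ assms(1)] pow by simp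
  moreover have "g = (g \<otimes>\<^bsub>Aff q\<^esub> \<alpha> q [^]\<^bsub>Aff q\<^esub> (- \<Phi> g)) \<otimes>\<^bsub>Aff q\<^esub> (\<alpha> q [^]\<^bsub>Aff q\<^esub> \<Phi> g)"
    using a by (subst m_assoc) (auto simp: int_pow_mult[symmetric] simp del: mult_Aff one_Aff)
  ultimately show "?\<gamma> \<in> Hor q \<and> (\<exists>m::int. g = ?\<gamma> \<otimes>\<^bsub>Aff q\<^esub> (\<alpha> q [^]\<^bsub>Aff q\<^esub> m))"
    unfolding Hor_def using carrier_Aff[OF assms(1)] by auto
  fix \<gamma> assume "\<gamma> \<in> Hor q \<and> (\<exists>m::int. g = \<gamma> \<otimes>\<^bsub>Aff q\<^esub> (\<alpha> q [^]\<^bsub>Aff q\<^esub> m))"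
  then obtain m :: int where \<gamma>: "\<gamma> \<in> carrier (Aff q)" "\<Phi> \<gamma> = 0"
    and g: "g = \<gamma> \<otimes>\<^bsub>Aff q\<^esub> (\<alpha> q [^]\<^bsub>Aff q\<^esub> m)" by (auto simp: Hor_def)
  have "\<Phi> g = m" using g \<gamma> pow[of m] \<Phi>_mult[of \<gamma> q _] assms(1) carrier_Aff by auto
  moreover have "\<gamma> = g \<otimes>\<^bsub>Aff q\<^esub> (\<alpha> q [^]\<^bsub>Aff q\<^esub> (- m))"
    unfolding g using a \<gamma> by (subst m_assoc) (auto simp: int_pow_mult[symmetric] simp del: mult_Aff one_Aff)
  ultimately show "\<gamma> = ?\<gamma>" by simp
qed

lemma hor_portrait_id_iff:
  assumes g: "g \<in> tree_maps q" and v: "v \<in> verts q"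
  shows "hor_portrait q g v = id \<longleftrightarrow> v \<notin> bad q g"
proof -
  \<comment> \<open>The last letter of the image of the child; beyond the alphabet the identity, as
    \<open>permutes\<close> demands.\<close>
  define \<sigma> where "\<sigma> = (\<lambda>t. if t < q then snd (g (child v t)) (fst (g (child v t))) else t)"
  note gD = tree_mapsD[OF g]
  have \<sigma>: "g (child v t) = child (g v) (\<sigma> t)" "\<sigma> t < q" if "t < q" for t
  proof -
    have c: "child v t \<in> verts q" using v that by simp
    have "ancestor (g (child v t)) = g v" using gD(5)[OF c] v by simp
    then show "g (child v t) = child (g v) (\<sigma> t)"
      using child_ancestor[OF gD(4)[OF c]] that by (simp add: \<sigma>_def)
    show "\<sigma> t < q" using vert_letter[OF gD(4)[OF c]] that by (simp add: \<sigma>_def)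
  qed
  have "inj_on \<sigma> {..<q}"
  proof (rule inj_onI)
    fix s t assume st: "s \<in> {..<q}" "t \<in> {..<q}" "\<sigma> s = \<sigma> t"
    then have "g (child v s) = g (child v t)" using \<sigma> by auto
    then show "s = t" using inj_onD[OF gD(3)] st v child_eq_iff[OF v v] child_verts[OF v] by blast
  qed
  then have "bij_betw \<sigma> {..<q} {..<q}"
    using \<sigma>(2) by (intro bij_betw_imageI endo_inj_surj) auto
  then have perm: "\<sigma> permutes {..<q}" by (rule bij_imp_permutes) (simp add: \<sigma>_def)
  have uniq: "\<tau> = \<sigma>" if \<tau>: "\<tau> permutes {..<q} \<and> (\<forall>t<q. g (child v t) = child (g v) (\<tau> t))" for \<tau>
  proof
    fix t show "\<tau> t = \<sigma> t"
    proof (cases "t < q")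
      case True
      then show ?thesis using \<tau> \<sigma>(1) child_eq_iff[OF gD(4)[OF v] gD(4)[OF v]] by metis
    next
      case False
      then show ?thesis using \<tau> by (auto simp: \<sigma>_def permutes_def)
    qed
  qed
  have "hor_portrait q g v = \<sigma>"
    unfolding hor_portrait_def using perm \<sigma>(1) uniq by (intro the_equality) auto
  moreover have "\<sigma> = id \<longleftrightarrow> (\<forall>t<q. \<sigma> t = t)" by (auto simp: \<sigma>_def fun_eq_iff)
  moreover have "\<sigma> t = t \<longleftrightarrow> g (child v t) = child (g v) t" if "t < q" for t
    using \<sigma>(1)[OF that] child_eq_iff[OF gD(4)[OF v] gD(4)[OF v]] by simp
  ultimately show ?thesis using v by (auto simp: bad_def)
qed

lemma portrait_id_iff:
  assumes "q > 0" "g \<in> tree_maps q" "v \<in> verts q"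
  shows "portrait q g v = id \<longleftrightarrow> v \<notin> bad q g"
proof -
  note pow = \<alpha>_power[OF assms(1), of "- \<Phi> g"]
  have "compose (verts q) (\<alpha> q [^]\<^bsub>Aff q\<^esub> (- \<Phi> g)) g \<in> tree_maps q"
    using assms pow by (intro tree_maps_compose) auto
  then show ?thesis
    unfolding portrait_def hor_part_eq[OF assms(1,2)]
    using hor_portrait_id_iff[OF _ assms(3)] bad_compose_right[OF assms(2), of "\<alpha> q [^]\<^bsub>Aff q\<^esub> (- \<Phi> g)"] pow
    by simp
qed

section \<open>The discrete affine group\<close>

lemma carrier_DA:
  assumes "q > 0"
  shows "carrier (DA q) = {g \<in> tree_maps q. finite (bad q g)}"
proof -
  have "{v \<in> verts q. portrait q g v \<noteq> id} = bad q g" if "g \<in> tree_maps q" for g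
    using portrait_id_iff[OF assms that] by (auto simp: bad_def)
  then show ?thesis by (auto simp: DA_def carrier_Aff[OF assms])
qed

lemma mult_DA [simp]: "g \<otimes>\<^bsub>DA q\<^esub> h = compose (verts q) h g"
  by (simp add: DA_def)

lemma one_DA [simp]: "\<one>\<^bsub>DA q\<^esub> = (\<lambda>v\<in>verts q. v)"
  by (simp add: DA_def)

lemma finite_bad_compose:
  assumes g: "g \<in> tree_maps q" and "finite (bad q g)" "finite (bad q h)"
  shows "finite (bad q (compose (verts q) h g))"
proof -
  have "finite {v \<in> verts q. g v \<in> bad q h}"
  proof (rule finite_imageD)
    show "finite (g ` {v \<in> verts q. g v \<in> bad q h})" by (rule finite_subset[OF _ assms(3)]) auto
    show "inj_on g {v \<in> verts q. g v \<in> bad q h}" by (rule inj_on_subset[OF tree_mapsD(3)[OF g]]) auto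
  qed
  then show ?thesis using bad_compose_subset[OF g, of h] assms(2) by (auto intro: finite_subset)
qed

lemma subgroup_DA:
  assumes "q > 0" shows "subgroup (carrier (DA q)) (Aff q)"
proof -
  interpret group "Aff q" using assms by (rule group_Aff)
  show ?thesis
  proof (rule subgroupI)
    show "carrier (DA q) \<subseteq> carrier (Aff q)" by (auto simp: carrier_DA carrier_Aff assms)
    show "carrier (DA q) \<noteq> {}"
      using \<alpha>_tree_maps[OF assms] bad_\<alpha> by (force simp: carrier_DA assms)
    show "inv\<^bsub>Aff q\<^esub> g \<in> carrier (DA q)" if "g \<in> carrier (DA q)" for g
    proof -
      have g: "g \<in> tree_maps q" "finite (bad q g)" using that by (auto simp: carrier_DA assms)
      show ?thesis using inv_Aff[OF assms g(1)] g(2) bad_inverse[OF g(1) inv_Aff[OF assms g(1)]]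
        by (auto simp: carrier_DA assms intro: finite_subset)
    qed
    show "g \<otimes>\<^bsub>Aff q\<^esub> h \<in> carrier (DA q)" if "g \<in> carrier (DA q)" "h \<in> carrier (DA q)" for g h
      using that by (auto simp: carrier_DA assms tree_maps_compose finite_bad_compose)
  qed
qed

lemma group_DA:
  assumes "q > 0" shows "group (DA q)"
  using subgroup.subgroup_is_group[OF subgroup_DA[OF assms] group_Aff[OF assms]] by (simp add: DA_def)

lemma inv_DA:
  assumes "q > 0" "g \<in> carrier (DA q)"
  shows "inv\<^bsub>DA q\<^esub> g = inv\<^bsub>Aff q\<^esub> g"
  using group.m_inv_consistent[OF group_Aff[OF assms(1)] subgroup_DA[OF assms(1)] assms(2)]
  by (simp add: DA_def)

subsection \<open>A cube of flips\<close>

definition swap01 :: "nat \<Rightarrow> nat" where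
  "swap01 t = (if t = 0 then 1 else if t = 1 then 0 else t)"

lemma swap01_simps [simp]: "swap01 0 = 1" "swap01 1 = 0" "swap01 (Suc 0) = 0" "swap01 (swap01 t) = t"
  by (auto simp: swap01_def)

lemma swap01_less: "q \<ge> 2 \<Longrightarrow> t < q \<Longrightarrow> swap01 t < q"
  by (auto simp: swap01_def)

definition below :: "vertex \<Rightarrow> vertex \<Rightarrow> bool" where
  "below w v \<longleftrightarrow> fst w < fst v \<and> (\<forall>k\<le>fst w. snd v k = snd w k)"

text \<open>For a vertex \<open>w\<close>, the automorphism whose only nontrivial portrait value is
  the transposition of 0 and 1 at \<open>w\<close>.\<close>

definition flip :: "nat \<Rightarrow> vertex \<Rightarrow> vertex \<Rightarrow> vertex" where
  "flip q w = (\<lambda>v\<in>verts q. if below w v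
     then (fst v, (snd v)(fst w + 1 := swap01 (snd v (fst w + 1)))) else v)"

lemma below_child_iff:
  assumes "v \<in> verts q" "w \<in> verts q"
  shows "below w (child v t) \<longleftrightarrow> below w v \<or> v = w"
proof
  assume b: "below w (child v t)"
  show "below w v \<or> v = w"
  proof (cases "fst v = fst w")
    case True
    have "snd v k = snd w k" if "k \<le> fst v" for k
      using b that True unfolding below_def child_def by (auto split: if_splits)
    then have "v = w" using True by (intro vert_eqI[OF assms]) auto
    then show ?thesis by simp
  next
    case False
    then show ?thesis using b by (auto simp: below_def child_def split: if_splits)
  qed
qed (auto simp: below_def child_def)

context
  fixes q :: nat
  assumes q: "q \<ge> 2"
begin

lemma q_pos: "q > 0" using q by simp

lemma flip_verts:
  assumes "v \<in> verts q" shows "flip q w v \<in> verts q"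
proof (cases "below w v")
  case True
  obtain N where N: "N \<le> fst v" "\<forall>k\<le>N. snd v k = 0" and sv: "snd v \<in> {..fst v} \<rightarrow>\<^sub>E {..<q}"
    using assms by (auto simp: verts_iff H_def)
  let ?u = "(snd v)(fst w + 1 := swap01 (snd v (fst w + 1)))"
  have "\<exists>N\<le>fst v. \<forall>k\<le>N. ?u k = 0"
    using N by (intro exI[of _ "min N (fst w)"]) auto
  moreover have "?u \<in> {..fst v} \<rightarrow>\<^sub>E {..<q}"
    using sv True swap01_less[OF q] vert_letter[OF assms]
    by (auto simp: PiE_iff below_def extensional_def)
  ultimately show ?thesis using True assms by (simp add: verts_iff H_def flip_def)
qed (use assms in \<open>simp add: flip_def\<close>)

lemma below_flip: "v \<in> verts q \<Longrightarrow> below w (flip q w v) = below w v"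
  by (auto simp: flip_def below_def)

lemma fst_flip: "v \<in> verts q \<Longrightarrow> fst (flip q w v) = fst v"
  by (auto simp: flip_def)

lemma snd_flip:
  "v \<in> verts q \<Longrightarrow> below w v \<Longrightarrow>
    snd (flip q w v) = (snd v)(fst w + 1 := swap01 (snd v (fst w + 1)))"
  by (auto simp: flip_def)

lemma flip_outside: "v \<in> verts q \<Longrightarrow> \<not> below w v \<Longrightarrow> flip q w v = v"
  by (auto simp: flip_def)

lemma flip_flip:
  assumes v: "v \<in> verts q" shows "flip q w (flip q w v) = v"
proof (cases "below w v")
  case True
  then show ?thesis
    by (intro vert_eqI[OF flip_verts[OF flip_verts[OF v]] v])
       (simp_all add: fst_flip flip_verts snd_flip below_flip v)
qed (simp add: flip_outside v)

lemma flip_ancestor: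
  assumes v: "v \<in> verts q"
  shows "flip q w (ancestor v) = ancestor (flip q w v)"
proof (rule vert_eqI[OF flip_verts[OF ancestor_verts[OF v]] ancestor_verts[OF flip_verts[OF v]]])
  have b: "below w (ancestor v) \<longleftrightarrow> below w v \<and> fst w < fst v - 1"
    by (auto simp: below_def ancestor_def)
  fix k assume k: "k \<le> fst (flip q w (ancestor v))"
  then have k': "k \<le> fst v - 1" by (simp add: fst_flip v)
  show "snd (flip q w (ancestor v)) k = snd (ancestor (flip q w v)) k"
  proof (cases "below w v")
    case True
    then have "snd (ancestor (flip q w v)) k = ((snd v)(fst w + 1 := swap01 (snd v (fst w + 1)))) k"
      using k' by (simp add: ancestor_def fst_flip snd_flip v)
    moreover have "snd (flip q w (ancestor v)) k = ((snd v)(fst w + 1 := swap01 (snd v (fst w + 1)))) k"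
    proof (cases "fst w < fst v - 1")
      case True
      then show ?thesis using \<open>below w v\<close> b k' by (simp add: snd_flip v) (simp add: ancestor_def)
    next
      case False
      then show ?thesis using b k' by (simp add: flip_outside v) (auto simp: ancestor_def)
    qed
    ultimately show ?thesis by simp
  qed (use b in \<open>simp add: flip_outside v\<close>)
qed (simp add: fst_flip flip_verts v)

lemma flip_tree_maps: "flip q w \<in> tree_maps q"
proof -
  have "bij_betw (flip q w) (verts q) (verts q)"
    by (rule bij_betw_byWitness[where f' = "flip q w"]) (auto simp: flip_flip flip_verts)
  then show ?thesis using flip_ancestor by (simp add: tree_maps_def) (simp add: flip_def)
qed

lemma flip_child:
  assumes "w \<in> verts q" "t < q"
  shows "flip q w (child w t) = child w (swap01 t)"
proof (rule vert_eqI[OF flip_verts[OF child_verts[OF assms]] child_verts[OF assms(1) swap01_less[OF q assms(2)]]])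
  have b: "below w (child w t)" using assms by (simp add: below_child_iff)
  show "snd (flip q w (child w t)) k = snd (child w (swap01 t)) k" for k
    using b assms by (simp add: snd_flip) (simp add: child_def)
qed (simp add: fst_flip assms)

lemma flip_child_other:
  assumes "v \<in> verts q" "w \<in> verts q" "v \<noteq> w" "t < q"
  shows "flip q w (child v t) = child (flip q w v) t"
proof (cases "below w v")
  case True
  then have b: "below w (child v t)" using assms by (simp add: below_child_iff)
  show ?thesis
  proof (rule vert_eqI[OF flip_verts[OF child_verts] child_verts[OF flip_verts]])
    show "snd (flip q w (child v t)) k = snd (child (flip q w v) t) k" for k
      using b True assms by (simp add: snd_flip) (simp add: child_def fst_flip snd_flip below_def)
  qed (simp_all add: fst_flip assms)
next
  case False
  then have "\<not> below w (child v t)" using assms by (simp add: below_child_iff)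
  then show ?thesis using False assms by (simp add: flip_outside)
qed

lemma bad_flip: "w \<in> verts q \<Longrightarrow> bad q (flip q w) \<subseteq> {w}"
  unfolding bad_def using flip_child_other by blast

lemma flip_DA: "w \<in> verts q \<Longrightarrow> flip q w \<in> carrier (DA q)"
  using bad_flip[of w] flip_tree_maps finite_subset[of _ "{w}"] by (auto simp: carrier_DA q_pos)

lemma \<alpha>_DA: "\<alpha> q \<in> carrier (DA q)"
  using \<alpha>_tree_maps bad_\<alpha> by (simp add: carrier_DA q_pos)

section \<open>Elements acting on the subtree below the root\<close>

abbreviation descend :: "nat list \<Rightarrow> vertex" where
  "descend xs \<equiv> foldl child (omega_ray 0) xs"

lemma descend_verts: "set xs \<subseteq> {..<q} \<Longrightarrow> descend xs \<in> verts q"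
  by (induction xs rule: rev_induct) (auto simp: q_pos)

lemma fst_foldl_child [simp]: "fst (foldl child v xs) = fst v + int (length xs)"
  by (induction xs rule: rev_induct) auto

lemma descend_inj:
  assumes "set xs \<subseteq> {..<q}" "set ys \<subseteq> {..<q}" "descend xs = descend ys"
  shows "xs = ys"
proof -
  have "length xs = length ys" using arg_cong[OF assms(3), of fst] by simp
  then show ?thesis using assms
  proof (induction xs arbitrary: ys rule: rev_induct)
    case (snoc x xs)
    then obtain y ys' where ys: "ys = ys' @ [y]" by (metis length_0_conv rev_exhaust snoc_eq_iff_butlast)
    have "descend xs = descend ys' \<and> x = y"
      using child_eq_iff[OF descend_verts[of xs] descend_verts[of ys']] snoc.prems ys by simp
    then show ?case using snoc.IH[of ys'] snoc.prems ys by simp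
  qed simp
qed

lemma below_root_descend:
  assumes "v \<in> verts q" "below (omega_ray 0) v"
  shows "\<exists>xs. set xs \<subseteq> {..<q} \<and> v = descend xs"
  using assms
proof (induction "nat (fst v)" arbitrary: v)
  case 0 then show ?case by (auto simp: below_def)
next
  case (Suc n)
  define w t where "w = ancestor v" and "t = snd v (fst v)"
  have v: "v = child w t" "w \<in> verts q" "t < q"
    using child_ancestor[OF Suc.prems(1)] Suc.prems(1) vert_letter[OF Suc.prems(1)] by (auto simp: w_def t_def)
  show ?case
  proof (cases "w = omega_ray 0")
    case True
    then show ?thesis using v by (intro exI[of _ "[t]"]) auto
  next
    case False
    then have "below (omega_ray 0) w"
      using Suc.prems(2) v below_child_iff[OF v(2) omega_ray_verts[OF q_pos]] by simp
    moreover have "n = nat (fst w)" using Suc.hyps(2) by (simp add: w_def)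
    ultimately obtain xs where "set xs \<subseteq> {..<q}" "w = descend xs" using Suc.hyps(1) v(2) by blast
    then show ?thesis using v by (intro exI[of _ "xs @ [t]"]) auto
  qed
qed

text \<open>With no bad vertex from the level of \<open>v\<close> on, \<open>g\<close> carries the
  subtree below \<open>v\<close> rigidly and keeps all letters.\<close>

lemma tree_map_foldl_child:
  assumes g: "g \<in> tree_maps q" and v: "v \<in> verts q" and xs: "set xs \<subseteq> {..<q}"
    and bad: "\<And>w. w \<in> bad q g \<Longrightarrow> fst w < fst v"
  shows "g (foldl child v xs) = foldl child (g v) xs"
  using xs
proof (induction xs rule: rev_induct)
  case (snoc x xs)
  let ?w = "foldl child v xs"
  have "?w \<in> verts q" using snoc.prems v by (induction xs rule: rev_induct) auto
  moreover have "?w \<notin> bad q g" using bad[of ?w] by auto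
  ultimately show ?case using snoc by (auto simp: bad_def)
qed simp

lemma \<alpha>_descend: "set xs \<subseteq> {..<q} \<Longrightarrow> \<alpha> q (descend xs) = descend (0 # xs)"
proof -
  assume "set xs \<subseteq> {..<q}"
  then have "\<alpha> q (descend xs) = foldl child (\<alpha> q (omega_ray 0)) xs"
    by (intro tree_map_foldl_child) (auto simp: \<alpha>_tree_maps bad_\<alpha> q_pos)
  moreover have "\<alpha> q (omega_ray 0) = child (omega_ray 0) 0"
    using tree_mapsD(4)[OF \<alpha>_tree_maps[OF q_pos] omega_ray_verts[OF q_pos]]
    by (rule vert_eqI[OF _ child_verts[OF omega_ray_verts[OF q_pos] q_pos]])
       (simp_all add: \<alpha>_def q_pos, simp add: omega_ray_def child_def)
  ultimately show ?thesis by simp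
qed

abbreviation root_flip :: "vertex \<Rightarrow> vertex" where
  "root_flip \<equiv> flip q (omega_ray 0)"

lemma root_flip_descend:
  assumes "t < q" "set xs \<subseteq> {..<q}"
  shows "root_flip (descend (t # xs)) = descend (swap01 t # xs)"
proof -
  have r: "omega_ray 0 \<in> verts q" by (simp add: q_pos)
  have "fst w < fst (child (omega_ray 0) t)" if "w \<in> bad q root_flip" for w
    using that bad_flip[OF r] by auto
  then have "root_flip (foldl child (child (omega_ray 0) t) xs) =
      foldl child (root_flip (child (omega_ray 0) t)) xs"
    by (intro tree_map_foldl_child flip_tree_maps child_verts r assms)
  then show ?thesis using flip_child[OF r assms(1)] by simp
qed

abbreviation child_flip :: "vertex \<Rightarrow> vertex" where
  "child_flip \<equiv> flip q (child (omega_ray 0) 0)"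

lemma child_flip_descend:
  assumes "t < q" "x < q"
  shows "child_flip (descend [t, x]) = descend [t, if t = 0 then swap01 x else x]"
proof (cases "t = 0")
  case True
  then show ?thesis using flip_child[of "child (omega_ray 0) 0" x] assms q_pos by simp
next
  case False
  have "\<not> below (child (omega_ray 0) 0) (descend [t, x])"
    using False assms below_child_iff[of "child (omega_ray 0) t" q "child (omega_ray 0) 0" x]
      child_eq_iff[of "omega_ray 0" q "omega_ray 0" t 0]
    by (simp add: q_pos) (simp add: below_def)
  then show ?thesis using False assms q_pos descend_verts[of "[t, x]"] by (simp add: flip_outside)
qed

text \<open>\<open>root_flip\<close> conjugates \<open>child_flip\<close> to the flip at the child
  1, so this product flips at both children 0 and 1 of the root. It is the square of
  \<open>child_flip\<close> times \<open>root_flip\<close>, hence of even word length for any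
  generators; \<open>root_flip\<close> alone would also toggle a coordinate but might be given by a
  word of odd length only.\<close>

definition twin_flip :: "vertex \<Rightarrow> vertex" where
  "twin_flip = ((child_flip \<otimes>\<^bsub>DA q\<^esub> root_flip) \<otimes>\<^bsub>DA q\<^esub> child_flip) \<otimes>\<^bsub>DA q\<^esub> root_flip"

lemma twin_flip_apply: "v \<in> verts q \<Longrightarrow> twin_flip v = root_flip (child_flip (root_flip (child_flip v)))"
  by (simp add: twin_flip_def compose_def)

lemma child_flip_DA: "child_flip \<in> carrier (DA q)" and root_flip_DA: "root_flip \<in> carrier (DA q)"
  by (auto intro!: flip_DA simp: q_pos)

lemma twin_flip_DA: "twin_flip \<in> carrier (DA q)"
proof -
  interpret group "DA q" by (rule group_DA[OF q_pos])
  show ?thesis unfolding twin_flip_def by (intro m_closed child_flip_DA root_flip_DA)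
qed

lemma twin_flip_descend:
  assumes "x \<in> {0, 1}"
  shows "twin_flip (descend [0, x]) = descend [0, swap01 x]"
proof -
  have lt: "x < q" "swap01 x < q" "0 < q" "1 < q" "Suc 0 < q" using assms q by auto
  have "child_flip (descend [0, x]) = descend [0, swap01 x]"
    using child_flip_descend[of 0 x] lt by simp
  moreover have "root_flip (descend [0, swap01 x]) = descend [1, swap01 x]"
    using root_flip_descend[of 0 "[swap01 x]"] lt by simp
  moreover have "child_flip (descend [1, swap01 x]) = descend [1, swap01 x]"
    using child_flip_descend[of 1 "swap01 x"] lt by simp
  moreover have "root_flip (descend [1, swap01 x]) = descend [0, swap01 x]"
    using root_flip_descend[of 1 "[swap01 x]"] lt by simp
  ultimately show ?thesis using twin_flip_apply[OF descend_verts[of "[0, x]"]] lt by simp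
qed

lemma twin_flip_outside:
  assumes v: "v \<in> verts q" "\<not> below (omega_ray 0) v"
  shows "twin_flip v = v"
proof -
  have "\<not> below (child (omega_ray 0) 0) v"
  proof
    assume b: "below (child (omega_ray 0) 0) v"
    have "snd v k = snd (omega_ray 0) k" if "k \<le> 0" for k
      using b that by (simp add: below_def child_def)
    then show False using v(2) b by (simp add: below_def)
  qed
  then show ?thesis using twin_flip_apply[OF v(1)] flip_outside v by simp
qed

text \<open>The right factor acts last, so letters are added in front: \<alpha> sends the root to
  its child 0 and keeps all letters, hence prepends 0, and \<open>root_flip\<close> turns that 0
  into 1. Every letter costs a bounded number of generators.\<close>

fun embed :: "nat list \<Rightarrow> vertex \<Rightarrow> vertex" where
  "embed [] = \<one>\<^bsub>DA q\<^esub>"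
| "embed (t # ts) = embed ts \<otimes>\<^bsub>DA q\<^esub> (if t = 0 then \<alpha> q else \<alpha> q \<otimes>\<^bsub>DA q\<^esub> root_flip)"

lemma embed_DA: "embed ts \<in> carrier (DA q)"
proof -
  interpret group "DA q" by (rule group_DA[OF q_pos])
  show ?thesis
    by (induction ts) (auto intro!: m_closed \<alpha>_DA root_flip_DA simp del: one_DA mult_DA)
qed

lemma DA_tree_maps: "g \<in> carrier (DA q) \<Longrightarrow> g \<in> tree_maps q"
  by (simp add: carrier_DA q_pos)

lemma embed_descend:
  assumes "set ts \<subseteq> {0, 1}" "set xs \<subseteq> {..<q}"
  shows "embed ts (descend xs) = descend (ts @ xs)"
  using assms
proof (induction ts)
  case Nil
  then show ?case using descend_verts[of xs] by simp
next
  case (Cons t ts)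
  have sub: "set (ts @ xs) \<subseteq> {..<q}" using Cons.prems q by auto
  have v: "descend xs \<in> verts q" "descend (ts @ xs) \<in> verts q" using descend_verts[OF sub] descend_verts[of xs] Cons.prems by auto
  have IH: "embed ts (descend xs) = descend (ts @ xs)" using Cons by simp
  show ?case
  proof (cases "t = 0")
    case True
    have "embed (t # ts) (descend xs) = \<alpha> q (embed ts (descend xs))"
      using True v by (simp add: compose_def)
    then show ?thesis using True \<alpha>_descend[OF sub] IH by simp
  next
    case False
    then have t: "t = 1" using Cons.prems by simp
    have "embed (t # ts) (descend xs) = root_flip (\<alpha> q (embed ts (descend xs)))"
      using t v IH by (simp add: compose_def)
    then show ?thesis using t \<alpha>_descend[OF sub] IH root_flip_descend[OF q_pos sub] by simp
  qed
qed

definition site :: "nat list \<Rightarrow> vertex \<Rightarrow> vertex" where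
  "site ts = (inv\<^bsub>DA q\<^esub> embed ts \<otimes>\<^bsub>DA q\<^esub> twin_flip) \<otimes>\<^bsub>DA q\<^esub> embed ts"

lemma site_DA: "site ts \<in> carrier (DA q)"
proof -
  interpret group "DA q" by (rule group_DA[OF q_pos])
  show ?thesis unfolding site_def by (intro m_closed inv_closed embed_DA twin_flip_DA)
qed

lemma inv_DA_apply:
  assumes "g \<in> carrier (DA q)" "v \<in> verts q"
  shows "(inv\<^bsub>DA q\<^esub> g) (g v) = v" "g ((inv\<^bsub>DA q\<^esub> g) v) = v" "(inv\<^bsub>DA q\<^esub> g) v \<in> verts q"
  using inv_Aff[OF q_pos DA_tree_maps[OF assms(1)]] assms(2) tree_mapsD(4)
  unfolding inv_DA[OF q_pos assms(1)] by auto

lemma site_apply: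
  "v \<in> verts q \<Longrightarrow> site ts v = embed ts (twin_flip ((inv\<^bsub>DA q\<^esub> embed ts) v))"
  by (simp add: site_def compose_def)

lemma site_swap:
  assumes "set ts \<subseteq> {0, 1}" "x \<in> {0, 1}"
  shows "site ts (descend (ts @ [0, x])) = descend (ts @ [0, swap01 x])"
proof -
  have lt: "x < q" "swap01 x < q" "0 < q" using assms q by auto
  have e: "embed ts (descend [0, x]) = descend (ts @ [0, x])"
    "embed ts (descend [0, swap01 x]) = descend (ts @ [0, swap01 x])"
    using embed_descend[OF assms(1), of "[0, x]"] embed_descend[OF assms(1), of "[0, swap01 x]"] lt by auto
  have v: "descend [0, x] \<in> verts q" using descend_verts[of "[0, x]"] lt by simp
  have "site ts (embed ts (descend [0, x])) = embed ts (twin_flip (descend [0, x]))"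
    using site_apply[OF tree_mapsD(4)[OF DA_tree_maps[OF embed_DA] v]] inv_DA_apply(1)[OF embed_DA v] by simp
  then show ?thesis using e twin_flip_descend[OF assms(2)] by simp
qed

text \<open>If the preimage of the vertex under \<open>embed ts\<close> were below the root, the
  vertex would be an extension of the word \<open>ts\<close>; equal lengths then force
  \<open>us = ts\<close>. And \<open>twin_flip\<close> fixes everything not below the root.\<close>

lemma site_fix:
  assumes "set ts \<subseteq> {0, 1}" "set us \<subseteq> {0, 1}" "length us = length ts" "us \<noteq> ts" "x \<in> {0, 1}"
  shows "site ts (descend (us @ [0, x])) = descend (us @ [0, x])"
proof -
  let ?v = "descend (us @ [0, x])"
  have sub: "set (us @ [0, x]) \<subseteq> {..<q}" using assms q by auto
  have v: "?v \<in> verts q" by (rule descend_verts[OF sub])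
  let ?w = "(inv\<^bsub>DA q\<^esub> embed ts) ?v"
  note w = inv_DA_apply(2,3)[OF embed_DA v, of ts]
  have "\<not> below (omega_ray 0) ?w"
  proof
    assume "below (omega_ray 0) ?w"
    then obtain xs where xs: "set xs \<subseteq> {..<q}" "?w = descend xs" using below_root_descend w(2) by blast
    then have "descend (us @ [0, x]) = descend (ts @ xs)"
      using w(1) embed_descend[OF assms(1) xs(1)] by simp
    moreover have "set (ts @ xs) \<subseteq> {..<q}" using assms(1) xs(1) q by auto
    ultimately have "us @ [0, x] = ts @ xs" using descend_inj[OF sub] by blast
    then show False using assms(3,4) by simp
  qed
  then show ?thesis using site_apply[OF v] twin_flip_outside w by simp
qed

text \<open>
  The order of the last letters of the preimages of the two children \<open>00\<close> and \<open>01\<close> below the vertex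
  \<open>ts\<close> is a coordinate of \<open>g\<close> that right multiplication by \<open>site ts\<close> flips, while the other
  sites of the same length leave it alone.
\<close>

definition coord :: "nat list \<Rightarrow> (vertex \<Rightarrow> vertex) \<Rightarrow> bool" where
  "coord ts g \<longleftrightarrow>
     (let v = (inv\<^bsub>DA q\<^esub> g) (descend (ts @ [0, 0])); w = (inv\<^bsub>DA q\<^esub> g) (descend (ts @ [0, 1]))
      in snd v (fst v) < snd w (fst w))"

lemma inv_mult_apply:
  assumes "g \<in> carrier (DA q)" "s \<in> carrier (DA q)" "v \<in> verts q" "s v = w"
  shows "(inv\<^bsub>DA q\<^esub> (g \<otimes>\<^bsub>DA q\<^esub> s)) w = (inv\<^bsub>DA q\<^esub> g) v"
proof -
  interpret group "DA q" by (rule group_DA[OF q_pos])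
  have w: "w \<in> verts q" using tree_mapsD(4)[OF DA_tree_maps[OF assms(2)] assms(3)] assms(4) by simp
  have "inv\<^bsub>DA q\<^esub> (g \<otimes>\<^bsub>DA q\<^esub> s) = inv\<^bsub>DA q\<^esub> s \<otimes>\<^bsub>DA q\<^esub> inv\<^bsub>DA q\<^esub> g"
    by (rule inv_mult_group[OF assms(1,2)])
  then show ?thesis using w inv_DA_apply(1)[OF assms(2,3)] assms(4) by (simp add: compose_def)
qed

text \<open>Multiplication by \<open>site ts\<close> exchanges the two preimages. They are distinct
  siblings, so their last letters differ and exchanging them negates the strict comparison.\<close>

lemma coord_flip:
  assumes "set ts \<subseteq> {0, 1}" and g: "g \<in> carrier (DA q)"
  shows "coord ts (g \<otimes>\<^bsub>DA q\<^esub> site ts) = (\<not> coord ts g)"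
proof -
  let ?h = "inv\<^bsub>DA q\<^esub> g"
  define c where "c = descend (ts @ [0])"
  have sub: "set (ts @ [0, 0]) \<subseteq> {..<q}" "set (ts @ [0, 1]) \<subseteq> {..<q}" "set (ts @ [0]) \<subseteq> {..<q}"
    using assms q by auto
  note v = descend_verts[OF sub(1)] descend_verts[OF sub(2)]
  define v0 v1 where "v0 = ?h (descend (ts @ [0, 0]))" and "v1 = ?h (descend (ts @ [0, 1]))"
  have vv: "v0 \<in> verts q" "v1 \<in> verts q" "v0 \<noteq> v1"
  proof -
    show "v0 \<in> verts q" "v1 \<in> verts q" using inv_DA_apply(3)[OF g] v by (auto simp: v0_def v1_def)
    have "g v0 \<noteq> g v1"
      unfolding v0_def v1_def using inv_DA_apply(2)[OF g v(1)] inv_DA_apply(2)[OF g v(2)]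
        descend_inj[OF sub(1,2)] by auto
    then show "v0 \<noteq> v1" by auto
  qed
  have inv: "?h \<in> tree_maps q" using inv_Aff(1)[OF q_pos DA_tree_maps[OF g]] inv_DA[OF q_pos g] by simp
  have "ancestor v0 = ?h c" "ancestor v1 = ?h c"
    unfolding v0_def v1_def using tree_mapsD(5)[OF inv v(1)] tree_mapsD(5)[OF inv v(2)]
      descend_verts[OF sub(3)] by (auto simp: c_def)
  then have ne: "snd v0 (fst v0) \<noteq> snd v1 (fst v1)"
    using child_ancestor[OF vv(1)] child_ancestor[OF vv(2)] vv(3) by metis
  moreover have "(inv\<^bsub>DA q\<^esub> (g \<otimes>\<^bsub>DA q\<^esub> site ts)) (descend (ts @ [0, 1])) = v0"
    using inv_mult_apply[OF g site_DA v(1) site_swap[OF assms(1), of 0]] by (simp add: v0_def)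
  moreover have "(inv\<^bsub>DA q\<^esub> (g \<otimes>\<^bsub>DA q\<^esub> site ts)) (descend (ts @ [0, 0])) = v1"
    using inv_mult_apply[OF g site_DA v(2) site_swap[OF assms(1), of 1]] by (simp add: v1_def)
  ultimately show ?thesis
    by (simp only: coord_def Let_def v0_def[symmetric] v1_def[symmetric]) (use ne in auto)
qed

lemma coord_keep:
  assumes "set ts \<subseteq> {0, 1}" "set us \<subseteq> {0, 1}" "length us = length ts" "us \<noteq> ts"
    and g: "g \<in> carrier (DA q)"
  shows "coord us (g \<otimes>\<^bsub>DA q\<^esub> site ts) = coord us g"
proof -
  have "(inv\<^bsub>DA q\<^esub> (g \<otimes>\<^bsub>DA q\<^esub> site ts)) (descend (us @ [0, x])) = (inv\<^bsub>DA q\<^esub> g) (descend (us @ [0, x]))"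
    if "x \<in> {0, 1}" for x
  proof -
    have "descend (us @ [0, x]) \<in> verts q" using assms(2) that q by (intro descend_verts) auto
    then show ?thesis by (rule inv_mult_apply[OF g site_DA _ site_fix[OF assms(1-4) that]])
  qed
  from this[of 0] this[of 1] show ?thesis by (simp only: coord_def insert_iff simp_thms)
qed

end

subsection \<open>Elements with portrait in a window\<close>

text \<open>Continues \<open>omega_ray\<close> to positive levels, which the translate of a vertex
  of the ray may reach.\<close>

definition zero_vertex :: "int \<Rightarrow> vertex" where
  "zero_vertex m = (m, \<lambda>k\<in>{..m}. 0)"

lemma fst_zero_vertex [simp]: "fst (zero_vertex m) = m"
  by (simp add: zero_vertex_def)

lemma snd_zero_vertex: "k \<le> m \<Longrightarrow> snd (zero_vertex m) k = 0"
  by (simp add: zero_vertex_def)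

lemma zero_vertex_verts: "(q::nat) > 0 \<Longrightarrow> zero_vertex m \<in> verts q"
  by (auto simp: zero_vertex_def verts_iff H_def)

lemma zero_vertex_omega_ray: "zero_vertex (- int n) = omega_ray n"
  by (simp add: zero_vertex_def omega_ray_def)

lemma ancestor_zero_vertex: "ancestor (zero_vertex m) = zero_vertex (m - 1)"
  by (auto simp: zero_vertex_def ancestor_def restrict_def fun_eq_iff)

lemma child_zero_vertex: "child (zero_vertex m) 0 = zero_vertex (m + 1)"
  by (auto simp: zero_vertex_def child_def restrict_def fun_eq_iff)

lemma zero_vertexI:
  assumes "v \<in> verts q" "\<And>k. k \<le> fst v \<Longrightarrow> snd v k = 0" "q > 0"
  shows "v = zero_vertex (fst v)"
  by (rule vert_eqI[OF assms(1) zero_vertex_verts[OF assms(3)]]) (simp_all add: assms(2) snd_zero_vertex)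

text \<open>The part of the subtree rooted at \<open>omega_ray R\<close> that lies above level
  \<open>R\<close>. Its size is exponential in \<open>R\<close>, so the portraits supported in it
  number about exp (exp (O(R))).\<close>

definition window :: "nat \<Rightarrow> nat \<Rightarrow> vertex set" where
  "window q R = {v \<in> verts q. - int R \<le> fst v \<and> fst v < int R \<and> (\<forall>k\<le>- int R. snd v k = 0)}"

lemma window_mono: "R \<le> R' \<Longrightarrow> window q R \<subseteq> window q R'"
  by (auto simp: window_def)

lemma vert_in_window:
  assumes "v \<in> verts q" shows "\<exists>R. v \<in> window q R"
proof -
  obtain N where N: "N \<le> fst v" "\<forall>k\<le>N. snd v k = 0" using assms by (auto simp: verts_iff H_def)
  show ?thesis using N assms
    by (intro exI[of _ "nat (\<bar>N\<bar> + \<bar>fst v\<bar> + 1)"]) (auto simp: window_def)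
qed

lemma finite_subset_window:
  assumes "finite B" "B \<subseteq> verts q" shows "\<exists>R. B \<subseteq> window q R"
  using assms
proof (induction B rule: finite_induct)
  case (insert v B)
  then obtain R where "B \<subseteq> window q R" by auto
  moreover obtain R' where "v \<in> window q R'" using vert_in_window insert.prems by blast
  ultimately have "insert v B \<subseteq> window q (max R R')"
    using window_mono[of R "max R R'" q] window_mono[of R' "max R R'" q] by auto
  then show ?case by blast
qed auto

lemma finite_bad_subset_window:
  assumes "finite K" "K \<subseteq> carrier (DA q)" "q > 0"
  shows "\<exists>R. \<forall>h\<in>K. bad q h \<subseteq> window q R"
proof -
  have "finite (\<Union>h\<in>K. bad q h)" "(\<Union>h\<in>K. bad q h) \<subseteq> verts q"
    using assms by (auto simp: carrier_DA bad_def)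
  from finite_subset_window[OF this] show ?thesis by blast
qed

lemma window_card:
  assumes "q \<ge> 2"
  shows "finite (window q R)" "card (window q R) \<le> (2 * q) ^ (2 * R)"
proof -
  \<comment> \<open>Restricts a sequence to the indices where it can be nonzero in the window; the
    entries beyond its level are set to 0 so that all values lie in the alphabet.\<close>
  define F where "F = (\<lambda>v::vertex. (fst v, \<lambda>k\<in>{- int R<..<int R}. if k \<le> fst v then snd v k else 0))"
  let ?T = "{- int R..<int R} \<times> ({- int R<..<int R} \<rightarrow>\<^sub>E {..<q})"
  have inj: "inj_on F (window q R)"
  proof (rule inj_onI)
    fix v w assume vw: "v \<in> window q R" "w \<in> window q R" "F v = F w"
    show "v = w"
    proof (rule vert_eqI[of _ q])
      fix k assume k: "k \<le> fst v"
      have f: "fst v = fst w" using vw(3) by (simp add: F_def)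
      show "snd v k = snd w k"
      proof (cases "k \<le> - int R")
        case False
        then have "k \<in> {- int R<..<int R}" using k vw(1) by (auto simp: window_def)
        moreover have "snd (F v) k = snd (F w) k" using vw(3) by simp
        ultimately show ?thesis using k f by (simp add: F_def)
      qed (use vw in \<open>auto simp: window_def\<close>)
    qed (use vw in \<open>auto simp: window_def F_def\<close>)
  qed
  have im: "F ` window q R \<subseteq> ?T"
    using vert_letter assms by (auto simp: F_def window_def PiE_iff)
  have fin: "finite ?T" by (intro finite_cartesian_product finite_PiE) auto
  show "finite (window q R)" using inj im fin finite_imageD finite_subset by blast
  have "card (window q R) \<le> card ?T" by (rule card_inj_on_le[OF inj im fin])
  also have "\<dots> = 2 * R * q ^ (2 * R - 1)"
  proof -
    have "card {- int R..<int R} = 2 * R" "card {- int R<..<int R} = 2 * R - 1"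
      by (subst card_atLeastLessThan_int card_greaterThanLessThan_int; linarith)+
    then show ?thesis by (simp only: card_cartesian_product card_PiE finite_greaterThanLessThan_int
        card_lessThan prod_constant)
  qed
  also have "\<dots> \<le> 2 ^ (2 * R) * q ^ (2 * R)"
  proof (rule mult_le_mono)
    show "2 * R \<le> 2 ^ (2 * R)" by (rule less_imp_le_nat[OF less_exp])
    show "q ^ (2 * R - 1) \<le> q ^ (2 * R)" using assms by (intro power_increasing diff_le_self) linarith
  qed
  finally show "card (window q R) \<le> (2 * q) ^ (2 * R)" by (simp only: power_mult_distrib)
qed

definition window_maps :: "nat \<Rightarrow> nat \<Rightarrow> (vertex \<Rightarrow> vertex) set" where
  "window_maps q R = {g \<in> tree_maps q. bad q g \<subseteq> window q R}"

lemma window_maps_DA: "q \<ge> 2 \<Longrightarrow> window_maps q R \<subseteq> carrier (DA q)"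
  using window_card(1) by (auto simp: window_maps_def carrier_DA intro: finite_subset)

text \<open>Since \<open>g\<close> fixes the end, it translates the zero path sufficiently far up.
  On the way down to level \<open>- int R\<close> the path meets no vertex of the window, hence no
  bad vertex, and its letters stay 0.\<close>

lemma window_maps_zero_vertex:
  assumes g: "g \<in> window_maps q R" and q: "q > 0" and m: "m \<le> - int R"
  shows "g (zero_vertex m) = zero_vertex (m + \<Phi> g)"
proof -
  have gt: "g \<in> tree_maps q" and bad: "bad q g \<subseteq> window q R" using g by (auto simp: window_maps_def)
  note zv = zero_vertex_verts[OF q]
  obtain n k where nk: "(ancestor ^^ n) (g (omega_ray 0)) = omega_ray k"
    using ancestor_iter_eventually_omega[OF tree_mapsD(4)[OF gt omega_ray_verts[OF q]] q] .
  define M where "M = - int n"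
  have "g (zero_vertex M) = zero_vertex (- int k)"
    using nk tree_maps_ancestor_iter[OF gt omega_ray_verts[OF q], of n 0]
    by (simp add: M_def zero_vertex_omega_ray)
  then have M: "g (zero_vertex M) = zero_vertex (M + \<Phi> g)"
    using level_shift[OF gt zv q, of M] by simp
  have down: "g (zero_vertex l) = zero_vertex (l + \<Phi> g)" if "l \<le> M" for l
    using that
  proof (induction l rule: int_le_induct)
    case (step i)
    then show ?case using tree_mapsD(5)[OF gt zv, of i]
      by (simp add: ancestor_zero_vertex algebra_simps)
  qed (rule M)
  show ?thesis
  proof (cases "m \<le> M")
    case False
    then have "M \<le> m" by simp
    then show ?thesis using m
    proof (induction m rule: int_ge_induct)
      case (step i)
      have "zero_vertex i \<notin> bad q g" using bad step.prems by (auto simp: window_def)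
      then have "g (child (zero_vertex i) 0) = child (g (zero_vertex i)) 0"
        using zv q by (auto simp: bad_def)
      then show ?case using step by (simp add: child_zero_vertex algebra_simps)
    qed (rule M)
  qed (rule down)
qed

text \<open>A new bad vertex \<open>v\<close> has \<open>g v\<close> in the smaller window. The
  bound on \<Phi> places the level of \<open>v\<close> correctly. The ancestor of \<open>g v\<close>
  at level -R + \<Phi> g is a zero vertex, and it is also the image of the zero vertex at level -R;
  by injectivity \<open>v\<close> descends from the latter. So right multiplication by a fixed
  finite set keeps the window as long as the height is moderate.\<close>

lemma window_maps_mult:
  assumes g: "g \<in> window_maps q R" and h: "h \<in> tree_maps q" "bad q h \<subseteq> window q R'"
    and q: "q > 0" and \<Phi>: "\<bar>\<Phi> g\<bar> \<le> int R - int R'"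
  shows "compose (verts q) h g \<in> window_maps q R"
proof -
  have gt: "g \<in> tree_maps q" and bad: "bad q g \<subseteq> window q R" using g by (auto simp: window_maps_def)
  have "v \<in> window q R" if v: "v \<in> verts q" and gv: "g v \<in> bad q h" for v
  proof -
    have w: "g v \<in> window q R'" using gv h(2) by auto
    have lev: "fst (g v) = fst v + \<Phi> g" by (rule level_shift[OF gt v q])
    have R: "- int R \<le> fst v" "fst v < int R" using w lev \<Phi> by (auto simp: window_def)
    define j where "j = nat (fst v + int R)"
    have a: "(ancestor ^^ j) v \<in> verts q" "fst ((ancestor ^^ j) v) = - int R"
      using v R by (auto simp: j_def)
    have "g ((ancestor ^^ j) v) = (ancestor ^^ j) (g v)" by (rule tree_maps_ancestor_iter[OF gt v])
    also have "\<dots> = zero_vertex (fst ((ancestor ^^ j) (g v)))"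
    proof (rule zero_vertexI[OF _ _ q])
      show "(ancestor ^^ j) (g v) \<in> verts q" using tree_mapsD(4)[OF gt v] by simp
      fix k assume k: "k \<le> fst ((ancestor ^^ j) (g v))"
      then have "k \<le> - int R'" using R \<Phi> lev by (simp add: j_def)
      then show "snd ((ancestor ^^ j) (g v)) k = 0"
        using w k by (simp add: window_def snd_ancestor_iter)
    qed
    also have "\<dots> = zero_vertex (- int R + \<Phi> g)" using R lev by (simp add: j_def)
    also have "\<dots> = g (zero_vertex (- int R))" using window_maps_zero_vertex[OF g q, of "- int R"] by simp
    finally have z: "(ancestor ^^ j) v = zero_vertex (- int R)"
      using inj_onD[OF tree_mapsD(3)[OF gt] _ a(1) zero_vertex_verts[OF q]] by blast
    have "snd v k = 0" if "k \<le> - int R" for k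
    proof -
      have "k \<le> fst v - int j" using a(2) that by simp
      then show ?thesis using snd_ancestor_iter[of k v j] snd_zero_vertex[OF that] z by simp
    qed
    then show ?thesis using v R by (simp add: window_def)
  qed
  then show ?thesis
    using bad_compose_subset[OF gt, of h] bad tree_maps_compose[OF gt h(1)]
    by (auto simp: window_maps_def)
qed

section \<open>Counting the window maps by height\<close>

definition window_hor :: "nat \<Rightarrow> nat \<Rightarrow> (vertex \<Rightarrow> vertex) set" where
  "window_hor q R = {g \<in> window_maps q R. \<Phi> g = 0}"

text \<open>A map is determined by the last letters of the images of the children of window
  vertices: elsewhere letters are kept, and at the start of the descent, on the zero path up to
  level -R, the map is the identity by \<open>window_maps_zero_vertex\<close>.\<close>

lemma window_hor_card:
  assumes q: "q \<ge> 2"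
  shows "finite (window_hor q R)" "card (window_hor q R) \<le> (q ^ q) ^ ((2 * q) ^ (2 * R))"
    "card (window_hor q R) > 0"
proof -
  have q0: "q > 0" using q by simp
  define F where "F = (\<lambda>g::vertex \<Rightarrow> vertex. \<lambda>v\<in>window q R. \<lambda>t\<in>{..<q}. snd (g (child v t)) (fst (g (child v t))))"
  let ?T = "window q R \<rightarrow>\<^sub>E ({..<q} \<rightarrow>\<^sub>E {..<q})"
  have inj: "inj_on F (window_hor q R)"
  proof (rule inj_onI)
    fix g h assume gh: "g \<in> window_hor q R" "h \<in> window_hor q R" "F g = F h"
    have gt: "g \<in> tree_maps q" "h \<in> tree_maps q" and bad: "bad q g \<subseteq> window q R" "bad q h \<subseteq> window q R"
      using gh by (auto simp: window_hor_def window_maps_def)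
    have zero: "g (zero_vertex m) = h (zero_vertex m)" if "m \<le> - int R" for m
      using window_maps_zero_vertex[OF _ q0 that, of g] window_maps_zero_vertex[OF _ q0 that, of h] gh(1,2)
      by (simp add: window_hor_def)
    have eq: "g v = h v" if "v \<in> verts q" "(ancestor ^^ n) v = zero_vertex m" "m \<le> - int R" for v n m
      using that(1,2)
    proof (induction n arbitrary: v)
      case 0 then show ?case using zero[OF that(3)] by simp
    next
      case (Suc n)
      define w t where "w = ancestor v" and "t = snd v (fst v)"
      have v: "v = child w t" "w \<in> verts q" "t < q"
        using child_ancestor[OF Suc.prems(1)] Suc.prems(1) vert_letter[OF Suc.prems(1)] by (auto simp: w_def t_def)
      have IH: "g w = h w"
        by (rule Suc.IH[OF v(2)]) (use Suc.prems(2) in \<open>simp add: w_def funpow_swap1\<close>)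
      show ?case
      proof (cases "w \<in> window q R")
        case True
        have "F f w t = snd (f v) (fst (f v))" for f
          unfolding F_def v(1) using True v(3) by simp
        then have "snd (g v) (fst (g v)) = snd (h v) (fst (h v))" by (metis gh(3))
        moreover have "ancestor (g v) = ancestor (h v)"
          using IH tree_mapsD(5)[OF gt(1) Suc.prems(1)] tree_mapsD(5)[OF gt(2) Suc.prems(1)]
          unfolding w_def by simp
        ultimately show ?thesis
          using child_ancestor[OF tree_mapsD(4)[OF gt(1) Suc.prems(1)]]
            child_ancestor[OF tree_mapsD(4)[OF gt(2) Suc.prems(1)]] by metis
      next
        case False
        then have "w \<notin> bad q g" "w \<notin> bad q h" using bad by auto
        then have "g (child w t) = child (g w) t" "h (child w t) = child (h w) t"
          using v(2,3) by (simp_all add: bad_def)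
        then show ?thesis unfolding v(1) IH by simp
      qed
    qed
    show "g = h"
    proof (rule extensionalityI[OF tree_mapsD(1)[OF gt(1)] tree_mapsD(1)[OF gt(2)]])
      fix v assume v: "v \<in> verts q"
      obtain n k where nk: "(ancestor ^^ n) v = omega_ray k"
        using ancestor_iter_eventually_omega[OF v q0] .
      \<comment> \<open>The additional \<open>R\<close> steps put the ancestor at level at most -R,
        where both maps are known to agree.\<close>
      have "(ancestor ^^ (R + n)) v = zero_vertex (- int (R + k))"
        by (simp add: funpow_add nk zero_vertex_omega_ray del: of_nat_add)
      then show "g v = h v" by (rule eq[OF v]) simp
    qed
  qed
  have im: "F ` window_hor q R \<subseteq> ?T"
  proof (intro image_subsetI)
    fix g assume "g \<in> window_hor q R"
    then have gt: "g \<in> tree_maps q" by (simp add: window_hor_def window_maps_def)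
    show "F g \<in> ?T"
      using vert_letter[OF tree_mapsD(4)[OF gt child_verts]] by (auto simp: F_def window_def PiE_iff)
  qed
  have fin: "finite ?T" by (intro finite_PiE window_card q) auto
  show "finite (window_hor q R)" using inj im fin finite_imageD finite_subset by blast
  have "card (window_hor q R) \<le> card ?T" by (rule card_inj_on_le[OF inj im fin])
  also have "\<dots> = (q ^ q) ^ card (window q R)" by (simp add: card_PiE window_card q)
  also have "\<dots> \<le> (q ^ q) ^ ((2 * q) ^ (2 * R))" by (intro power_increasing window_card q) (use q in auto)
  finally show "card (window_hor q R) \<le> (q ^ q) ^ ((2 * q) ^ (2 * R))" .
  have "(\<lambda>v\<in>verts q. v) \<in> window_hor q R"
    using tree_maps_one q0 by (auto simp: window_hor_def window_maps_def bad_def \<Phi>_def)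
  then show "card (window_hor q R) > 0"
    using \<open>finite (window_hor q R)\<close> by (auto simp: card_gt_0_iff)
qed

text \<open>Powers of \<alpha> on the right change the height and leave the portrait alone. Hence
  all heights have equally many window maps, and ratios of such counts are those of intervals in the
  integers.\<close>

lemma window_maps_level_card:
  assumes q: "q \<ge> 2"
  shows "card {g \<in> window_maps q R. \<bar>\<Phi> g\<bar> \<le> int n} = (2 * n + 1) * card (window_hor q R)"
    "finite {g \<in> window_maps q R. \<bar>\<Phi> g\<bar> \<le> int n}"
proof -
  have q0: "q > 0" using q by simp
  interpret group "Aff q" by (rule group_Aff[OF q0])
  let ?p = "\<lambda>m::int. \<alpha> q [^]\<^bsub>Aff q\<^esub> m"
  note pow = \<alpha>_power[OF q0]
  have a: "\<alpha> q \<in> carrier (Aff q)" using \<alpha>_tree_maps q0 carrier_Aff by simp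
  have mult: "g \<otimes>\<^bsub>Aff q\<^esub> ?p m \<in> window_maps q R \<and> \<Phi> (g \<otimes>\<^bsub>Aff q\<^esub> ?p m) = \<Phi> g + m"
    if "g \<in> window_maps q R" for g m
    using that pow[of m] bad_compose_right[of g q "?p m"] \<Phi>_mult[of g q "?p m"] q0
    by (auto simp: window_maps_def tree_maps_compose)
  have car: "g \<in> carrier (Aff q)" if "g \<in> window_maps q R" for g
    using that carrier_Aff[OF q0] by (simp add: window_maps_def)
  have bij: "bij_betw (\<lambda>(g, m). g \<otimes>\<^bsub>Aff q\<^esub> ?p m) (window_hor q R \<times> {- int n..int n})
      {g \<in> window_maps q R. \<bar>\<Phi> g\<bar> \<le> int n}"
  proof (rule bij_betw_byWitness[where f' = "\<lambda>g. (g \<otimes>\<^bsub>Aff q\<^esub> ?p (- \<Phi> g), \<Phi> g)"])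
    show "\<forall>x\<in>window_hor q R \<times> {- int n..int n}.
        (\<lambda>g. (g \<otimes>\<^bsub>Aff q\<^esub> ?p (- \<Phi> g), \<Phi> g)) ((\<lambda>(g, m). g \<otimes>\<^bsub>Aff q\<^esub> ?p m) x) = x"
    proof
      fix x assume "x \<in> window_hor q R \<times> {- int n..int n}"
      then obtain g m where x: "x = (g, m)" "g \<in> window_maps q R" "\<Phi> g = 0" by (auto simp: window_hor_def)
      have "(g \<otimes>\<^bsub>Aff q\<^esub> ?p m) \<otimes>\<^bsub>Aff q\<^esub> ?p (- m) = g"
        using a car[OF x(2)] by (subst m_assoc) (auto simp: int_pow_mult[symmetric] simp del: mult_Aff one_Aff)
      then show "(\<lambda>g. (g \<otimes>\<^bsub>Aff q\<^esub> ?p (- \<Phi> g), \<Phi> g)) ((\<lambda>(g, m). g \<otimes>\<^bsub>Aff q\<^esub> ?p m) x) = x"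
        using mult[OF x(2), of m] x by (simp del: mult_Aff)
    qed
    show "\<forall>g\<in>{g \<in> window_maps q R. \<bar>\<Phi> g\<bar> \<le> int n}.
        (\<lambda>(g, m). g \<otimes>\<^bsub>Aff q\<^esub> ?p m) (g \<otimes>\<^bsub>Aff q\<^esub> ?p (- \<Phi> g), \<Phi> g) = g"
    proof
      fix g assume "g \<in> {g \<in> window_maps q R. \<bar>\<Phi> g\<bar> \<le> int n}"
      then have g: "g \<in> carrier (Aff q)" using car by simp
      have "(g \<otimes>\<^bsub>Aff q\<^esub> ?p (- \<Phi> g)) \<otimes>\<^bsub>Aff q\<^esub> ?p (\<Phi> g) = g"
        using a g by (subst m_assoc) (auto simp: int_pow_mult[symmetric] simp del: mult_Aff one_Aff)
      then show "(\<lambda>(g, m). g \<otimes>\<^bsub>Aff q\<^esub> ?p m) (g \<otimes>\<^bsub>Aff q\<^esub> ?p (- \<Phi> g), \<Phi> g) = g" by (simp del: mult_Aff)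
    qed
    show "(\<lambda>(g, m). g \<otimes>\<^bsub>Aff q\<^esub> ?p m) ` (window_hor q R \<times> {- int n..int n}) \<subseteq>
        {g \<in> window_maps q R. \<bar>\<Phi> g\<bar> \<le> int n}"
    proof clarify
      fix g m assume "g \<in> window_hor q R" "m \<in> {- int n..int n}"
      then show "g \<otimes>\<^bsub>Aff q\<^esub> ?p m \<in> window_maps q R \<and> \<bar>\<Phi> (g \<otimes>\<^bsub>Aff q\<^esub> ?p m)\<bar> \<le> int n"
        using mult[of g m] by (auto simp: window_hor_def simp del: mult_Aff)
    qed
    show "(\<lambda>g. (g \<otimes>\<^bsub>Aff q\<^esub> ?p (- \<Phi> g), \<Phi> g)) ` {g \<in> window_maps q R. \<bar>\<Phi> g\<bar> \<le> int n} \<subseteq>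
        window_hor q R \<times> {- int n..int n}"
    proof clarify
      fix g assume "g \<in> window_maps q R" "\<bar>\<Phi> g\<bar> \<le> int n"
      then show "g \<otimes>\<^bsub>Aff q\<^esub> ?p (- \<Phi> g) \<in> window_hor q R \<and> \<Phi> g \<in> {- int n..int n}"
        using mult[of g "- \<Phi> g"] by (auto simp: window_hor_def simp del: mult_Aff)
    qed
  qed
  have fin: "finite (window_hor q R \<times> {- int n..int n})" using window_hor_card(1)[OF q] by simp
  have "nat (2 * int n + 1) = 2 * n + 1" by simp
  then have "card (window_hor q R \<times> {- int n..int n}) = (2 * n + 1) * card (window_hor q R)"
    by (simp add: card_cartesian_product mult.commute)
  then show "card {g \<in> window_maps q R. \<bar>\<Phi> g\<bar> \<le> int n} = (2 * n + 1) * card (window_hor q R)"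
    using bij_betw_same_card[OF bij] by simp
  show "finite {g \<in> window_maps q R. \<bar>\<Phi> g\<bar> \<le> int n}"
    using bij_betw_finite[OF bij] fin by simp
qed

subsection \<open>The isoperimetric profile and test functions\<close>

locale DA_walk = symmetric_walk "DA q" \<mu> for q \<mu> +
  assumes q: "q \<ge> 2" and nondegenerate: "nondegenerate (DA q) \<mu>"
begin

lemma DA_words: "g \<in> carrier (DA q) \<Longrightarrow> \<exists>n. g \<in> words n"
  using nondegenerate semigroup_generated_words unfolding nondegenerate_def by blast

lemma site_words: "\<exists>L>0. \<forall>ts. \<exists>n\<le>L * (length ts + 1). site q ts \<in> words (2 * n)"
proof -
  obtain a where a: "\<alpha> q \<in> words a" using DA_words \<alpha>_DA[OF q] by blast
  obtain c where c: "flip q (omega_ray 0) \<in> words c" using DA_words root_flip_DA[OF q] by blast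
  obtain d where d: "flip q (child (omega_ray 0) 0) \<in> words d" using DA_words child_flip_DA[OF q] by blast
  have embed: "\<exists>n\<le>(a + c) * length ts. embed q ts \<in> words n" for ts
  proof (induction ts)
    case Nil then show ?case unfolding embed.simps[OF q] by (intro exI[of _ 0]) (simp del: one_DA)
  next
    case (Cons t ts)
    then obtain n where n: "n \<le> (a + c) * length ts" "embed q ts \<in> words n" by blast
    have "\<exists>k\<le>a + c. (if t = 0 then \<alpha> q else \<alpha> q \<otimes>\<^bsub>DA q\<^esub> flip q (omega_ray 0)) \<in> words k"
      using a words_mult[OF a c] by (cases "t = 0") (auto simp del: mult_DA intro: exI[of _ a] exI[of _ "a + c"])
    then obtain k where k: "k \<le> a + c"
      "(if t = 0 then \<alpha> q else \<alpha> q \<otimes>\<^bsub>DA q\<^esub> flip q (omega_ray 0)) \<in> words k" by blast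
    have "n + k \<le> (a + c) * length (t # ts)" using n(1) k(1) by simp
    moreover have "embed q (t # ts) \<in> words (n + k)"
      unfolding embed.simps[OF q] by (rule words_mult[OF n(2) k(2)])
    ultimately show ?case by blast
  qed
  have "\<exists>n\<le>(a + c + d + c + 1) * (length ts + 1). site q ts \<in> words (2 * n)" for ts
  proof -
    obtain n where n: "n \<le> (a + c) * length ts" "embed q ts \<in> words n" using embed by blast
    have "twin_flip q \<in> words (d + c + d + c)"
      unfolding twin_flip_def[OF q] by (intro words_mult c d)
    then have "site q ts \<in> words (n + (d + c + d + c) + n)"
      unfolding site_def[OF q] by (intro words_mult words_inv n(2))
    \<comment> \<open>Conjugation contributes \<open>n\<close> twice and \<open>twin_flip\<close>
      contributes \<open>d + c\<close> twice.\<close>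
    moreover have "n + (d + c + d + c) + n = 2 * (n + d + c)" by simp
    moreover have "n + d + c \<le> (a + c + d + c + 1) * (length ts + 1)"
      using n(1) by (simp add: algebra_simps)
    ultimately show ?thesis by metis
  qed
  then show ?thesis by (intro exI[of _ "a + c + d + c + 1"]) auto
qed

text \<open>
  The average is over the two-step walk; this is why \<open>site_words\<close> provides words of even length.
\<close>

lemma isoperimetry:
  "\<exists>c>0. c \<le> 1 \<and> (\<forall>r f. fin_supp f \<longrightarrow> 4 * log 2 (card (supp f)) \<le> 2 ^ r \<longrightarrow>
     c / (real r + 1) * tot (\<lambda>x. \<bar>f x\<bar>) \<le> avg (var1 f))"
proof -
  obtain L where L: "L > 0" "\<And>ts. \<exists>n\<le>L * (length ts + 1). site q ts \<in> words (2 * n)"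
    using site_words by blast
  obtain C where C: "C > 0"
    "\<And>f n w. w \<in> words (2 * n) \<Longrightarrow> fin_supp f \<Longrightarrow> var1 f w \<le> C * n * avg (var1 f)"
    using var1_even_word_avg by blast
  have main: "tot (\<lambda>x. \<bar>f x\<bar>) \<le> 2 * C * L * (real r + 1) * avg (var1 f)"
    if f: "fin_supp f" and small: "4 * log 2 (card (supp f)) \<le> 2 ^ r" for f r
  proof -
    define I where "I = {ts :: nat list. set ts \<subseteq> {0, 1} \<and> length ts = r}"
    have I: "finite I" "card I = 2 ^ r"
      using finite_lists_length_eq[of "{0, 1 :: nat}" r] card_lists_length_eq[of "{0, 1 :: nat}" r]
      by (auto simp: I_def numeral_2_eq_2)
    have supp: "supp (\<lambda>x. \<bar>f x\<bar>) = supp f" by (simp add: supp_def)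
    have fa: "fin_supp (\<lambda>x. \<bar>f x\<bar>)" using f supp by simp
    have A0: "avg (var1 f) \<ge> 0" using avg_mono[of "\<lambda>_. 0" "var1 f"] by (simp add: avg_const var1_nonneg)
    have "card I * tot (\<lambda>x. \<bar>f x\<bar>) / 2 \<le> (\<Sum>ts\<in>I. var1 (\<lambda>x. \<bar>f x\<bar>) (site q ts))"
    proof (rule cube_isoperimetry[OF I(1), where \<xi> = "coord q"])
      show "site q ts \<in> carrier (DA q)" for ts by (rule site_DA[OF q])
      show "coord q ts (x \<otimes>\<^bsub>DA q\<^esub> site q ts) = (\<not> coord q ts x)"
        if "ts \<in> I" "x \<in> carrier (DA q)" for ts x
        using that by (intro coord_flip[OF q]) (auto simp: I_def)
      show "coord q us (x \<otimes>\<^bsub>DA q\<^esub> site q ts) = coord q us x"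
        if "ts \<in> I" "us \<in> I" "ts \<noteq> us" "x \<in> carrier (DA q)" for ts us x
        using that by (intro coord_keep[OF q]) (auto simp: I_def)
    qed (use fa supp small I(2) in auto)
    also have "\<dots> \<le> (\<Sum>ts\<in>I. C * L * (real r + 1) * avg (var1 f))"
    proof (rule sum_mono)
      fix ts assume "ts \<in> I"
      then obtain n where n: "n \<le> L * (r + 1)" "site q ts \<in> words (2 * n)"
        using L(2)[of ts] by (auto simp: I_def)
      have "var1 (\<lambda>x. \<bar>f x\<bar>) (site q ts) \<le> var1 f (site q ts)"
        unfolding var1_def
        by (rule tot_mono[OF fin_supp_abs_diff[OF fa site_DA[OF q]] fin_supp_abs_diff[OF f site_DA[OF q]]])
           (rule abs_triangle_ineq3)
      also have "\<dots> \<le> C * n * avg (var1 f)" by (rule C(2)[OF n(2) f])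
      also have "\<dots> \<le> C * real (L * (r + 1)) * avg (var1 f)"
        using n(1) C(1) A0 by (intro mult_right_mono mult_left_mono) (simp_all only: of_nat_mono less_imp_le)
      also have "\<dots> = C * L * (real r + 1) * avg (var1 f)" by (simp add: algebra_simps)
      finally show "var1 (\<lambda>x. \<bar>f x\<bar>) (site q ts) \<le> C * L * (real r + 1) * avg (var1 f)" .
    qed
    also have "\<dots> = card I * (C * L * (real r + 1) * avg (var1 f))" by simp
    finally have "card I * (tot (\<lambda>x. \<bar>f x\<bar>) / 2) \<le> card I * (C * L * (real r + 1) * avg (var1 f))" by simp
    then have "tot (\<lambda>x. \<bar>f x\<bar>) / 2 \<le> C * L * (real r + 1) * avg (var1 f)"
      by (rule mult_left_le_imp_le) (simp add: I(2))
    then show ?thesis by simp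
  qed
  \<comment> \<open>Capped at 1 for the hypothesis \<kappa> \<le> 1 of
    \<open>return_upper\<close>.\<close>
  define c where "c = min 1 (1 / (2 * C * L))"
  have c: "c > 0" "c \<le> 1" using C(1) L(1) by (auto simp: c_def)
  have "c / (real r + 1) * tot (\<lambda>x. \<bar>f x\<bar>) \<le> avg (var1 f)"
    if f: "fin_supp f" "4 * log 2 (card (supp f)) \<le> 2 ^ r" for f r
  proof -
    have "c / (real r + 1) * tot (\<lambda>x. \<bar>f x\<bar>) \<le> 1 / (2 * C * L) / (real r + 1) * tot (\<lambda>x. \<bar>f x\<bar>)"
      by (intro mult_right_mono divide_right_mono tot_nonneg) (auto simp: c_def)
    also have "\<dots> \<le> avg (var1 f)"
    proof -
      have "2 * C * L * (real r + 1) > 0" using C(1) L(1) by simp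
      then have "tot (\<lambda>x. \<bar>f x\<bar>) / (2 * C * L * (real r + 1)) \<le> avg (var1 f)"
        using main[OF f] by (simp only: pos_divide_le_eq mult.commute)
      then show ?thesis by simp
    qed
    finally show ?thesis .
  qed
  then show ?thesis using c by blast
qed

text \<open>On window maps \<open>f\<close> is a tent function of the height, and the window is so
  large that no generator leaves it while the height is at most 2r in absolute value. Thus
  \<open>f\<close> changes only through the height, by at most a constant per step, while it is at
  least \<open>r\<close> on a fixed proportion of the set where it changes: the one-dimensional
  estimates 1 / r and 1 / r^2.\<close>

lemma test_function:
  "\<exists>C>0. \<forall>r\<ge>1. \<exists>f. fin_supp f \<and> (\<forall>x. f x \<ge> 0) \<and> tot f > 0 \<and> tot (\<lambda>x. (f x)\<^sup>2) > 0 \<and>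
     real (card (supp f)) \<le> exp (exp (C * r)) \<and> energy1 f \<le> C / r * tot f \<and>
     avg (var2 f) \<le> C / (real r)\<^sup>2 * tot (\<lambda>x. (f x)\<^sup>2)"
proof -
  have q0: "q > 0" using q by simp
  define S where "S = set_pmf \<mu> \<union> (\<lambda>(a, b). a \<otimes>\<^bsub>DA q\<^esub> b) ` (set_pmf \<mu> \<times> set_pmf \<mu>)"
  \<comment> \<open>Contains single steps for \<open>energy1\<close>, double steps for
    \<open>avg\<close>, and inverses so that an edge can be traversed from its other end.\<close>
  define K where "K = S \<union> m_inv (DA q) ` S"
  have S: "finite S" "S \<subseteq> carrier (DA q)"
    using finite_support support_carrier by (auto simp: S_def simp del: mult_DA)
  have K: "finite K" "K \<subseteq> carrier (DA q)" "\<And>y. y \<in> K \<Longrightarrow> inv\<^bsub>DA q\<^esub> y \<in> K"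
    using S by (auto simp: K_def)
  obtain R0 where R0: "\<And>h. h \<in> K \<Longrightarrow> bad q h \<subseteq> window q R0"
    using finite_bad_subset_window[OF K(1,2) q0] by blast
  define c where "c = nat (Max ((\<lambda>h. \<bar>\<Phi> h\<bar>) ` K))"
  have c: "\<bar>\<Phi> h\<bar> \<le> int c" if "h \<in> K" for h
  proof -
    have "\<bar>\<Phi> h\<bar> \<le> Max ((\<lambda>h. \<bar>\<Phi> h\<bar>) ` K)" using that K(1) by (intro Max_ge) auto
    then show ?thesis unfolding c_def by linarith
  qed
  have tm: "h \<in> tree_maps q" if "h \<in> carrier (DA q)" for h using DA_tree_maps[OF q that] .
  \<comment> \<open>\<open>B\<close> and \<open>b\<close> come from taking logarithms in
    \<open>window_hor_card\<close> with \<open>R = 2 * r + R0\<close>: the number of maps is at most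
    exp (B b^r).\<close>
  define B where "B = real q * ln q * (2 * real q) ^ (2 * R0)"
  define b where "b = (2 * real q) ^ 4"
  have B: "B \<ge> 0" using q by (simp add: B_def)
  have b: "b \<ge> 2" using q power_increasing[of 1 4 "2 * real q"] by (simp add: b_def)
  \<comment> \<open>The first two terms serve the size of the support, the third the L1 energy, the
    fourth the L2 energy.\<close>
  define C where "C = ln (4 + B) + ln b + real c * (2 + 2 * c) + real c ^ 2 * (2 + 2 * c)"
  have lnB: "ln (4 + B) > 0" and lnb: "ln b > 0" using B b by (auto simp: ln_gt_zero_iff)
  have C: "C > 0" "ln (4 + B) + ln b \<le> C" "real c * (2 + 2 * c) \<le> C" "real c ^ 2 * (2 + 2 * c) \<le> C"
    using lnB lnb unfolding C_def by (auto intro!: add_pos_nonneg add_nonneg_nonneg)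
  have "\<exists>f. fin_supp f \<and> (\<forall>x. f x \<ge> 0) \<and> tot f > 0 \<and> tot (\<lambda>x. (f x)\<^sup>2) > 0 \<and>
     real (card (supp f)) \<le> exp (exp (C * r)) \<and> energy1 f \<le> C / r * tot f \<and>
     avg (var2 f) \<le> C / (real r)\<^sup>2 * tot (\<lambda>x. (f x)\<^sup>2)" if r: "r \<ge> 1" for r :: nat
  proof -
    \<comment> \<open>The excess of \<open>R\<close> over \<open>R0\<close> is the largest height
      \<open>2 * r\<close> at which \<open>window_maps_mult\<close> is applied.\<close>
    define R where "R = 2 * r + R0"
    define N where "N = real (card (window_hor q R))"
    define D where "D = (\<lambda>n. {g \<in> window_maps q R. \<bar>\<Phi> g\<bar> \<le> int n})"
    have D: "finite (D n)" "real (card (D n)) = real (2 * n + 1) * N" "D n \<subseteq> carrier (DA q)" for n :: nat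
    proof -
      show "finite (D n)" unfolding D_def by (rule window_maps_level_card(2)[OF q])
      show "real (card (D n)) = real (2 * n + 1) * N"
        unfolding D_def N_def window_maps_level_card(1)[OF q] by (simp only: of_nat_mult)
      show "D n \<subseteq> carrier (DA q)" unfolding D_def using window_maps_DA[OF q] by blast
    qed
    have N: "N > 0" using window_hor_card(3)[OF q] by (simp add: N_def)
    define f where "f = (\<lambda>g. if g \<in> window_maps q R then real_of_int (max 0 (2 * int r - \<bar>\<Phi> g\<bar>)) else 0)"
    have f_nn: "f x \<ge> 0" for x by (simp add: f_def)
    have suppf: "supp f \<subseteq> D (2 * r)" by (auto simp: supp_def f_def D_def split: if_splits)
    then have fs: "fin_supp f" using D(1) finite_subset by blast
    have big: "f x \<ge> r" if "x \<in> D r" for x using that by (auto simp: f_def D_def)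
    have move: "x \<otimes>\<^bsub>DA q\<^esub> y \<in> window_maps q R \<and> \<Phi> (x \<otimes>\<^bsub>DA q\<^esub> y) = \<Phi> x + \<Phi> y"
      if "x \<in> window_maps q R" "\<bar>\<Phi> x\<bar> \<le> 2 * int r" "y \<in> K" for x y
    proof -
      have y: "y \<in> tree_maps q" using that K tm by auto
      have "x \<in> tree_maps q" using that by (simp add: window_maps_def)
      then show ?thesis
        using window_maps_mult[OF that(1) y R0[OF that(3)] q0] \<Phi>_mult[OF _ y q0] that(2) by (simp add: R_def)
    qed
    have diff: "\<bar>f x - f (x \<otimes>\<^bsub>DA q\<^esub> y)\<bar> \<le> c \<and> x \<in> D (2 * r + c)"
      if x: "x \<in> carrier (DA q)" and y: "y \<in> K" and ne: "f x \<noteq> f (x \<otimes>\<^bsub>DA q\<^esub> y)" for x y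
    proof -
      have yc: "y \<in> carrier (DA q)" using y K by auto
      have both: "\<bar>f x - f z\<bar> \<le> c" if "x \<in> window_maps q R" "z \<in> window_maps q R" "\<Phi> z = \<Phi> x + \<Phi> y" for z
        using that c[OF y] by (auto simp: f_def max_def)
      show ?thesis
      proof (cases "x \<in> window_maps q R \<and> \<bar>\<Phi> x\<bar> \<le> 2 * int r")
        case True
        then show ?thesis using move[of x y] y both by (auto simp: D_def simp del: mult_DA)
      next
        \<comment> \<open>Here \<open>f\<close> vanishes at \<open>x\<close>, so the other end of
          the edge carries the value; \<open>move\<close> is applied there with the inverse of
          \<open>y\<close>.\<close>
        case False
        then have "f x = 0" by (auto simp: f_def)
        then have z: "x \<otimes>\<^bsub>DA q\<^esub> y \<in> window_maps q R" "\<bar>\<Phi> (x \<otimes>\<^bsub>DA q\<^esub> y)\<bar> \<le> 2 * int r"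
          using ne by (auto simp: f_def split: if_splits simp del: mult_DA)
        have "(x \<otimes>\<^bsub>DA q\<^esub> y) \<otimes>\<^bsub>DA q\<^esub> inv\<^bsub>DA q\<^esub> y = x" using x yc by (simp add: m_assoc del: mult_DA one_DA)
        then have xw: "x \<in> window_maps q R" and \<Phi>x: "\<Phi> x = \<Phi> (x \<otimes>\<^bsub>DA q\<^esub> y) + \<Phi> (inv\<^bsub>DA q\<^esub> y)"
          using move[OF z K(3)[OF y]] by auto
        have \<Phi>y: "\<Phi> (inv\<^bsub>DA q\<^esub> y) = - \<Phi> y" using \<Phi>_inv[OF q0 tm[OF yc]] inv_DA[OF q0 yc] by simp
        show ?thesis using both[OF xw z(1)] \<Phi>x \<Phi>y xw z(2) c[OF y] by (auto simp: D_def simp del: mult_DA)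
      qed
    qed
    have v1: "var1 f y \<le> real c * card (D (2 * r + c))" if y: "y \<in> K" for y
      unfolding var1_def
    proof (rule tot_le_card[OF D(3,1)])
      show "supp (\<lambda>x. \<bar>f x - f (x \<otimes>\<^bsub>DA q\<^esub> y)\<bar>) \<subseteq> D (2 * r + c)"
        using diff[OF _ y] by (auto simp: supp_def simp del: mult_DA)
      show "\<bar>f x - f (x \<otimes>\<^bsub>DA q\<^esub> y)\<bar> \<le> c" if "x \<in> D (2 * r + c)" for x
        using diff[OF _ y, of x] that D(3)[of "2 * r + c"] by (cases "f x = f (x \<otimes>\<^bsub>DA q\<^esub> y)") (auto simp del: mult_DA)
    qed
    have v2: "var2 f y \<le> (real c)\<^sup>2 * card (D (2 * r + c))" if y: "y \<in> K" for y
      unfolding var2_def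
    proof (rule tot_le_card[OF D(3,1)])
      show "supp (\<lambda>x. (f x - f (x \<otimes>\<^bsub>DA q\<^esub> y))\<^sup>2) \<subseteq> D (2 * r + c)"
        using diff[OF _ y] by (auto simp: supp_def simp del: mult_DA)
      show "(f x - f (x \<otimes>\<^bsub>DA q\<^esub> y))\<^sup>2 \<le> (real c)\<^sup>2" if "x \<in> D (2 * r + c)" for x
        using diff[OF _ y, of x] that D(3)[of "2 * r + c"]
        by (cases "f x = f (x \<otimes>\<^bsub>DA q\<^esub> y)") (auto simp: abs_le_square_iff[symmetric] simp del: mult_DA)
    qed
    have "real r * real (card (D r)) \<le> tot f"
      by (rule tot_ge_card[OF fs f_nn D(3,1)]) (use big in auto)
    then have t1: "real r * (real (2 * r + 1) * N) \<le> tot f" by (simp only: D(2))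
    have "(real r)\<^sup>2 * real (card (D r)) \<le> tot (\<lambda>x. (f x)\<^sup>2)"
      by (rule tot_ge_card[OF fin_supp_power2[OF fs] _ D(3,1)]) (use big in \<open>auto intro!: power_mono\<close>)
    then have t2: "(real r)\<^sup>2 * (real (2 * r + 1) * N) \<le> tot (\<lambda>x. (f x)\<^sup>2)" by (simp only: D(2))
    have pos: "r * ((2 * r + 1) * N) > 0" "(real r)\<^sup>2 * ((2 * r + 1) * N) > 0" using r N by auto
    have DD: "card (D (2 * r + c)) \<le> (2 + 2 * c) * ((2 * r + 1) * N)"
    proof -
      \<comment> \<open>The common factor \<open>N\<close> cancels, and only the numbers of heights
        are compared.\<close>
      have "real (2 * (2 * r + c) + 1) \<le> (2 + 2 * c) * (2 * r + 1)" by (simp add: algebra_simps)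
      then have "real (2 * (2 * r + c) + 1) * N \<le> real ((2 + 2 * c) * (2 * r + 1)) * N"
        using N by (intro mult_right_mono) auto
      then show ?thesis unfolding D(2) by (simp add: algebra_simps)
    qed
    have "energy1 f \<le> (\<Sum>a\<in>set_pmf \<mu>. pmf \<mu> a * (real c * card (D (2 * r + c))))"
      unfolding energy1_def by (intro sum_mono mult_left_mono v1) (auto simp: K_def S_def)
    also have "\<dots> = real c * card (D (2 * r + c))" by (simp only: sum_distrib_right[symmetric] sum_support mult_1_left)
    also have "\<dots> \<le> real c * ((2 + 2 * c) * ((2 * r + 1) * N))" by (intro mult_left_mono DD) auto
    also have "\<dots> = real c * (2 + 2 * c) * ((2 * r + 1) * N)" by simp
    also have "\<dots> \<le> C * ((2 * r + 1) * N)" using C(3) N by (intro mult_right_mono) auto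
    also have "\<dots> = C / r * (r * ((2 * r + 1) * N))" using r by simp
    also have "\<dots> \<le> C / r * tot f" using t1 C(1) by (intro mult_left_mono) auto
    finally have e1: "energy1 f \<le> C / r * tot f" .
    have "avg (var2 f) \<le> avg (\<lambda>_. (real c)\<^sup>2 * card (D (2 * r + c)))"
      by (intro avg_mono v2) (auto simp: K_def S_def simp del: mult_DA)
    also have "\<dots> = (real c)\<^sup>2 * card (D (2 * r + c))" by (rule avg_const)
    also have "\<dots> \<le> (real c)\<^sup>2 * ((2 + 2 * c) * ((2 * r + 1) * N))" by (intro mult_left_mono DD) auto
    also have "\<dots> = (real c)\<^sup>2 * (2 + 2 * c) * ((2 * r + 1) * N)" by simp
    also have "\<dots> \<le> C * ((2 * r + 1) * N)" using C(4) N by (intro mult_right_mono) auto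
    also have "\<dots> = C / (real r)\<^sup>2 * ((real r)\<^sup>2 * ((2 * r + 1) * N))" using r by simp
    also have "\<dots> \<le> C / (real r)\<^sup>2 * tot (\<lambda>x. (f x)\<^sup>2)" using t2 C(1) by (intro mult_left_mono) auto
    finally have e2: "avg (var2 f) \<le> C / (real r)\<^sup>2 * tot (\<lambda>x. (f x)\<^sup>2)" .
    have "real (card (supp f)) \<le> card (D (2 * r))" using card_mono[OF D(1) suppf] by simp
    also have "\<dots> = (4 * r + 1) * N" by (simp add: D(2))
    also have "\<dots> \<le> exp (4 * r) * exp (B * b ^ r)"
    proof (rule mult_mono)
      show "real (4 * r + 1) \<le> exp (4 * r)" using exp_ge_add_one_self[of "4 * real r"] by simp
      have "N \<le> real ((q ^ q) ^ ((2 * q) ^ (2 * R)))"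
        unfolding N_def using window_hor_card(2)[OF q] by (simp only: of_nat_le_iff)
      also have "\<dots> = exp (ln q) ^ (q * (2 * q) ^ (2 * R))" using q by (simp add: power_mult)
      also have "\<dots> = exp (real (q * (2 * q) ^ (2 * R)) * ln q)" by (simp only: exp_of_nat_mult)
      also have "real (q * (2 * q) ^ (2 * R)) * ln q = B * b ^ r"
      proof -
        have "2 * R = 2 * R0 + 4 * r" by (simp add: R_def)
        then have "(2 * real q) ^ (2 * R) = (2 * real q) ^ (2 * R0) * b ^ r"
          unfolding b_def by (simp only: power_add power_mult)
        then show ?thesis by (simp add: B_def mult_ac)
      qed
      finally show "N \<le> exp (B * b ^ r)" .
    qed (use N in auto)
    also have "\<dots> = exp (4 * r + B * b ^ r)" by (simp add: exp_add)
    also have "\<dots> \<le> exp (exp (C * r))"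
    proof -
      have "real r \<le> 2 ^ r" using less_exp[of r] by (metis less_imp_le of_nat_le_iff of_nat_numeral of_nat_power)
      also have "\<dots> \<le> b ^ r" using b by (intro power_mono) auto
      finally have "4 * r + B * b ^ r \<le> (4 + B) * b ^ r" by (simp add: algebra_simps)
      also have "\<dots> \<le> (4 + B) ^ r * b ^ r"
        using B b r power_increasing[of 1 r "4 + B"] by (intro mult_right_mono) auto
      also have "\<dots> = exp (ln (4 + B)) ^ r * exp (ln b) ^ r" using B b by simp
      also have "\<dots> = exp ((ln (4 + B) + ln b) * r)"
        by (simp only: exp_of_nat_mult[symmetric] exp_add[symmetric]) (simp add: algebra_simps)
      also have "\<dots> \<le> exp (C * r)" using C(2) by (simp add: mult_right_mono)
      finally show ?thesis by simp
    qed
    finally have "real (card (supp f)) \<le> exp (exp (C * r))" .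
    then show ?thesis using fs f_nn e1 e2 t1 t2 pos by (intro exI[of _ f]) auto
  qed
  then show ?thesis using C(1) by blast
qed

end

subsection \<open>Asymptotics\<close>

lemma nat_round_bounds:
  fixes t :: real
  assumes "t \<ge> 1"
  shows "real (nat (round t)) \<le> 2 * t" "t / 2 \<le> real (nat (round t))"
    "t - 1 \<le> real (nat (round t))"
proof -
  have "round t \<ge> 1" using assms round_mono[of 1 t] by simp
  then have "real (nat (round t)) = of_int (round t)" by simp
  then show "real (nat (round t)) \<le> 2 * t" "t / 2 \<le> real (nat (round t))" "t - 1 \<le> real (nat (round t))"
    using of_int_round_abs_le[of t] assms by linarith+
qed

text \<open>The relation permits rescaling of the argument and a factor in front, but no constant in
  the exponent. So \<open>c\<close> has to become a rescaling of \<open>t\<close>, which changes the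
  squared logarithm by a bounded factor only.\<close>

lemma rounded_upper:
  fixes u :: "nat \<Rightarrow> real" and c :: real
  assumes "c > 0" and u: "\<forall>\<^sub>F n in sequentially. u n \<le> exp (- (c * real n / (ln n)\<^sup>2))"
  shows "rounded u \<lesssim> (\<lambda>t. exp (- t / (ln t)\<^sup>2))"
proof -
  obtain n0 where n0: "\<And>n. n \<ge> n0 \<Longrightarrow> u n \<le> exp (- (c * real n / (ln n)\<^sup>2))"
    using u by (auto simp: eventually_sequentially)
  \<comment> \<open>One factor 2 is lost by rounding, \<open>n\<close> being at least
    \<open>t / 2\<close>, and another in the comparison of squared logarithms.\<close>
  define d where "d = c / 4"
  have d: "d > 0" using assms(1) by (simp add: d_def)
  have "\<forall>\<^sub>F t in at_top. (ln (2 * t))\<^sup>2 \<le> 2 * (ln (d * t))\<^sup>2" using d by real_asymp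
  moreover have "\<forall>\<^sub>F t in at_top. t \<ge> max 4 (real n0 + 1)" by (rule eventually_ge_at_top)
  ultimately have "\<forall>\<^sub>F t in at_top. rounded u t \<le> 1 * exp (- (d * t) / (ln (d * t))\<^sup>2)"
  proof eventually_elim
    case (elim t)
    define n where "n = nat (round t)"
    have n: "real n \<le> 2 * t" "t / 2 \<le> real n" "t - 1 \<le> real n"
      unfolding n_def using nat_round_bounds[of t] elim by auto
    have lnn: "ln n > 0" using n(2) elim by (subst ln_gt_zero_iff) auto
    have "ln n \<le> ln (2 * t)" using n elim by (subst ln_le_cancel_iff) auto
    then have "(ln n)\<^sup>2 \<le> (ln (2 * t))\<^sup>2" using lnn by (intro power_mono) auto
    then have *: "(ln n)\<^sup>2 \<le> 2 * (ln (d * t))\<^sup>2" using elim by linarith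
    have "d * t / (ln (d * t))\<^sup>2 = c * (t / 2) / (2 * (ln (d * t))\<^sup>2)" by (simp add: d_def)
    also have "\<dots> \<le> c * (t / 2) / (ln n)\<^sup>2"
    proof (rule divide_left_mono[OF *])
      have "0 < 2 * (ln (d * t))\<^sup>2" by (rule less_le_trans[OF _ *]) (use lnn in simp)
      then show "0 < 2 * (ln (d * t))\<^sup>2 * (ln n)\<^sup>2" using lnn by simp
    qed (use assms(1) elim in auto)
    also have "\<dots> \<le> c * real n / (ln n)\<^sup>2" using n assms(1) by (intro divide_right_mono mult_left_mono) auto
    finally have "exp (- (c * real n / (ln n)\<^sup>2)) \<le> exp (- (d * t / (ln (d * t))\<^sup>2))" by simp
    moreover have "n \<ge> n0" using n(3) elim by simp
    ultimately have "u n \<le> exp (- (d * t / (ln (d * t))\<^sup>2))" using n0[of n] by linarith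
    then show ?case by (simp add: rounded_def n_def)
  qed
  then show ?thesis unfolding asymp_le_def using d by (intro exI[of _ 1] conjI exI[of _ d]) auto
qed

lemma rounded_lower:
  fixes u :: "nat \<Rightarrow> real" and D :: real
  assumes "D > 0" and u: "\<forall>\<^sub>F n in sequentially. exp (- (D * real n / (ln n)\<^sup>2)) \<le> u n"
  shows "(\<lambda>t. exp (- t / (ln t)\<^sup>2)) \<lesssim> rounded u"
proof -
  obtain n0 where n0: "\<And>n. n \<ge> n0 \<Longrightarrow> exp (- (D * real n / (ln n)\<^sup>2)) \<le> u n"
    using u by (auto simp: eventually_sequentially)
  \<comment> \<open>Again a factor 2 for rounding, now from \<open>n \<le> 2 * (d * t)\<close>, and
    a factor 2 for the logarithms.\<close>
  define d where "d = 1 / (4 * D)"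
  have d: "d > 0" using assms(1) by (simp add: d_def)
  have "\<forall>\<^sub>F t in at_top. (ln t)\<^sup>2 \<le> 2 * (ln (d * t / 2))\<^sup>2" using d by real_asymp
  moreover have "\<forall>\<^sub>F t in at_top. d * t \<ge> max 4 (real n0 + 1)" using d by real_asymp
  moreover have "\<forall>\<^sub>F t in at_top. (t::real) > 1" by (rule eventually_gt_at_top)
  ultimately have "\<forall>\<^sub>F t in at_top. exp (- t / (ln t)\<^sup>2) \<le> 1 * rounded u (d * t)"
  proof eventually_elim
    case (elim t)
    define n where "n = nat (round (d * t))"
    have n: "real n \<le> 2 * (d * t)" "d * t / 2 \<le> real n" "d * t - 1 \<le> real n"
      unfolding n_def using nat_round_bounds[of "d * t"] elim by auto
    have ln0: "ln (d * t / 2) > 0" using elim by (subst ln_gt_zero_iff) auto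
    have "ln (d * t / 2) \<le> ln n" using n elim by (subst ln_le_cancel_iff) auto
    then have "(ln (d * t / 2))\<^sup>2 \<le> (ln n)\<^sup>2" using ln0 by (intro power_mono) auto
    then have *: "(ln t)\<^sup>2 / 2 \<le> (ln n)\<^sup>2" using elim by linarith
    have lnt: "ln t > 0" using elim by simp
    have "D * real n / (ln n)\<^sup>2 \<le> D * real n / ((ln t)\<^sup>2 / 2)"
    proof (rule divide_left_mono[OF *])
      have "0 < (ln n)\<^sup>2" by (rule less_le_trans[OF _ *]) (use lnt in simp)
      then show "0 < (ln n)\<^sup>2 * ((ln t)\<^sup>2 / 2)" using lnt by simp
    qed (use assms(1) in auto)
    also have "\<dots> \<le> D * (2 * (d * t)) / ((ln t)\<^sup>2 / 2)"
      using n assms(1) by (intro divide_right_mono mult_left_mono) auto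
    also have "\<dots> = t / (ln t)\<^sup>2" using assms(1) by (simp add: d_def)
    finally have "exp (- (t / (ln t)\<^sup>2)) \<le> exp (- (D * real n / (ln n)\<^sup>2))" by simp
    moreover have "n \<ge> n0" using n(3) elim by simp
    ultimately have "exp (- (t / (ln t)\<^sup>2)) \<le> u n" using n0[of n] by linarith
    then show ?case by (simp add: rounded_def n_def)
  qed
  then show ?thesis unfolding asymp_le_def using d by (intro exI[of _ 1] conjI exI[of _ d]) auto
qed

lemma log2_le: "x \<ge> 1 \<Longrightarrow> log 2 x \<le> 2 * ln x"
proof -
  assume "x \<ge> 1"
  then have "ln x * 1 \<le> ln x * (2 * ln 2)" using ln2_ge_two_thirds by (intro mult_left_mono) auto
  then show ?thesis by (simp add: log_def pos_divide_le_eq)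
qed

lemma nat_ceiling_log2:
  assumes "x \<ge> 1"
  shows "x \<le> 2 ^ nat \<lceil>log 2 x\<rceil>" "real (nat \<lceil>log 2 x\<rceil>) + 1 \<le> 2 * ln x + 2"
proof -
  have l: "log 2 x \<ge> 0" using assms by simp
  then have c: "real (nat \<lceil>log 2 x\<rceil>) = of_int \<lceil>log 2 x\<rceil>" by simp
  have "x = 2 powr (log 2 x)" using assms by simp
  also have "\<dots> \<le> 2 powr real (nat \<lceil>log 2 x\<rceil>)" using c by (intro powr_mono) auto
  finally show "x \<le> 2 ^ nat \<lceil>log 2 x\<rceil>" by (simp add: powr_realpow)
  show "real (nat \<lceil>log 2 x\<rceil>) + 1 \<le> 2 * ln x + 2" unfolding c using log2_le[OF assms] by linarith
qed

section \<open>From energies to the profile\<close>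

context symmetric_walk
begin

lemma profile_eq:
  "isoperimetric_profile G \<mu> v =
     (INF f \<in> {f. fin_supp f \<and> real (card (supp f)) \<le> v \<and> tot (\<lambda>x. \<bar>f x\<bar>) = 1}. 1 / 2 * energy1 f)"
  unfolding isoperimetric_profile_def supp_def[symmetric] tot_def[symmetric]
  by (intro INF_cong refl) (auto simp: infsum_energy1)

lemma energy1_nonneg: "energy1 f \<ge> 0"
  unfolding energy1_def by (intro sum_nonneg mult_nonneg_nonneg var1_nonneg) auto

lemma profile_ge:
  assumes "v \<ge> 1"
    "\<And>f. fin_supp f \<Longrightarrow> real (card (supp f)) \<le> v \<Longrightarrow> tot (\<lambda>x. \<bar>f x\<bar>) = 1 \<Longrightarrow> b \<le> energy1 f / 2"
  shows "b \<le> isoperimetric_profile G \<mu> v"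
  unfolding profile_eq
proof (rule cINF_greatest)
  \<comment> \<open>The point mass at the identity shows that the infimum is over a nonempty set; it
    is admissible because v \<ge> 1.\<close>
  have supp0: "supp (heat 0) = {\<one>}" by (auto simp: supp_def heat_0)
  have "tot (\<lambda>x. \<bar>heat 0 x\<bar>) = 1" using tot_heat[of 0] heat_nonneg by simp
  then show "{f. fin_supp f \<and> real (card (supp f)) \<le> v \<and> tot (\<lambda>x. \<bar>f x\<bar>) = 1} \<noteq> {}"
    using assms(1) supp0 by (intro ex_in_conv[THEN iffD1] exI[of _ "heat 0"]) simp
qed (use assms(2) in auto)

lemma profile_le:
  assumes f: "fin_supp f" "\<And>x. f x \<ge> 0" "tot f > 0" "real (card (supp f)) \<le> v"
  shows "isoperimetric_profile G \<mu> v \<le> energy1 f / (2 * tot f)"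
proof -
  define g where "g = (\<lambda>x. (1 / tot f) * f x)"
  have supp: "supp g = supp f" using f(3) by (auto simp: supp_def g_def)
  have "tot (\<lambda>x. \<bar>g x\<bar>) = tot g" using f(2,3) by (intro tot_cong) (simp add: g_def)
  also have "\<dots> = 1" unfolding g_def tot_cmult using f(3) by simp
  finally have tg: "tot (\<lambda>x. \<bar>g x\<bar>) = 1" .
  have "var1 g a = (1 / tot f) * var1 f a" for a
  proof -
    have "var1 g a = tot (\<lambda>x. (1 / tot f) * \<bar>f x - f (x \<otimes> a)\<bar>)"
      unfolding var1_def g_def using f(3)
      by (intro tot_cong) (simp add: diff_divide_distrib[symmetric])
    then show ?thesis unfolding tot_cmult var1_def .
  qed
  then have "energy1 g = (1 / tot f) * energy1 f"
    unfolding energy1_def by (simp add: sum_distrib_left mult_ac)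
  then have eg: "1 / 2 * energy1 g = energy1 f / (2 * tot f)" by simp
  have "isoperimetric_profile G \<mu> v \<le> 1 / 2 * energy1 g"
    unfolding profile_eq
  proof (rule cINF_lower)
    show "bdd_below ((\<lambda>f. 1 / 2 * energy1 f) ` {f. fin_supp f \<and> real (card (supp f)) \<le> v \<and> tot (\<lambda>x. \<bar>f x\<bar>) = 1})"
      by (rule bdd_belowI[of _ 0]) (use energy1_nonneg in auto)
  qed (use f supp tg in auto)
  then show ?thesis using eg by simp
qed

end

context DA_walk
begin

lemma profile_asymp: "isoperimetric_profile (DA q) \<mu> \<simeq> (\<lambda>v. 1 / ln (ln v))"
proof -
  obtain c where c: "c > 0" "c \<le> 1" and iso: "\<And>r f. fin_supp f \<Longrightarrow> 4 * log 2 (card (supp f)) \<le> 2 ^ r \<Longrightarrow>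
     c / (real r + 1) * tot (\<lambda>x. \<bar>f x\<bar>) \<le> avg (var1 f)" using isoperimetry by blast
  obtain C where C: "C > 0" and test: "\<And>r. r \<ge> 1 \<Longrightarrow> \<exists>f. fin_supp f \<and> (\<forall>x. f x \<ge> 0) \<and> tot f > 0 \<and>
     tot (\<lambda>x. (f x)\<^sup>2) > 0 \<and> real (card (supp f)) \<le> exp (exp (C * real r)) \<and> energy1 f \<le> C / real r * tot f \<and>
     avg (var2 f) \<le> C / (real r)\<^sup>2 * tot (\<lambda>x. (f x)\<^sup>2)" using test_function by blast
  have "\<forall>\<^sub>F v::real in at_top. 2 * ln (8 * ln v) + 2 \<le> 4 * ln (ln v)" by real_asymp
  moreover have "\<forall>\<^sub>F v::real in at_top. ln v \<ge> 1" by real_asymp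
  moreover have "\<forall>\<^sub>F v::real in at_top. v \<ge> 3" by (rule eventually_ge_at_top)
  moreover have "\<forall>\<^sub>F v::real in at_top. ln (ln v) > 0" by real_asymp
  ultimately have lower: "\<forall>\<^sub>F v in at_top. 1 / ln (ln v) \<le> 16 / c * isoperimetric_profile (DA q) \<mu> (1 * v)"
  proof eventually_elim
    case (elim v)
    \<comment> \<open>The cube must have dimension at least 4 log2 v, which \<open>log2_le\<close>
      bounds by 8 ln v.\<close>
    define r where "r = nat \<lceil>log 2 (8 * ln v)\<rceil>"
    have r: "4 * log 2 v \<le> 2 ^ r" "real r + 1 \<le> 4 * ln (ln v)"
      using nat_ceiling_log2[of "8 * ln v"] log2_le[of v] elim unfolding r_def by linarith+
    \<comment> \<open>16 is 4 from the bound on \<open>r + 1\<close>, times 2 from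
      \<open>avg_var1_le\<close>, times 2 from the factor 1 / 2 in the profile.\<close>
    have "c / (16 * ln (ln v)) \<le> isoperimetric_profile (DA q) \<mu> v"
    proof (rule profile_ge)
      fix f assume f: "fin_supp f" "real (card (supp f)) \<le> v" "tot (\<lambda>x. \<bar>f x\<bar>) = 1"
      have "log 2 (card (supp f)) \<le> log 2 v"
      proof (cases "card (supp f) = 0")
        case True then show ?thesis using elim by (simp add: log_def)
      next
        case False then show ?thesis using f(2) elim by (subst log_le_cancel_iff) auto
      qed
      then have "c / (real r + 1) * 1 \<le> avg (var1 f)" using iso[OF f(1), of r] r(1) f(3) by simp
      also have "\<dots> \<le> 2 * energy1 f" by (rule avg_var1_le[OF f(1)])
      finally have "c / (real r + 1) \<le> 2 * energy1 f" by simp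
      moreover have "c / (4 * ln (ln v)) \<le> c / (real r + 1)"
        using r(2) c elim by (intro divide_left_mono) auto
      ultimately have "c / (4 * ln (ln v)) \<le> 2 * energy1 f" by (rule order.trans[rotated])
      then have "1 / 4 * (c / (4 * ln (ln v))) \<le> 1 / 4 * (2 * energy1 f)" by (rule mult_left_mono) simp
      then show "c / (16 * ln (ln v)) \<le> energy1 f / 2" by simp
    qed (use elim in auto)
    then have "16 / c * (c / (16 * ln (ln v))) \<le> 16 / c * isoperimetric_profile (DA q) \<mu> v"
      using c by (intro mult_left_mono) auto
    then show ?case using c by simp
  qed
  have "\<forall>\<^sub>F v::real in at_top. ln (ln v) \<ge> 2 * C" using C by real_asymp
  moreover have "\<forall>\<^sub>F v::real in at_top. v \<ge> 3" by (rule eventually_ge_at_top)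
  moreover have "\<forall>\<^sub>F v::real in at_top. ln v > 0" by real_asymp
  ultimately have upper: "\<forall>\<^sub>F v in at_top. isoperimetric_profile (DA q) \<mu> v \<le> C\<^sup>2 * (1 / ln (ln (1 * v)))"
  proof eventually_elim
    case (elim v)
    \<comment> \<open>The real solution of exp (exp (C y)) = v; its integer part keeps the support
      of the test function within \<open>v\<close>.\<close>
    define y where "y = ln (ln v) / C"
    define r where "r = nat \<lfloor>y\<rfloor>"
    have y: "y \<ge> 2" using elim C by (simp add: y_def field_simps)
    then have "real r = of_int \<lfloor>y\<rfloor>" by (simp add: r_def)
    then have r: "real r \<le> y" "2 * real r \<ge> y" "r \<ge> 1" using y by linarith+
    obtain f where f: "fin_supp f" "\<forall>x. f x \<ge> 0" "tot f > 0" "real (card (supp f)) \<le> exp (exp (C * real r))"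
      "energy1 f \<le> C / real r * tot f" using test[OF r(3)] by blast
    have "C * real r \<le> ln (ln v)" using r(1) C by (simp add: y_def field_simps)
    then have "exp (exp (C * real r)) \<le> exp (exp (ln (ln v)))" by simp
    also have "\<dots> = v" using elim by simp
    finally have "isoperimetric_profile (DA q) \<mu> v \<le> energy1 f / (2 * tot f)"
      using f by (intro profile_le) auto
    also have "\<dots> \<le> C / real r * tot f / (2 * tot f)" using f by (intro divide_right_mono) auto
    also have "\<dots> = C / (2 * real r)" using f(3) by simp
    also have "\<dots> \<le> C / y" using r(2) y C by (intro divide_left_mono mult_pos_pos) linarith+
    also have "\<dots> = C\<^sup>2 * (1 / ln (ln (1 * v)))" by (simp add: y_def power2_eq_square)
    finally show ?case .
  qed
  show ?thesis
    unfolding asymp_equiv_scaled_def asymp_le_def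
  proof (intro conjI exI)
    show "\<forall>\<^sub>F v in at_top. isoperimetric_profile (DA q) \<mu> v \<le> C\<^sup>2 * (1 / ln (ln (1 * v)))" by (rule upper)
    show "\<forall>\<^sub>F v in at_top. 1 / ln (ln v) \<le> 16 / c * isoperimetric_profile (DA q) \<mu> (1 * v)" by (rule lower)
  qed (use c C in auto)
qed

section \<open>The return probability\<close>

lemma return_upper_asymp:
  "\<exists>c>0. \<forall>\<^sub>F n in sequentially. heat (2 * n) \<one>\<^bsub>DA q\<^esub> \<le> exp (- (c * real n / (ln n)\<^sup>2))"
proof -
  obtain c where c: "c > 0" "c \<le> 1" and iso: "\<And>r f. fin_supp f \<Longrightarrow> 4 * log 2 (card (supp f)) \<le> 2 ^ r \<Longrightarrow>
     c / (real r + 1) * tot (\<lambda>x. \<bar>f x\<bar>) \<le> avg (var1 f)" using isoperimetry by blast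
  have "\<forall>\<^sub>F n::nat in sequentially. 2 * ln (4 * (2 + 2 * real n)) + 2 \<le> 4 * ln n" by real_asymp
  moreover have "\<forall>\<^sub>F n::nat in sequentially. n \<ge> 2" by (rule eventually_ge_at_top)
  \<comment> \<open>256 is 16 from \<open>return_upper\<close> times the square of 4 from the bound
    \<kappa> \<ge> c / (4 ln n).\<close>
  ultimately have "\<forall>\<^sub>F n in sequentially. heat (2 * n) \<one>\<^bsub>DA q\<^esub> \<le> exp (- (c\<^sup>2 / 256 * n / (ln n)\<^sup>2))"
  proof eventually_elim
    case (elim n)
    \<comment> \<open>Four times a bound for the binary logarithm of 4 e^n, the largest support that
      \<open>return_upper\<close> asks about.\<close>
    define x where "x = 4 * (2 + 2 * real n)"
    define r where "r = nat \<lceil>log 2 x\<rceil>"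
    have "x \<ge> 1" by (simp add: x_def)
    note cl = nat_ceiling_log2[OF this]
    have r: "x \<le> 2 ^ r" "real r + 1 \<le> 4 * ln n"
      using cl elim unfolding r_def by (simp_all add: x_def)
    define \<kappa> where "\<kappa> = c / (real r + 1)"
    have \<kappa>: "\<kappa> > 0" "\<kappa> \<le> 1" using c by (auto simp: \<kappa>_def)
    have "heat (2 * n) \<one>\<^bsub>DA q\<^esub> \<le> exp (- (\<kappa>\<^sup>2 / 16 * n))"
    proof (rule return_upper[OF \<kappa>])
      fix g assume g: "fin_supp g" "real (card (supp g)) \<le> 4 * exp (real n)"
      have "log 2 (card (supp g)) \<le> 2 + 2 * real n"
      proof (cases "card (supp g) = 0")
        case True then show ?thesis by (simp add: log_def)
      next
        case False
        then have "log 2 (card (supp g)) \<le> log 2 (4 * exp (real n))" using g(2) by (subst log_le_cancel_iff) auto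
        also have "\<dots> = log 2 (2 ^ 2) + log 2 (exp (real n))" by (subst log_mult) auto
        also have "\<dots> \<le> 2 + 2 * real n" using log2_le[of "exp (real n)"] by (subst log_nat_power) auto
        finally show ?thesis .
      qed
      then have "4 * log 2 (card (supp g)) \<le> 2 ^ r" using r(1) by (simp add: x_def)
      then show "\<kappa> * tot (\<lambda>x. \<bar>g x\<bar>) \<le> avg (var1 g)" unfolding \<kappa>_def by (rule iso[OF g(1)])
    qed
    also have "\<dots> \<le> exp (- (c\<^sup>2 / 256 * n / (ln n)\<^sup>2))"
    proof -
      have "c / (4 * ln n) \<le> \<kappa>" unfolding \<kappa>_def using r(2) c elim by (intro divide_left_mono) auto
      then have "(c / (4 * ln n))\<^sup>2 \<le> \<kappa>\<^sup>2" using c elim by (intro power_mono) auto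
      then have "(c / (4 * ln n))\<^sup>2 / 16 * n \<le> \<kappa>\<^sup>2 / 16 * n" by (intro mult_right_mono) auto
      moreover have "(c / (4 * ln n))\<^sup>2 / 16 * n = c\<^sup>2 / 256 * n / (ln n)\<^sup>2"
        by (simp add: power_divide power_mult_distrib)
      ultimately show ?thesis by simp
    qed
    finally show ?case .
  qed
  then show ?thesis using c by (intro exI[of _ "c\<^sup>2 / 256"]) auto
qed

text \<open>The loss \<delta> per step is of order 1 / r^2, and the support costs exp (C r) in the
  exponent. With \<open>r\<close> at most (ln n) / (2 C) this cost is at most sqrt n, which is below
  n / (ln n)^2, while n \<delta> is of order n / (ln n)^2.\<close>

lemma return_lower_asymp:
  "\<exists>D>0. \<forall>\<^sub>F n in sequentially. exp (- (D * real n / (ln n)\<^sup>2)) \<le> heat (2 * n) \<one>\<^bsub>DA q\<^esub>"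
proof -
  obtain C where C: "C > 0" and test: "\<And>r. r \<ge> 1 \<Longrightarrow> \<exists>f. fin_supp f \<and> (\<forall>x. f x \<ge> 0) \<and> tot f > 0 \<and>
     tot (\<lambda>x. (f x)\<^sup>2) > 0 \<and> real (card (supp f)) \<le> exp (exp (C * real r)) \<and> energy1 f \<le> C / real r * tot f \<and>
     avg (var2 f) \<le> C / (real r)\<^sup>2 * tot (\<lambda>x. (f x)\<^sup>2)" using test_function by blast
  \<comment> \<open>The first term bounds the accumulated loss 2 \<delta> n through r \<ge> (ln n) /
    (4 C); the 1 accounts for the support.\<close>
  define D where "D = 16 * C ^ 3 + 1"
  have "\<forall>\<^sub>F n::nat in sequentially. ln n / (4 * C) \<ge> C + 1" using C by real_asymp
  moreover have "\<forall>\<^sub>F n::nat in sequentially. sqrt n \<le> n / (ln n)\<^sup>2" by real_asymp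
  moreover have "\<forall>\<^sub>F n::nat in sequentially. n \<ge> 2" by (rule eventually_ge_at_top)
  ultimately have "\<forall>\<^sub>F n in sequentially. exp (- (D * real n / (ln n)\<^sup>2)) \<le> heat (2 * n) \<one>\<^bsub>DA q\<^esub>"
  proof eventually_elim
    case (elim n)
    define y where "y = ln n / (4 * C)"
    define r where "r = nat \<lfloor>2 * y\<rfloor>"
    have y: "y \<ge> C + 1" using elim by (simp add: y_def)
    then have "real r = of_int \<lfloor>2 * y\<rfloor>" using C by (simp add: r_def)
    then have r: "real r \<le> 2 * y" "real r \<ge> y" "r \<ge> 1" using y C by linarith+
    obtain f where f: "fin_supp f" "\<And>x. f x \<ge> 0" "tot (\<lambda>x. (f x)\<^sup>2) > 0"
      "real (card (supp f)) \<le> exp (exp (C * real r))"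
      "avg (var2 f) \<le> C / (real r)\<^sup>2 * tot (\<lambda>x. (f x)\<^sup>2)" using test[OF r(3)] by blast
    define \<delta> where "\<delta> = C / (2 * (real r)\<^sup>2)"
    \<comment> \<open>With r \<ge> 1 this gives C \<le> r^2, hence \<delta> \<le> 1 / 2, the range
      in which ln (1 - \<delta>) \<ge> - 2 \<delta> is derived.\<close>
    have "C \<le> real r * 1" using r(2) y by simp
    also have "\<dots> \<le> real r * real r" using r(3) by (intro mult_left_mono) auto
    finally have \<delta>: "\<delta> \<ge> 0" "\<delta> \<le> 1 / 2"
      using C r(3) by (auto simp: \<delta>_def power2_eq_square field_simps)
    have "(1 - \<delta>) ^ n \<le> card (supp f) * heat (2 * n) \<one>\<^bsub>DA q\<^esub>"
      by (rule return_lower[OF f(1-3)]) (use \<delta> f(5) in \<open>auto simp: \<delta>_def\<close>)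
    also have "\<dots> \<le> exp (exp (C * real r)) * heat (2 * n) \<one>\<^bsub>DA q\<^esub>"
      using f(4) by (intro mult_right_mono heat_nonneg)
    finally have main: "(1 - \<delta>) ^ n \<le> exp (exp (C * real r)) * heat (2 * n) \<one>\<^bsub>DA q\<^esub>" .
    have "- (2 * \<delta>) \<le> ln (1 - \<delta>)"
    proof -
      have "\<delta> * \<delta> \<le> \<delta> * (1 / 2)" using \<delta> by (intro mult_left_mono) auto
      then show ?thesis
        using ln_one_minus_pos_lower_bound[OF \<delta>] by (simp add: power2_eq_square)
    qed
    then have "exp (- (2 * \<delta>)) \<le> 1 - \<delta>" using \<delta> by (simp add: ln_ge_iff)
    then have "exp (- (2 * \<delta>)) ^ n \<le> (1 - \<delta>) ^ n" by (intro power_mono) auto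
    then have e: "exp (- (2 * \<delta> * n)) \<le> (1 - \<delta>) ^ n"
      by (simp only: exp_of_nat_mult[symmetric]) (simp add: mult_ac)
    have "2 * \<delta> * n + exp (C * real r) \<le> D * real n / (ln n)\<^sup>2"
    proof -
      have "2 * \<delta> * n = C * n / (real r)\<^sup>2" by (simp add: \<delta>_def)
      also have "\<dots> \<le> C * n / y\<^sup>2"
        using C r y by (intro divide_left_mono power_mono mult_pos_pos) auto
      also have "\<dots> = 16 * C ^ 3 * n / (ln n)\<^sup>2"
        using C by (simp add: y_def power_divide power_mult_distrib power2_eq_square power3_eq_cube)
      finally have 1: "2 * \<delta> * n \<le> 16 * C ^ 3 * n / (ln n)\<^sup>2" .
      have "C * real r \<le> C * (2 * y)" using r(1) C by (intro mult_left_mono) auto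
      also have "\<dots> = ln n / 2" using C by (simp add: y_def)
      finally have "exp (C * real r) \<le> exp (ln n / 2)" by simp
      also have "\<dots> = sqrt n"
        using elim powr_half_sqrt[of "real n"] by (simp add: powr_def)
      also have "\<dots> \<le> n / (ln n)\<^sup>2" using elim by simp
      finally show ?thesis using 1 by (simp add: D_def distrib_right add_divide_distrib)
    qed
    then have "exp (- (D * real n / (ln n)\<^sup>2)) \<le> exp (- (2 * \<delta> * n) - exp (C * real r))" by simp
    also have "\<dots> = exp (- (2 * \<delta> * n)) / exp (exp (C * real r))" by (rule exp_diff)
    also have "\<dots> \<le> heat (2 * n) \<one>\<^bsub>DA q\<^esub>"
      using e main by (simp add: field_simps)
    finally show ?case .
  qed
  moreover have "D > 0" using C by (simp add: D_def add_pos_pos)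
  ultimately show ?thesis by blast
qed

end

theorem proposition1p3:
  fixes q :: nat and \<mu> :: "(vertex \<Rightarrow> vertex) pmf"
  assumes "q \<ge> 2"
    and "set_pmf \<mu> \<subseteq> carrier (DA q)"
    and "finite (set_pmf \<mu>)"
    and "nondegenerate (DA q) \<mu>"
    and "symmetric_measure (DA q) \<mu>"
  shows "isoperimetric_profile (DA q) \<mu> \<simeq> (\<lambda>v. 1 / ln (ln v)) \<and>
         rounded (\<lambda>n. pmf (conv_power (DA q) \<mu> (2 * n)) \<one>\<^bsub>DA q\<^esub>) \<simeq> (\<lambda>t. exp (- t / (ln t)\<^sup>2))"
proof -
  have "q > 0" using assms(1) by simp
  interpret group "DA q" by (rule group_DA) fact
  interpret DA_walk q \<mu> by unfold_locales (rule assms)+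
  obtain c D where "c > 0" "D > 0"
    and upper: "\<forall>\<^sub>F n in sequentially. heat (2 * n) \<one>\<^bsub>DA q\<^esub> \<le> exp (- (c * real n / (ln n)\<^sup>2))"
    and lower: "\<forall>\<^sub>F n in sequentially. exp (- (D * real n / (ln n)\<^sup>2)) \<le> heat (2 * n) \<one>\<^bsub>DA q\<^esub>"
    using return_upper_asymp return_lower_asymp by blast
  have "rounded (\<lambda>n. heat (2 * n) \<one>\<^bsub>DA q\<^esub>) \<simeq> (\<lambda>t. exp (- t / (ln t)\<^sup>2))"
    unfolding asymp_equiv_scaled_def
    using rounded_upper[OF \<open>c > 0\<close> upper] rounded_lower[OF \<open>D > 0\<close> lower] ..
  with profile_asymp show ?thesis unfolding heat_def ..
qed

end
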